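(* Let $\nu>0$ be fixed, and let $\rho_k\to\rho\ge0$ and $h_k\to h\ge0$ be sequences of nonnegative numbers, each of which is either constant or convergent to $0$. Let $(u,z)_{\rho,\nu,h}$ denote the incremental solution on the fixed partition (see context). Then, for all $t\in[0,T]$, $$(u(t),z(t))_{\rho_k,\nu,h_k}\to(u(t),z(t))_{\rho,\nu,h}\quad\text{strongly in }\mathcal Y^\nu.$$
   Context: Tensors: $\mathbb R^{3\times3}_{\rm sym}$ is the space of symmetric $3\times3$ matrices with $a:b=\mathrm{tr}(ab)$ and norm $|\cdot|$; $\mathbb R^{3\times3}_{\rm dev}$ is its trace-free subspace. $\mathbb C:\mathbb R^{3\times3}_{\rm sym}\to\mathbb R^{3\times3}_{\rm sym}$ is linear, symmetric, positive definite, and leaves $\mathbb R^{3\times3}_{\rm dev}$ and $\mathbb R 1_2$ invariant. Domain: $\Omega\subset\mathbb R^3$ is nonempty, bounded, connected, open, with Lipschitz boundary; $\Gamma_{\rm Dir},\Gamma_{\rm tr}$ are disjoint relatively open subsets partitioning $\partial\Omega$ with common relative boundary, and Korn's inequality $c_0\|u\|_{H^1}^2\le\|u\|^2_{L^2(\Gamma_{\rm Dir})}+\|\varepsilon(u)\|^2_{L^2(\Omega)}$ holds on $H^1(\Omega;\mathbb R^3)$ with some $c_0>0$. Energy: $c_1,c_2,c_3>0$; $F_0(a)=c_1|a|+c_2|a|^2+I(a)$ on $\mathbb R^{3\times3}_{\rm dev}$, $I(a)=0$ if $|a|\le c_3$, $+\infty$ otherwise. For $\rho>0$, $F_\rho(a)=c_1(\sqrt{\rho^2+|a|^2}-\rho)+c_2|a|^2+\varphi(|a|)/\rho$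 with a fixed $\varphi\in C^{2,1}(\mathbb R)$, convex, non-decreasing, $\varphi'\in L^\infty(\mathbb R)$, $\varphi(r)=0$ iff $r\le c_3$. For $\nu>0$: $\mathcal U=H^1(\Omega;\mathbb R^3)$, $\mathcal Z^\nu=H^1(\Omega;\mathbb R^{3\times3}_{\rm dev})$, $\mathcal Y^\nu=\mathcal U\times\mathcal Z^\nu$, $\mathcal Y^\nu(\bar u)=\{(u,z)\in\mathcal Y^\nu:u=\bar u\text{ on }\Gamma_{\rm Dir}\}$, $\mathcal W_{\rho,\nu}(u,z)=\frac12\int_\Omega\mathbb C(\varepsilon(u)-z):(\varepsilon(u)-z)+\int_\Omega(F_\rho(z)+\frac\nu2|\nabla z|^2)$. $D:\mathbb R^{3\times3}_{\rm dev}\to[0,\infty)$ is lower semicontinuous, positively 1-homogeneous, subadditive, with $D(a)\ge c_D|a|$, $c_D>0$; $\mathcal D(a)=\int_\Omega D(a)\,dx$. Space approximation: for $h>0$, $\mathcal Y^\nu_h=\mathcal U_h\times\mathcal Z^\nu_h\subset\mathcal Y^\nu$ are closed subspaces, non-decreasing as $h$ decreases, with union dense in $\mathcal Y^\nu$. $\mathcal Y^\nu_{h,0}=\mathcal Y^\nu_h\cap\mathcal Y^\nu(0)$, with $\bigcup_{h>0}\mathcal Y^\nu_{h,0}$ dense in $\mathcal Y^\nu(0)$; for $h=0$ put $\mathcal Y^\nu_{h,0}=\mathcal Y^\nu(0)$. There are operators $q_h:\mathcal U\to\mathcal U_h$, $r^\nu_h:\mathcal Z^\nu\to\mathcal Z^\nu_h$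 converging pointwise to the identity as $h\to0$, and $|z|\le c_3$ a.e. implies $|r^\nu_h(z)|\le c_3$ a.e. Incremental problem: a partition $0=t_0<\dots<t_N=T$ is fixed. Data independent of $\rho,\nu,h$: $u^{{\rm Dir},i}\in H^1(\Omega;\mathbb R^3)$ (belonging to $\mathcal U_h$ for the $h>0$ considered), $\ell^i\in(H^1(\Omega;\mathbb R^3))'$, $i=0,\dots,N$, and an initial datum $(u^0,z^0)\in(u^{{\rm Dir},0},0)+\mathcal Y^\nu_{h,0}$ for all $h$ considered. For $i=1,\dots,N$, $(u^i,z^i)$ is the unique minimizer of $\mathcal W_{\rho,\nu}(u,z)-\langle\ell^i,u\rangle+\mathcal D(z-z^{i-1})$ over $(u^{{\rm Dir},i},0)+\mathcal Y^\nu_{h,0}$. $(u,z)_{\rho,\nu,h}$ is the right-continuous piecewise constant interpolant on the partition (value $(u^i,z^i)$ on $[t_i,t_{i+1})$, and $(u^N,z^N)$ at $T$). *)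

theory Defs
  imports "HOL-Analysis.Analysis"
begin

section \<open>Tensors\<close>

type_synonym vec3 = "real^3"
type_synonym tensor3 = "real^3^3"

definition sym3 :: "tensor3 set" where
  "sym3 = {a. transpose a = a}"

definition dev3 :: "tensor3 set" where
  "dev3 = {a \<in> sym3. trace a = 0}"

text \<open>The product $a:b$ of symmetric matrices and the norm it induces are the library's inner
  product and (Frobenius) norm.\<close>

lemma inner_eq_trace:
  assumes "a \<in> sym3" "b \<in> sym3"
  shows "a \<bullet> b = trace (a ** b)"
proof -
  have "b $ k $ i = b $ i $ k" for i k
    using assms(2) unfolding sym3_def transpose_def by (auto simp: vec_eq_iff)
  then show ?thesis
    by (simp add: inner_vec_def trace_def matrix_matrix_mult_def)
qed

definition elasticity_tensor :: "(tensor3 \<Rightarrow> tensor3) \<Rightarrow> bool" where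
  "elasticity_tensor \<C> \<longleftrightarrow>
     (\<forall>a\<in>sym3. \<C> a \<in> sym3) \<and>
     (\<forall>a\<in>sym3. \<forall>b\<in>sym3. \<C> (a + b) = \<C> a + \<C> b) \<and>
     (\<forall>a\<in>sym3. \<forall>s. \<C> (s *\<^sub>R a) = s *\<^sub>R \<C> a) \<and>
     (\<forall>a\<in>sym3. \<forall>b\<in>sym3. \<C> a \<bullet> b = a \<bullet> \<C> b) \<and>
     (\<forall>a\<in>sym3. a \<noteq> 0 \<longrightarrow> 0 < \<C> a \<bullet> a) \<and>
     \<C> ` dev3 \<subseteq> dev3 \<and>
     \<C> ` span {mat 1} \<subseteq> span {mat 1}"

section \<open>The Sobolev space\<close>

text \<open>Functions of class \<open>C\<^sup>n\<close> on the whole space, by recursion over directional derivatives.\<close>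

primrec Cn :: "nat \<Rightarrow> ('a::euclidean_space \<Rightarrow> 'b::euclidean_space) \<Rightarrow> bool" where
  "Cn 0 f \<longleftrightarrow> continuous_on UNIV f"
| "Cn (Suc n) f \<longleftrightarrow>
     (\<forall>x. f differentiable (at x)) \<and> (\<forall>v. Cn n (\<lambda>x. frechet_derivative f (at x) v))"

definition smooth :: "('a::euclidean_space \<Rightarrow> 'b::euclidean_space) \<Rightarrow> bool" where
  "smooth f \<longleftrightarrow> (\<forall>n. Cn n f)"

definition test_function :: "vec3 set \<Rightarrow> (vec3 \<Rightarrow> real) \<Rightarrow> bool" where
  "test_function \<Omega> \<psi> \<longleftrightarrow>
     smooth \<psi> \<and> compact (closure {x. \<psi> x \<noteq> 0}) \<and> closure {x. \<psi> x \<noteq> 0} \<subseteq> \<Omega>"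

text \<open>Elements of \<open>L\<^sup>2\<close> and \<open>H\<^sup>1\<close> are represented by functions on the whole space, of which only the
  values almost everywhere in \<open>\<Omega>\<close> matter. The completed measure \<open>lebesgue_on \<Omega>\<close> makes measurability
  independent of the representative. Norms are thus seminorms on representatives, and a set that
  is closed under limits for such a seminorm is a union of almost-everywhere classes.\<close>

definition L2 :: "vec3 set \<Rightarrow> (vec3 \<Rightarrow> 'b::euclidean_space) set" where
  "L2 \<Omega> = {f \<in> borel_measurable (lebesgue_on \<Omega>). integrable (lebesgue_on \<Omega>) (\<lambda>x. (norm (f x))\<^sup>2)}"

definition L2_norm :: "vec3 set \<Rightarrow> (vec3 \<Rightarrow> 'b::euclidean_space) \<Rightarrow> real" where
  "L2_norm \<Omega> f = sqrt (\<integral>x. (norm (f x))\<^sup>2 \<partial>lebesgue_on \<Omega>)"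

text \<open>The \<open>i\<close>-th component of the gradient at \<open>x\<close> is the partial derivative in direction \<open>i\<close>.\<close>

definition weak_gradient ::
    "vec3 set \<Rightarrow> (vec3 \<Rightarrow> 'b::euclidean_space) \<Rightarrow> (vec3 \<Rightarrow> 'b^3) \<Rightarrow> bool" where
  "weak_gradient \<Omega> u G \<longleftrightarrow>
     (\<forall>\<psi>. test_function \<Omega> \<psi> \<longrightarrow> (\<forall>i.
        (\<integral>x. frechet_derivative \<psi> (at x) (axis i 1) *\<^sub>R u x \<partial>lebesgue_on \<Omega>) =
        - (\<integral>x. \<psi> x *\<^sub>R (G x $ i) \<partial>lebesgue_on \<Omega>)))"

definition H1 :: "vec3 set \<Rightarrow> (vec3 \<Rightarrow> 'b::euclidean_space) set" where
  "H1 \<Omega> = {u \<in> L2 \<Omega>. \<exists>G \<in> L2 \<Omega>. weak_gradient \<Omega> u G}"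

definition wgrad :: "vec3 set \<Rightarrow> (vec3 \<Rightarrow> 'b::euclidean_space) \<Rightarrow> vec3 \<Rightarrow> 'b^3" where
  "wgrad \<Omega> u = (SOME G. G \<in> L2 \<Omega> \<and> weak_gradient \<Omega> u G)"

definition H1_norm :: "vec3 set \<Rightarrow> (vec3 \<Rightarrow> 'b::euclidean_space) \<Rightarrow> real" where
  "H1_norm \<Omega> u = sqrt ((L2_norm \<Omega> u)\<^sup>2 + (L2_norm \<Omega> (wgrad \<Omega> u))\<^sup>2)"

definition strain :: "vec3 set \<Rightarrow> (vec3 \<Rightarrow> vec3) \<Rightarrow> vec3 \<Rightarrow> tensor3" where
  "strain \<Omega> u x = (1/2) *\<^sub>R (wgrad \<Omega> u x + transpose (wgrad \<Omega> u x))"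

definition H1_dual :: "vec3 set \<Rightarrow> ((vec3 \<Rightarrow> vec3) \<Rightarrow> real) set" where
  "H1_dual \<Omega> = {l.
     (\<forall>u\<in>H1 \<Omega>. \<forall>v\<in>H1 \<Omega>. l (\<lambda>x. u x + v x) = l u + l v) \<and>
     (\<forall>u\<in>H1 \<Omega>. \<forall>s. l (\<lambda>x. s *\<^sub>R u x) = s * l u) \<and>
     (\<exists>K. \<forall>u\<in>H1 \<Omega>. \<bar>l u\<bar> \<le> K * H1_norm \<Omega> u)}"

section \<open>Surface measure and traces\<close>

text \<open>Surface measure is the two-dimensional Hausdorff measure, normalised so that it agrees with
  area on planes; Borel sets are measurable for this outer measure, since it is a metric one.\<close>

definition hausdorff2_outer :: "vec3 set \<Rightarrow> ennreal" where
  "hausdorff2_outer S =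
     (SUP \<delta>\<in>{0<..}. INF C\<in>{C :: nat \<Rightarrow> vec3 set. S \<subseteq> (\<Union>n. C n) \<and> (\<forall>n. bounded (C n) \<and> diameter (C n) \<le> \<delta>)}.
        (\<Sum>n. ennreal (pi / 4 * (diameter (C n))\<^sup>2)))"

definition hausdorff2 :: "vec3 measure" where
  "hausdorff2 = measure_of UNIV (sets borel) hausdorff2_outer"

definition surface_on :: "vec3 set \<Rightarrow> vec3 measure" where
  "surface_on \<Gamma> = restrict_space hausdorff2 \<Gamma>"

text \<open>The trace on a part \<open>\<Gamma>\<close> of the boundary is the continuous extension, from smooth functions to
  \<open>H\<^sup>1(\<Omega>)\<close>, of the restriction to \<open>\<Gamma>\<close>. It is given by its graph, the closure in \<open>H\<^sup>1(\<Omega>) \<times> L\<^sup>2(\<Gamma>)\<close> of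
  the graph of the restriction; for \<open>\<Omega>\<close> with Lipschitz boundary this is the graph of an operator
  defined on all of \<open>H\<^sup>1(\<Omega>)\<close>.\<close>

definition has_trace ::
    "vec3 set \<Rightarrow> vec3 set \<Rightarrow> (vec3 \<Rightarrow> vec3) \<Rightarrow> (vec3 \<Rightarrow> vec3) \<Rightarrow> bool" where
  "has_trace \<Omega> \<Gamma> u g \<longleftrightarrow>
     u \<in> H1 \<Omega> \<and> g \<in> borel_measurable (surface_on \<Gamma>) \<and>
     (\<exists>w :: nat \<Rightarrow> vec3 \<Rightarrow> vec3. (\<forall>n. smooth (w n)) \<and>
        (\<lambda>n. H1_norm \<Omega> (\<lambda>x. w n x - u x)) \<longlonglongrightarrow> 0 \<and>
        (\<lambda>n. \<integral>\<^sup>+x. ennreal ((norm (w n x - g x))\<^sup>2) \<partial>surface_on \<Gamma>) \<longlonglongrightarrow> 0)"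

definition equal_on_boundary ::
    "vec3 set \<Rightarrow> vec3 set \<Rightarrow> (vec3 \<Rightarrow> vec3) \<Rightarrow> (vec3 \<Rightarrow> vec3) \<Rightarrow> bool" where
  "equal_on_boundary \<Omega> \<Gamma> u v \<longleftrightarrow> has_trace \<Omega> \<Gamma> (\<lambda>x. u x - v x) (\<lambda>x. 0)"

section \<open>The domain\<close>

text \<open>Near each boundary point, \<open>\<Omega>\<close> is the region above the graph of a Lipschitz function in suitable
  Cartesian coordinates, where \<open>e\<close> is the vertical direction.\<close>

definition lipschitz_boundary :: "vec3 set \<Rightarrow> bool" where
  "lipschitz_boundary \<Omega> \<longleftrightarrow>
     (\<forall>x\<in>frontier \<Omega>. \<exists>r>0. \<exists>e g L. norm e = 1 \<and> L-lipschitz_on UNIV (g :: vec3 \<Rightarrow> real) \<and>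
        \<Omega> \<inter> ball x r = {y \<in> ball x r. g (y - (y \<bullet> e) *\<^sub>R e) < y \<bullet> e})"

definition korn_inequality :: "vec3 set \<Rightarrow> vec3 set \<Rightarrow> bool" where
  "korn_inequality \<Omega> \<Gamma> \<longleftrightarrow>
     (\<exists>c\<^sub>0>0. \<forall>u\<in>H1 \<Omega>. \<forall>g. has_trace \<Omega> \<Gamma> u g \<longrightarrow>
        ennreal (c\<^sub>0 * (H1_norm \<Omega> u)\<^sup>2) \<le>
        (\<integral>\<^sup>+x. ennreal ((norm (g x))\<^sup>2) \<partial>surface_on \<Gamma>) + ennreal ((L2_norm \<Omega> (strain \<Omega> u))\<^sup>2))"

text \<open>The Dirichlet and traction parts cover the boundary up to their common relative boundary.\<close>

definition admissible_domain :: "vec3 set \<Rightarrow> vec3 set \<Rightarrow> vec3 set \<Rightarrow> bool" where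
  "admissible_domain \<Omega> \<Gamma>\<^sub>D \<Gamma>\<^sub>t \<longleftrightarrow>
     \<Omega> \<noteq> {} \<and> bounded \<Omega> \<and> connected \<Omega> \<and> open \<Omega> \<and> lipschitz_boundary \<Omega> \<and>
     openin (top_of_set (frontier \<Omega>)) \<Gamma>\<^sub>D \<and> openin (top_of_set (frontier \<Omega>)) \<Gamma>\<^sub>t \<and>
     \<Gamma>\<^sub>D \<inter> \<Gamma>\<^sub>t = {} \<and>
     top_of_set (frontier \<Omega>) frontier_of \<Gamma>\<^sub>D = top_of_set (frontier \<Omega>) frontier_of \<Gamma>\<^sub>t \<and>
     \<Gamma>\<^sub>D \<union> \<Gamma>\<^sub>t \<union> (top_of_set (frontier \<Omega>) frontier_of \<Gamma>\<^sub>D) = frontier \<Omega> \<and>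
     korn_inequality \<Omega> \<Gamma>\<^sub>D"

section \<open>States and energies\<close>

type_synonym state = "(vec3 \<Rightarrow> vec3) \<times> (vec3 \<Rightarrow> tensor3)"

definition Zspace :: "vec3 set \<Rightarrow> (vec3 \<Rightarrow> tensor3) set" where
  "Zspace \<Omega> = {z \<in> H1 \<Omega>. AE x in lebesgue_on \<Omega>. z x \<in> dev3}"

definition Yspace :: "vec3 set \<Rightarrow> state set" where
  "Yspace \<Omega> = H1 \<Omega> \<times> Zspace \<Omega>"

definition Y_bc :: "vec3 set \<Rightarrow> vec3 set \<Rightarrow> (vec3 \<Rightarrow> vec3) \<Rightarrow> state set" where
  "Y_bc \<Omega> \<Gamma> v = {(u, z) \<in> Yspace \<Omega>. equal_on_boundary \<Omega> \<Gamma> u v}"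

definition Y_dist :: "vec3 set \<Rightarrow> state \<Rightarrow> state \<Rightarrow> real" where
  "Y_dist \<Omega> y y' =
     sqrt ((H1_norm \<Omega> (\<lambda>x. fst y x - fst y' x))\<^sup>2 + (H1_norm \<Omega> (\<lambda>x. snd y x - snd y' x))\<^sup>2)"

definition tendsto_Y :: "vec3 set \<Rightarrow> (nat \<Rightarrow> state) \<Rightarrow> state \<Rightarrow> bool" where
  "tendsto_Y \<Omega> w y \<longleftrightarrow>
     (\<forall>k. w k \<in> Yspace \<Omega>) \<and> y \<in> Yspace \<Omega> \<and> (\<lambda>k. Y_dist \<Omega> (w k) y) \<longlonglongrightarrow> 0"

text \<open>The class \<open>C\<^sup>2\<^sup>,\<^sup>1\<close> on the (noncompact) real line is understood locally: the second derivative is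
  locally Lipschitz.\<close>

definition penalty :: "real \<Rightarrow> (real \<Rightarrow> real) \<Rightarrow> bool" where
  "penalty c\<^sub>3 \<phi> \<longleftrightarrow>
     Cn 2 \<phi> \<and> (\<forall>r. \<exists>d>0. \<exists>L. L-lipschitz_on (ball r d) (deriv (deriv \<phi>))) \<and>
     convex_on UNIV \<phi> \<and> mono \<phi> \<and> bounded (range (deriv \<phi>)) \<and>
     (\<forall>r. \<phi> r = 0 \<longleftrightarrow> r \<le> c\<^sub>3)"

definition hardening ::
    "real \<Rightarrow> real \<Rightarrow> real \<Rightarrow> (real \<Rightarrow> real) \<Rightarrow> real \<Rightarrow> tensor3 \<Rightarrow> ereal" where
  "hardening c\<^sub>1 c\<^sub>2 c\<^sub>3 \<phi> \<rho> a =
     (if \<rho> = 0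
      then ereal (c\<^sub>1 * norm a + c\<^sub>2 * (norm a)\<^sup>2) + (if norm a \<le> c\<^sub>3 then 0 else \<infinity>)
      else ereal (c\<^sub>1 * (sqrt (\<rho>\<^sup>2 + (norm a)\<^sup>2) - \<rho>) + c\<^sub>2 * (norm a)\<^sup>2 + \<phi> (norm a) / \<rho>))"

text \<open>The integrands below are nonnegative, so the integral of the hardening and gradient terms
  exists as an extended real number, and \<open>e2ennreal\<close> does not truncate anything.\<close>

definition stored_energy ::
    "vec3 set \<Rightarrow> (tensor3 \<Rightarrow> tensor3) \<Rightarrow> (tensor3 \<Rightarrow> ereal) \<Rightarrow> real \<Rightarrow> state \<Rightarrow> ereal" where
  "stored_energy \<Omega> \<C> F \<nu> = (\<lambda>(u, z).
     ereal (1/2 * (\<integral>x. \<C> (strain \<Omega> u x - z x) \<bullet> (strain \<Omega> u x - z x) \<partial>lebesgue_on \<Omega>)) +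
     enn2ereal (\<integral>\<^sup>+x. e2ennreal (F (z x) + ereal (\<nu>/2 * (norm (wgrad \<Omega> z x))\<^sup>2)) \<partial>lebesgue_on \<Omega>))"

definition lsc_on :: "'a::topological_space set \<Rightarrow> ('a \<Rightarrow> real) \<Rightarrow> bool" where
  "lsc_on S f \<longleftrightarrow> (\<forall>a\<in>S. \<forall>c<f a. \<forall>\<^sub>F b in at a within S. c < f b)"

definition dissipation_potential :: "(tensor3 \<Rightarrow> real) \<Rightarrow> bool" where
  "dissipation_potential D \<longleftrightarrow>
     (\<forall>a\<in>dev3. 0 \<le> D a) \<and> lsc_on dev3 D \<and>
     (\<forall>a\<in>dev3. \<forall>s\<ge>0. D (s *\<^sub>R a) = s * D a) \<and>
     (\<forall>a\<in>dev3. \<forall>b\<in>dev3. D (a + b) \<le> D a + D b) \<and>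
     (\<exists>c\<^sub>D>0. \<forall>a\<in>dev3. c\<^sub>D * norm a \<le> D a)"

definition dissipation :: "vec3 set \<Rightarrow> (tensor3 \<Rightarrow> real) \<Rightarrow> (vec3 \<Rightarrow> tensor3) \<Rightarrow> ereal" where
  "dissipation \<Omega> D a = enn2ereal (\<integral>\<^sup>+x. ennreal (D (a x)) \<partial>lebesgue_on \<Omega>)"

section \<open>Space approximation\<close>

definition closed_subspace_of_H1 :: "vec3 set \<Rightarrow> (vec3 \<Rightarrow> 'b::euclidean_space) set \<Rightarrow> bool" where
  "closed_subspace_of_H1 \<Omega> S \<longleftrightarrow>
     S \<subseteq> H1 \<Omega> \<and> (\<lambda>x. 0) \<in> S \<and>
     (\<forall>u\<in>S. \<forall>v\<in>S. (\<lambda>x. u x + v x) \<in> S) \<and>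
     (\<forall>u\<in>S. \<forall>s. (\<lambda>x. s *\<^sub>R u x) \<in> S) \<and>
     (\<forall>w u. (\<forall>n::nat. w n \<in> S) \<and> u \<in> H1 \<Omega> \<and> (\<lambda>n. H1_norm \<Omega> (\<lambda>x. w n x - u x)) \<longlonglongrightarrow> 0 \<longrightarrow> u \<in> S)"

definition dense_in_Y :: "vec3 set \<Rightarrow> state set \<Rightarrow> state set \<Rightarrow> bool" where
  "dense_in_Y \<Omega> A B \<longleftrightarrow> (\<forall>y\<in>B. \<forall>e>0. \<exists>a\<in>A. Y_dist \<Omega> a y < e)"

definition Y_h0 ::
    "vec3 set \<Rightarrow> vec3 set \<Rightarrow> (real \<Rightarrow> (vec3 \<Rightarrow> vec3) set) \<Rightarrow> (real \<Rightarrow> (vec3 \<Rightarrow> tensor3) set) \<Rightarrow> real \<Rightarrow> state set" where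
  "Y_h0 \<Omega> \<Gamma> U Z h =
     (if h = 0 then Y_bc \<Omega> \<Gamma> (\<lambda>x. 0) else (U h \<times> Z h) \<inter> Y_bc \<Omega> \<Gamma> (\<lambda>x. 0))"

definition space_approximation ::
    "vec3 set \<Rightarrow> vec3 set \<Rightarrow> real \<Rightarrow> (real \<Rightarrow> (vec3 \<Rightarrow> vec3) set) \<Rightarrow> (real \<Rightarrow> (vec3 \<Rightarrow> tensor3) set) \<Rightarrow>
     (real \<Rightarrow> (vec3 \<Rightarrow> vec3) \<Rightarrow> (vec3 \<Rightarrow> vec3)) \<Rightarrow> (real \<Rightarrow> (vec3 \<Rightarrow> tensor3) \<Rightarrow> (vec3 \<Rightarrow> tensor3)) \<Rightarrow> bool" where
  "space_approximation \<Omega> \<Gamma> c\<^sub>3 U Z q r \<longleftrightarrow>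
     (\<forall>h>0. closed_subspace_of_H1 \<Omega> (U h) \<and> closed_subspace_of_H1 \<Omega> (Z h) \<and> Z h \<subseteq> Zspace \<Omega>) \<and>
     (\<forall>h h'. 0 < h' \<and> h' \<le> h \<longrightarrow> U h \<times> Z h \<subseteq> U h' \<times> Z h') \<and>
     dense_in_Y \<Omega> (\<Union>h\<in>{0<..}. U h \<times> Z h) (Yspace \<Omega>) \<and>
     dense_in_Y \<Omega> (\<Union>h\<in>{0<..}. Y_h0 \<Omega> \<Gamma> U Z h) (Y_bc \<Omega> \<Gamma> (\<lambda>x. 0)) \<and>
     (\<forall>h>0. \<forall>u\<in>H1 \<Omega>. q h u \<in> U h) \<and>
     (\<forall>h>0. \<forall>z\<in>Zspace \<Omega>. r h z \<in> Z h) \<and>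
     (\<forall>u\<in>H1 \<Omega>. ((\<lambda>h. H1_norm \<Omega> (\<lambda>x. q h u x - u x)) \<longlongrightarrow> 0) (at_right 0)) \<and>
     (\<forall>z\<in>Zspace \<Omega>. ((\<lambda>h. H1_norm \<Omega> (\<lambda>x. r h z x - z x)) \<longlongrightarrow> 0) (at_right 0)) \<and>
     (\<forall>h>0. \<forall>z\<in>Zspace \<Omega>. (AE x in lebesgue_on \<Omega>. norm (z x) \<le> c\<^sub>3) \<longrightarrow>
        (AE x in lebesgue_on \<Omega>. norm (r h z x) \<le> c\<^sub>3))"

section \<open>The incremental problem\<close>

definition shifted :: "(vec3 \<Rightarrow> vec3) \<Rightarrow> state set \<Rightarrow> state set" where
  "shifted v S = {(u, z). (\<lambda>x. u x - v x, z) \<in> S}"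

text \<open>\<open>W\<close> is the stored energy, \<open>S\<close> the linear space of admissible variations.\<close>

definition incremental_solution ::
    "vec3 set \<Rightarrow> (state \<Rightarrow> ereal) \<Rightarrow> (tensor3 \<Rightarrow> real) \<Rightarrow> state set \<Rightarrow> nat \<Rightarrow> (nat \<Rightarrow> vec3 \<Rightarrow> vec3) \<Rightarrow>
     (nat \<Rightarrow> (vec3 \<Rightarrow> vec3) \<Rightarrow> real) \<Rightarrow> state \<Rightarrow> (nat \<Rightarrow> state) \<Rightarrow> bool" where
  "incremental_solution \<Omega> W D S N uDir l y\<^sub>0 y \<longleftrightarrow>
     y 0 = y\<^sub>0 \<and>
     (\<forall>i\<in>{1..N}. is_arg_min
        (\<lambda>(u, z). W (u, z) - ereal (l i u) + dissipation \<Omega> D (\<lambda>x. z x - snd (y (i - 1)) x))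
        (\<lambda>w. w \<in> shifted (uDir i) S) (y i))"

definition interpolant :: "(nat \<Rightarrow> real) \<Rightarrow> nat \<Rightarrow> (nat \<Rightarrow> state) \<Rightarrow> real \<Rightarrow> state" where
  "interpolant t N y \<tau> =
     (if \<tau> = t N then y N else y (THE i. i < N \<and> t i \<le> \<tau> \<and> \<tau> < t (Suc i)))"

end

theory Submission
  imports Defs
begin

text \<open>The functionals minimized at each time step are uniformly convex on \<open>H\<^sup>1\<close>, by Korn's inequality
  and the quadratic terms in \<open>z\<close> and \<open>\<nabla>z\<close>, with a modulus independent of \<open>\<rho>\<close> and of the previous state,
  and they depend Lipschitz continuously on the previous state because \<open>D\<close>, being sublinear on a
  finite-dimensional space, is Lipschitz. So it suffices, at each step, to have a recovery sequence
  (from the density of the spaces and from \<open>r\<^sub>h\<close>, which preserves the constraint \<open>|z| \<le> c\<^sub>3\<close>) and the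
  lower bound \<open>liminf inf E\<^sub>\<rho> \<ge> min E\<^sub>0\<close> on the limit space. The latter needs no weak compactness:
  \<open>E\<^sub>\<rho>\<close> increases as \<open>\<rho>\<close> decreases, so near-minimizers for \<open>\<rho> = 1/n\<close> form a Cauchy sequence by uniform
  convexity, and its strong limit satisfies the constraint because \<open>\<integral>\<phi>(|z|)\<close> is \<open>O(\<rho>)\<close>.\<close>

section \<open>Smooth functions and the uniqueness of weak gradients\<close>

text \<open>No relation between the rates of \<rho>_k and h_k is given, and this decides where each
  estimate is applied. The lower bound holds for every state of the limit space, hence for the
  minimizers on all smaller discrete spaces. A recovery state \<open>w\<close> obeys the constraint
  of the limit problem, so its energy at \<rho>_k is at most its energy at \<rho>. Testing the
  minimality of \<open>yk k\<close> with the midpoint of \<open>yk k\<close> and \<open>w\<close>, a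
  point of the same discrete space, bounds the squared distance by an energy gap, and the two
  one-sided estimates make this gap small. Only the L^2 convergence of \<open>z\<close> is handed on
  to the next time step. The energies are kept real-valued: the constraint is split off as the
  predicate \<open>feasible\<close>, and \<open>objective_eq\<close> links this to the extended-real
  functional. The long preparation on weak gradients has one cause: \<open>wgrad\<close> is a choice
  of representative, so its linearity, and with it the metric structure of H^1, rests on uniqueness
  almost everywhere.\<close>

lemma Cn_Suc_imp_Cn: "Cn (Suc n) f \<Longrightarrow> Cn n f"
proof (induction n arbitrary: f)
  case 0
  then show ?case
    by (auto simp: continuous_on_eq_continuous_within intro: differentiable_imp_continuous_within)
next
  case (Suc n)
  then show ?case by (metis Cn.simps(2))
qed

lemma Cn_imp_continuous: "Cn n f \<Longrightarrow> continuous_on UNIV f"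
  by (induction n arbitrary: f) (use Cn_Suc_imp_Cn in fastforce)+

lemma Cn_const: "Cn n (\<lambda>x. c)"
  by (induction n arbitrary: c) simp_all

lemma Cn_add: "Cn n f \<Longrightarrow> Cn n g \<Longrightarrow> Cn n (\<lambda>x. f x + g x)"
proof (induction n arbitrary: f g)
  case 0
  then show ?case by (auto intro: continuous_intros)
next
  case (Suc n)
  have "frechet_derivative (\<lambda>x. f x + g x) (at x) =
      (\<lambda>v. frechet_derivative f (at x) v + frechet_derivative g (at x) v)" for x
    using Suc.prems by (intro frechet_derivative_at[symmetric] has_derivative_add)
      (simp_all add: frechet_derivative_works)
  then show ?case using Suc by simp
qed

lemma Cn_scaleR: "Cn n f \<Longrightarrow> Cn n (\<lambda>x. c *\<^sub>R f x)"
proof (induction n arbitrary: f)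
  case 0
  then show ?case by (auto intro: continuous_intros)
next
  case (Suc n)
  have "frechet_derivative (\<lambda>x. c *\<^sub>R f x) (at x) = (\<lambda>v. c *\<^sub>R frechet_derivative f (at x) v)" for x
    using Suc.prems by (intro frechet_derivative_at[symmetric] has_derivative_scaleR_right)
      (simp add: frechet_derivative_works)
  then show ?case using Suc by simp
qed

lemma Cn_mult:
  fixes f g :: "'a::euclidean_space \<Rightarrow> real"
  shows "Cn n f \<Longrightarrow> Cn n g \<Longrightarrow> Cn n (\<lambda>x. f x * g x)"
proof (induction n arbitrary: f g)
  case 0
  then show ?case by (auto intro: continuous_intros)
next
  case (Suc n)
  have "frechet_derivative (\<lambda>x. f x * g x) (at x) =
      (\<lambda>v. f x * frechet_derivative g (at x) v + frechet_derivative f (at x) v * g x)" for x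
    using Suc.prems by (intro frechet_derivative_at[symmetric] has_derivative_mult)
      (simp_all add: frechet_derivative_works)
  then show ?case using Suc.IH Suc.prems Cn_Suc_imp_Cn[OF Suc.prems(1)] Cn_Suc_imp_Cn[OF Suc.prems(2)]
    by (auto intro!: Cn_add)
qed

lemma Cn_prod:
  fixes f :: "'i \<Rightarrow> 'a::euclidean_space \<Rightarrow> real"
  shows "(\<And>i. i \<in> I \<Longrightarrow> Cn n (f i)) \<Longrightarrow> Cn n (\<lambda>x. \<Prod>i\<in>I. f i x)"
  by (induction I rule: infinite_finite_induct) (auto intro: Cn_const Cn_mult)

lemma smooth_add: "smooth f \<Longrightarrow> smooth g \<Longrightarrow> smooth (\<lambda>x. f x + g x)"
  by (simp add: smooth_def Cn_add)

lemma smooth_scaleR: "smooth f \<Longrightarrow> smooth (\<lambda>x. c *\<^sub>R f x)"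
  by (simp add: smooth_def Cn_scaleR)

lemma smooth_const: "smooth (\<lambda>x. c)"
  by (simp add: smooth_def Cn_const)

lemma smooth_imp_continuous: "smooth f \<Longrightarrow> continuous_on UNIV f"
  using Cn_imp_continuous smooth_def by blast

section \<open>Flat exponentials and smooth approximation of boxes\<close>

text \<open>With a polynomial factor the family is closed under differentiation, which gives smoothness by a
  plain induction on the order.\<close>

definition flat_exp :: "real poly \<Rightarrow> real \<Rightarrow> real" where
  "flat_exp p s = (if s > 0 then poly p (1 / s) * exp (- 1 / s) else 0)"

lemma poly_times_exp_minus_tendsto_0:
  "((\<lambda>x::real. poly p x * exp (- x)) \<longlongrightarrow> 0) at_top"
proof -
  have "((\<lambda>x::real. \<Sum>i\<le>degree p. coeff p i * (x ^ i / exp x)) \<longlongrightarrow> (\<Sum>i\<le>degree p. coeff p i * 0)) at_top"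
    by (intro tendsto_intros tendsto_power_div_exp_0)
  then show ?thesis
    by (simp add: poly_altdef sum_distrib_right exp_minus divide_inverse mult.assoc)
qed

lemma flat_exp_tendsto_0: "(flat_exp p \<longlongrightarrow> 0) (at 0)"
proof -
  have r: "(flat_exp p \<longlongrightarrow> 0) (at_right 0)"
  proof (rule Lim_transform_eventually)
    show "((\<lambda>s. poly p (inverse s) * exp (- inverse s)) \<longlongrightarrow> 0) (at_right (0::real))"
      using filterlim_compose[OF poly_times_exp_minus_tendsto_0 filterlim_inverse_at_top_right] .
    show "\<forall>\<^sub>F s in at_right 0. poly p (inverse s) * exp (- inverse s) = flat_exp p s"
      by (auto simp: flat_exp_def eventually_at_filter divide_inverse)
  qed
  have l: "(flat_exp p \<longlongrightarrow> 0) (at_left 0)"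
    by (rule Lim_transform_eventually[OF tendsto_const])
      (auto simp: flat_exp_def eventually_at_filter)
  show ?thesis using r l by (simp add: filterlim_at_split)
qed

text \<open>With \<open>x = 1/s\<close>, the chain rule gives d/ds (p(x) exp(-x)) = x^2 (p(x) -
  p'(x)) exp(-x), which is the origin of the new polynomial.\<close>

lemma flat_exp_has_derivative:
  "(flat_exp p has_real_derivative flat_exp ([:0, 0, 1:] * (p - pderiv p)) s) (at s)"
proof (cases s "0::real" rule: linorder_cases)
  case greater
  have "((\<lambda>s. poly p (1 / s) * exp (- 1 / s)) has_real_derivative
      flat_exp ([:0, 0, 1:] * (p - pderiv p)) s) (at s)"
    using greater
    by (auto intro!: derivative_eq_intros DERIV_chain2[OF poly_DERIV]
        simp: flat_exp_def field_simps power2_eq_square)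
  then show ?thesis
    by (rule DERIV_cong_ev[THEN iffD1, rotated -1, OF _ refl])
      (use greater in \<open>auto simp: flat_exp_def eventually_nhds intro!: exI[of _ "{0<..}"]\<close>)
next
  case less
  have "((\<lambda>s. 0) has_real_derivative flat_exp ([:0, 0, 1:] * (p - pderiv p)) s) (at s)"
    using less by (simp add: flat_exp_def)
  then show ?thesis
    by (rule DERIV_cong_ev[THEN iffD1, rotated -1, OF _ refl])
      (use less in \<open>auto simp: flat_exp_def eventually_nhds intro!: exI[of _ "{..<0}"]\<close>)
next
  case equal
  \<comment> \<open>The difference quotient at 0 is itself a flat exponential: dividing by
    \<open>s\<close> multiplies \<open>p\<close> by the monomial \<open>[:0,1:]\<close>.\<close>
  have "((\<lambda>s. (flat_exp p s - flat_exp p 0) / (s - 0)) \<longlongrightarrow> 0) (at 0)"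
    by (rule Lim_transform_eventually[OF flat_exp_tendsto_0[of "[:0,1:] * p"]])
      (auto simp: flat_exp_def eventually_at_filter)
  then show ?thesis
    by (simp add: equal has_field_derivative_iff flat_exp_def)
qed

text \<open>The affine argument belongs to the statement so that the induction closes: a directional
  derivative contributes only the constant factor \<open>c * (v \<bullet> e)\<close> and a new
  polynomial, hence the generalisation over \<open>p\<close>.\<close>

lemma Cn_flat_exp_affine:
  fixes e :: "'a::euclidean_space"
  shows "Cn n (\<lambda>x. flat_exp p (c * (x \<bullet> e) + d))"
proof (induction n arbitrary: p)
  case 0
  have "isCont (flat_exp p) s" for s
    using flat_exp_has_derivative DERIV_isCont by blast
  then have "continuous_on UNIV (flat_exp p)"
    by (simp add: continuous_on_eq_continuous_at)
  then have "continuous_on UNIV (flat_exp p \<circ> (\<lambda>x. c * (x \<bullet> e) + d))"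
    by (intro continuous_on_compose continuous_intros) (auto intro: continuous_on_subset)
  then show ?case by (simp add: o_def)
next
  case (Suc n)
  let ?p = "[:0, 0, 1:] * (p - pderiv p)"
  have d: "((\<lambda>x. flat_exp p (c * (x \<bullet> e) + d)) has_derivative
      (\<lambda>v. (c * (v \<bullet> e)) *\<^sub>R flat_exp ?p (c * (x \<bullet> e) + d))) (at x)" for x
  proof -
    have "((\<lambda>x. c * (x \<bullet> e) + d) has_derivative (\<lambda>v. c * (v \<bullet> e))) (at x)"
      by (auto intro!: derivative_eq_intros)
    from has_derivative_compose[OF this flat_exp_has_derivative[unfolded has_field_derivative_def]]
    show ?thesis by (simp add: mult.commute)
  qed
  have fd: "frechet_derivative (\<lambda>x. flat_exp p (c * (x \<bullet> e) + d)) (at x) =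
      (\<lambda>v. (c * (v \<bullet> e)) *\<^sub>R flat_exp ?p (c * (x \<bullet> e) + d))" for x
    using frechet_derivative_at[OF d] by simp
  show ?case
    using d Cn_scaleR[OF Suc] by (auto simp: fd differentiable_def simp del: scaleR_conv_of_real real_scaleR_def mult_pCons_left)
qed

text \<open>One factor for each face of the box, positive exactly on the open half-space of that
  face. The product is therefore nonzero exactly on the open box, and its support lies in the closed
  box, hence in \<Omega>.\<close>

lemma ex_smooth_box_approximation:
  fixes a b :: vec3
  assumes "cbox a b \<subseteq> \<Omega>"
  obtains \<psi> :: "nat \<Rightarrow> vec3 \<Rightarrow> real"
  where "\<And>n. test_function \<Omega> (\<psi> n)" "\<And>n x. \<bar>\<psi> n x\<bar> \<le> 1"
    "\<And>x. (\<lambda>n. \<psi> n x) \<longlonglongrightarrow> indicat_real (box a b) x"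
proof
  \<comment> \<open>\<open>g n s = exp (- 1 / ((n + 1) s))\<close> for \<open>s > 0\<close> increases to the indicator of \<open>s > 0\<close>.\<close>
  define g where "g n s = flat_exp 1 (real (Suc n) * s)" for n s
  define \<psi> where "\<psi> n x = (\<Prod>i\<in>Basis. g n (x \<bullet> i - a \<bullet> i) * g n (b \<bullet> i - x \<bullet> i))" for n and x :: vec3
  have g01: "0 \<le> g n s" "g n s \<le> 1" for n s
    by (auto simp: g_def flat_exp_def)
  have g0: "g n s = 0 \<longleftrightarrow> s \<le> 0" for n s
    by (simp add: g_def flat_exp_def zero_less_mult_iff not_less)
  have glim: "(\<lambda>n. g n s) \<longlonglongrightarrow> (if s > 0 then 1 else 0)" for s
  proof (cases "s > 0")
    case True
    have "(\<lambda>n. exp (- (inverse s * inverse (real (Suc n))))) \<longlonglongrightarrow> exp (- (inverse s * 0))"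
      by (intro tendsto_intros LIMSEQ_inverse_real_of_nat)
    moreover have "g n s = exp (- (inverse s * inverse (real (Suc n))))" for n
      using True by (simp add: g_def flat_exp_def zero_less_mult_iff divide_inverse mult.commute del: of_nat_Suc)
    ultimately show ?thesis using True by simp
  next
    case False
    then show ?thesis using g0[of _ s] by simp
  qed
  have supp: "\<psi> n x \<noteq> 0 \<longleftrightarrow> x \<in> box a b" for n x
    by (auto simp: \<psi>_def g0 mem_box not_le)
  have "Cn m (\<psi> n)" for m n
  proof -
    have "Cn m (\<lambda>x::vec3. g n (x \<bullet> i - a \<bullet> i) * g n (b \<bullet> i - x \<bullet> i))" for i
    proof (rule Cn_mult)
      show "Cn m (\<lambda>x::vec3. g n (x \<bullet> i - a \<bullet> i))"
        using Cn_flat_exp_affine[of m 1 "real (Suc n)" i "- real (Suc n) * (a \<bullet> i)"]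
        by (simp add: g_def algebra_simps)
      show "Cn m (\<lambda>x::vec3. g n (b \<bullet> i - x \<bullet> i))"
        using Cn_flat_exp_affine[of m 1 "- real (Suc n)" i "real (Suc n) * (b \<bullet> i)"]
        by (simp add: g_def algebra_simps)
    qed
    then show ?thesis unfolding \<psi>_def by (intro Cn_prod)
  qed
  moreover have "closure {x. \<psi> n x \<noteq> 0} \<subseteq> cbox a b" for n
    by (rule closure_minimal) (auto simp: supp box_subset_cbox[THEN subsetD])
  ultimately show "test_function \<Omega> (\<psi> n)" for n
    using assms unfolding test_function_def smooth_def
    by (meson closed_closure compact_cbox compact_closure bounded_cbox bounded_subset closure_subset order_trans)
  show "\<bar>\<psi> n x\<bar> \<le> 1" for n x
    unfolding \<psi>_def using g01 by (auto simp: abs_prod intro!: prod_le_1 mult_le_one)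
  show "(\<lambda>n. \<psi> n x) \<longlonglongrightarrow> indicat_real (box a b) x" for x
  proof -
    have "(\<lambda>n. \<psi> n x) \<longlonglongrightarrow> (\<Prod>i\<in>Basis. (if x \<bullet> i - a \<bullet> i > 0 then 1 else 0) * (if b \<bullet> i - x \<bullet> i > 0 then 1 else (0::real)))"
      unfolding \<psi>_def by (intro tendsto_intros glim)
    also have "(\<Prod>i\<in>Basis. (if x \<bullet> i - a \<bullet> i > 0 then 1 else 0) * (if b \<bullet> i - x \<bullet> i > 0 then 1 else (0::real)))
        = indicat_real (box a b) x"
    proof (cases "x \<in> box a b")
      case False
      then obtain i where "i \<in> Basis" "\<not> (a \<bullet> i < x \<bullet> i \<and> x \<bullet> i < b \<bullet> i)"
        by (auto simp: mem_box)
      then show ?thesis using False by (auto intro!: prod_zero)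
    qed (auto simp: mem_box intro!: prod.neutral)
    finally show ?thesis .
  qed
qed


text \<open>A Dynkin argument: open boxes are stable under intersection and generate the Borel sets,
  so the integrals over all Borel sets vanish. Completion extends this to Lebesgue sets, and a
  function whose integrals all vanish is zero almost everywhere.\<close>

lemma AE_zero_if_box_integrals_zero:
  fixes F :: "vec3 \<Rightarrow> real"
  assumes F: "integrable lebesgue F"
    and outside: "\<And>x. x \<notin> box a0 b0 \<Longrightarrow> F x = 0"
    and zero: "\<And>a b. (\<integral>x. indicat_real (box a b) x * F x \<partial>lebesgue) = 0"
  shows "AE x in lebesgue. F x = 0"
proof -
  \<comment> \<open>The complement step of the induction needs the integral over the whole space; it
    equals the integral over one box because \<open>F\<close> vanishes outside
    \<open>box a0 b0\<close>.\<close>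
  have F0: "(\<integral>x. F x \<partial>lebesgue) = 0"
  proof -
    have "(\<integral>x. F x \<partial>lebesgue) = (\<integral>x. indicat_real (box a0 b0) x * F x \<partial>lebesgue)"
      by (intro Bochner_Integration.integral_cong) (auto simp: indicator_def outside)
    then show ?thesis using zero by simp
  qed
  have int: "integrable lebesgue (\<lambda>x. indicat_real A x * F x)" if "A \<in> sets lebesgue" for A
    using integrable_mult_indicator[OF that F] by simp
  have borel: "(\<integral>x. indicat_real A x * F x \<partial>lebesgue) = 0" if "A \<in> sets borel" for A
  proof -
    let ?G = "range (\<lambda>(a, b). box a b :: vec3 set)"
    have leb: "X \<in> sets lebesgue" if "X \<in> sigma_sets UNIV ?G" for X
    proof -
      have "X \<in> sets borel" using that by (simp add: borel_eq_box)
      then show ?thesis by simp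
    qed
    have "Int_stable ?G"
      by (auto simp: Int_stable_def box_Int_box image_iff)
    moreover have "?G \<subseteq> Pow UNIV" by simp
    moreover have "A \<in> sigma_sets UNIV ?G"
      using that by (simp add: borel_eq_box)
    ultimately show ?thesis
    proof (induction rule: sigma_sets_induct_disjoint)
      case (basic A)
      then obtain a b where "A = box a b" by auto
      then show ?case using zero by simp
    next
      case empty
      then show ?case by simp
    next
      case (compl A)
      have A: "A \<in> sets lebesgue"
        using compl leb by blast
      have "(\<integral>x. indicat_real (UNIV - A) x * F x \<partial>lebesgue)
          = (\<integral>x. F x - indicat_real A x * F x \<partial>lebesgue)"
        by (intro Bochner_Integration.integral_cong) (auto simp: indicator_def)
      also have "\<dots> = 0"
        using compl(2) F0 Bochner_Integration.integral_diff[OF F int[OF A]] by simp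
      finally show ?case .
    next
      case (union A)
      have A: "A i \<in> sets lebesgue" for i
        using union(2) leb by blast
      have "(\<integral>x\<in>(\<Union>i. A i). F x \<partial>lebesgue) = (\<Sum>i. (\<integral>x\<in>A i. F x \<partial>lebesgue))"
      proof (rule lebesgue_integral_countable_add)
        show "A i \<inter> A j = {}" if "i \<noteq> j" for i j
          using union(1) that by (auto simp: disjoint_family_on_def)
        have "(\<Union>i. A i) \<in> sets lebesgue" using A by blast
        from integrable_mult_indicator[OF this F]
        show "set_integrable lebesgue (\<Union>i. A i) F" by (simp add: set_integrable_def)
      qed (rule A)
      also have "\<dots> = (\<Sum>i. 0)"
        using union(3) by (intro suminf_cong) (simp add: set_lebesgue_integral_def)
      finally show ?case by (simp add: set_lebesgue_integral_def)
    qed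
  qed
  \<comment> \<open>A Lebesgue set is a Borel set up to a null set, so the Borel case
    suffices.\<close>
  have "(\<integral>x\<in>A. F x \<partial>lebesgue) = (\<integral>x\<in>A. 0 \<partial>lebesgue)" if Am: "A \<in> sets lebesgue" for A
  proof -
    obtain S N N' where A: "A = S \<union> N" "N \<subseteq> N'" "N' \<in> null_sets lborel" "S \<in> sets lborel"
      using Am by (rule sets_completionE)
    have "N' \<in> null_sets lebesgue" using A(3) by (rule null_sets_completionI)
    then have "AE x in lebesgue. x \<notin> N'" by (rule AE_not_in)
    then have "AE x in lebesgue. indicat_real A x * F x = indicat_real S x * F x"
      by eventually_elim (use A in \<open>auto simp: indicator_def\<close>)
    then have "(\<integral>x. indicat_real A x * F x \<partial>lebesgue) = (\<integral>x. indicat_real S x * F x \<partial>lebesgue)"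
      using A Am by (intro integral_cong_AE borel_measurable_integrable[OF int]) (auto intro: sets_completionI_sets)
    then show ?thesis using borel[of S] A by (simp add: set_lebesgue_integral_def)
  qed
  from density_unique_real[OF F integrable_zero this] show ?thesis by simp
qed

text \<open>On boxes whose closure lies in \<Omega>, dominated convergence along smooth
  approximations carries the vanishing from test functions to indicators. Such boxes cover \<Omega>,
  and by Lindelof countably many of them suffice, so the exceptional null sets can be united. The
  argument runs coordinatewise because the box lemma concerns real functions.\<close>

lemma fundamental_lemma_calculus_of_variations:
  fixes f :: "vec3 \<Rightarrow> 'b::euclidean_space"
  assumes \<Omega>: "open \<Omega>" and f: "integrable (lebesgue_on \<Omega>) f"
    and zero: "\<And>\<psi>. test_function \<Omega> \<psi> \<Longrightarrow> (\<integral>x. \<psi> x *\<^sub>R f x \<partial>lebesgue_on \<Omega>) = 0"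
  shows "AE x in lebesgue_on \<Omega>. f x = 0"
proof -
  have "\<Omega> \<in> sets borel" using \<Omega> by simp
  then have \<Omega>s: "\<Omega> \<in> sets lebesgue" "\<Omega> \<inter> space lebesgue \<in> sets lebesgue"
    by simp_all
  have coord: "AE x in lebesgue. x \<in> \<Omega> \<longrightarrow> f x \<bullet> e = 0" for e
  proof -
    define F where "F x = indicat_real \<Omega> x * (f x \<bullet> e)" for x
    have F: "integrable lebesgue F"
    proof -
      have "integrable (lebesgue_on \<Omega>) (\<lambda>x. f x \<bullet> e)" using f by simp
      then show ?thesis using integrable_restrict_space[OF \<Omega>s(2), of "\<lambda>x. f x \<bullet> e"]
        by (simp add: F_def[abs_def])
    qed
    have box0: "(\<integral>x. indicat_real (box a b) x * F x \<partial>lebesgue) = 0" if ab: "cbox a b \<subseteq> \<Omega>" for a b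
    proof -
      obtain \<psi> where \<psi>: "\<And>n. test_function \<Omega> (\<psi> n)" "\<And>n x. \<bar>\<psi> n x\<bar> \<le> 1"
        "\<And>x. (\<lambda>n. \<psi> n x) \<longlonglongrightarrow> indicat_real (box a b) x"
        using ex_smooth_box_approximation[OF ab] by blast
      have \<psi>m: "\<psi> n \<in> borel_measurable borel" for n
        using \<psi>(1)[of n] by (simp add: test_function_def smooth_imp_continuous borel_measurable_continuous_onI)
      have \<psi>F: "\<psi> n \<in> borel_measurable lebesgue" for n
        using \<psi>m[of n] measurable_completion measurable_lborel2 by blast
      have "(\<lambda>n. \<integral>x. \<psi> n x * F x \<partial>lebesgue) \<longlonglongrightarrow> (\<integral>x. indicat_real (box a b) x * F x \<partial>lebesgue)"
      proof (rule integral_dominated_convergence)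
        show "integrable lebesgue (\<lambda>x. \<bar>F x\<bar>)" using F by simp
        show "AE x in lebesgue. (\<lambda>n. \<psi> n x * F x) \<longlonglongrightarrow> indicat_real (box a b) x * F x"
          by (intro AE_I2 tendsto_intros \<psi>)
        show "AE x in lebesgue. norm (\<psi> n x * F x) \<le> \<bar>F x\<bar>" for n
          using \<psi>(2)[of n] by (auto simp: abs_mult intro!: AE_I2 mult_left_le_one_le)
      qed (use F \<psi>F integrable_mult_indicator[OF _ F, of "box a b"] in
          \<open>auto intro!: borel_measurable_times borel_measurable_integrable\<close>)
      moreover have "(\<integral>x. \<psi> n x * F x \<partial>lebesgue) = 0" for n
      proof -
        have "continuous_on UNIV (\<psi> n)"
          using \<psi>(1)[of n] by (simp add: test_function_def smooth_imp_continuous)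
        have i: "integrable (lebesgue_on \<Omega>) (\<lambda>x. \<psi> n x *\<^sub>R f x)"
        proof (rule Bochner_Integration.integrable_bound[OF f])
          show "(\<lambda>x. \<psi> n x *\<^sub>R f x) \<in> borel_measurable (lebesgue_on \<Omega>)"
            using measurable_restrict_space1[OF \<psi>F[of n]] f by (intro borel_measurable_scaleR) auto
          show "AE x in lebesgue_on \<Omega>. norm (\<psi> n x *\<^sub>R f x) \<le> norm (f x)"
            using \<psi>(2)[of n] by (auto intro!: AE_I2 mult_left_le_one_le)
        qed
        have "(\<integral>x. \<psi> n x * F x \<partial>lebesgue) = (\<integral>x. indicat_real \<Omega> x *\<^sub>R ((\<psi> n x *\<^sub>R f x) \<bullet> e) \<partial>lebesgue)"
          by (intro Bochner_Integration.integral_cong) (auto simp: F_def)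
        also have "\<dots> = (\<integral>x. (\<psi> n x *\<^sub>R f x) \<bullet> e \<partial>lebesgue_on \<Omega>)"
          using integral_restrict_space[OF \<Omega>s(2), of "\<lambda>x. (\<psi> n x *\<^sub>R f x) \<bullet> e"] by simp
        also have "\<dots> = (\<integral>x. \<psi> n x *\<^sub>R f x \<partial>lebesgue_on \<Omega>) \<bullet> e"
          by (rule integral_inner_left) (use i in simp)
        finally show ?thesis using zero[OF \<psi>(1)] by simp
      qed
      ultimately show ?thesis
        by (simp add: LIMSEQ_const_iff)
    qed
    define \<B> where "\<B> = {X. \<exists>a b. X = box a b \<and> cbox a b \<subseteq> \<Omega>}"
    have \<B>: "\<Union>\<B> = \<Omega>"
    proof
      show "\<Union>\<B> \<subseteq> \<Omega>" using box_subset_cbox unfolding \<B>_def by blast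
      show "\<Omega> \<subseteq> \<Union>\<B>"
      proof
        fix x assume "x \<in> \<Omega>"
        then obtain a b where "cbox a b \<subseteq> \<Omega>" "x \<in> box a b"
          using open_contains_cbox[OF \<Omega>] by metis
        then show "x \<in> \<Union>\<B>" unfolding \<B>_def by blast
      qed
    qed
    have "openin (top_of_set UNIV) X" if "X \<in> \<B>" for X
      using that by (auto simp: \<B>_def open_box)
    then obtain \<D> where \<D>: "\<D> \<subseteq> \<B>" "countable \<D>" "\<Union>\<D> = \<Union>\<B>"
      by (rule Lindelof_openin)
    have "AE x in lebesgue. \<forall>X\<in>\<D>. x \<in> X \<longrightarrow> F x = 0"
    proof (subst AE_ball_countable[OF \<D>(2)], intro ballI)
      fix X assume X: "X \<in> \<D>"
      then obtain a b where ab: "X = box a b" "cbox a b \<subseteq> \<Omega>" using \<D>(1) by (auto simp: \<B>_def)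
      define H where "H x = indicat_real (box a b) x * F x" for x
      have "AE x in lebesgue. H x = 0"
      proof (rule AE_zero_if_box_integrals_zero)
        show "integrable lebesgue H"
          using integrable_mult_indicator[OF _ F, of "box a b"] by (simp add: H_def[abs_def])
        show "H x = 0" if "x \<notin> box a b" for x using that by (simp add: H_def)
        fix c d
        have "(\<integral>x. indicat_real (box c d) x * H x \<partial>lebesgue) =
            (\<integral>x. indicat_real (box c d \<inter> box a b) x * F x \<partial>lebesgue)"
          by (intro Bochner_Integration.integral_cong) (auto simp: H_def indicator_def)
        also have "\<dots> = 0"
        \<comment> \<open>Only a nonempty open box has the closed box with the same corners as its
          closure; for an empty intersection the integral is trivially zero.\<close>
        proof (cases "box c d \<inter> box a b = {}")
          case False
          then obtain c' d' where c: "box c d \<inter> box a b = box c' d'"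
            using box_Int_box[of c d a b] by (auto intro: that)
          have "cbox c' d' = closure (box c' d')"
            using False c closure_box[of c' d'] by simp
          also have "\<dots> \<subseteq> cbox a b"
          proof (rule closure_minimal)
            show "box c' d' \<subseteq> cbox a b" unfolding c[symmetric] using box_subset_cbox by blast
          qed (rule closed_cbox)
          finally have "cbox c' d' \<subseteq> \<Omega>" using ab by blast
          then show ?thesis using box0 c by simp
        qed simp
        finally show "(\<integral>x. indicat_real (box c d) x * H x \<partial>lebesgue) = 0" .
      qed
      then show "AE x in lebesgue. x \<in> X \<longrightarrow> F x = 0"
        by eventually_elim (auto simp: ab H_def indicator_def split: if_splits)
    qed
    then show ?thesis
      by eventually_elim (use \<D>(3) \<B> in \<open>auto simp: F_def indicator_def split: if_splits\<close>)
  qed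
  have "AE x in lebesgue. \<forall>e\<in>Basis. x \<in> \<Omega> \<longrightarrow> f x \<bullet> e = 0"
    by (subst AE_ball_countable) (auto intro: coord countable_finite)
  then have "AE x in lebesgue. x \<in> \<Omega> \<longrightarrow> f x = 0"
    by eventually_elim (auto intro: euclidean_eqI)
  then show ?thesis
    by (simp add: AE_restrict_space_iff[OF \<Omega>s(2)])
qed

section \<open>The space \<open>L\<^sup>2\<close>\<close>

lemma L2_measurable: "f \<in> L2 \<Omega> \<Longrightarrow> f \<in> borel_measurable (lebesgue_on \<Omega>)"
  by (simp add: L2_def)

lemma L2_norm_nonneg [simp]: "0 \<le> L2_norm \<Omega> f"
  by (simp add: L2_norm_def)

lemma L2_norm_power2: "(L2_norm \<Omega> f)\<^sup>2 = (\<integral>x. (norm (f x))\<^sup>2 \<partial>lebesgue_on \<Omega>)"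
  by (simp add: L2_norm_def)

lemma L2_bound:
  assumes "g \<in> L2 \<Omega>" "f \<in> borel_measurable (lebesgue_on \<Omega>)"
    and "AE x in lebesgue_on \<Omega>. norm (f x) \<le> c * norm (g x)"
  shows "f \<in> L2 \<Omega>"
proof -
  have "integrable (lebesgue_on \<Omega>) (\<lambda>x. (norm (f x))\<^sup>2)"
  proof (rule Bochner_Integration.integrable_bound)
    show "integrable (lebesgue_on \<Omega>) (\<lambda>x. c\<^sup>2 * (norm (g x))\<^sup>2)"
      using assms(1) by (simp add: L2_def)
    show "AE x in lebesgue_on \<Omega>. norm ((norm (f x))\<^sup>2) \<le> norm (c\<^sup>2 * (norm (g x))\<^sup>2)"
      using assms(3)
    proof eventually_elim
      case (elim x)
      then show ?case
        using power_mono[OF elim, of 2] by (simp add: power_mult_distrib)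
    qed
  qed (use assms in simp)
  then show ?thesis using assms by (simp add: L2_def)
qed

lemma norm_add_power2_le:
  fixes a b :: "'a::real_normed_vector"
  shows "(norm (a + b))\<^sup>2 \<le> 2 * (norm a)\<^sup>2 + 2 * (norm b)\<^sup>2"
proof -
  have "(norm (a + b))\<^sup>2 \<le> (norm a + norm b)\<^sup>2"
    by (intro power_mono norm_triangle_ineq) simp
  also have "\<dots> \<le> 2 * (norm a)\<^sup>2 + 2 * (norm b)\<^sup>2"
    using zero_le_power2[of "norm a - norm b"] by (simp add: power2_eq_square algebra_simps)
  finally show ?thesis .
qed

lemma L2_add:
  assumes "f \<in> L2 \<Omega>" "g \<in> L2 \<Omega>"
  shows "(\<lambda>x. f x + g x) \<in> L2 \<Omega>"
proof -
  have m: "(\<lambda>x. f x + g x) \<in> borel_measurable (lebesgue_on \<Omega>)"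
    using assms by (auto intro: borel_measurable_add L2_measurable)
  have "integrable (lebesgue_on \<Omega>) (\<lambda>x. (norm (f x + g x))\<^sup>2)"
  proof (rule Bochner_Integration.integrable_bound)
    show "integrable (lebesgue_on \<Omega>) (\<lambda>x. 2 * (norm (f x))\<^sup>2 + 2 * (norm (g x))\<^sup>2)"
      using assms by (simp add: L2_def)
  qed (use m norm_add_power2_le in \<open>auto intro!: AE_I2\<close>)
  then show ?thesis using m by (simp add: L2_def)
qed

lemma L2_linear_image:
  assumes "linear A" "f \<in> L2 \<Omega>"
  shows "(\<lambda>x. A (f x)) \<in> L2 \<Omega>"
proof -
  obtain B where B: "\<And>v. norm (A v) \<le> B * norm v"
    using linear_bounded[OF assms(1)] by auto
  have "A \<in> borel_measurable borel"
    using assms(1) by (intro borel_measurable_continuous_onI linear_continuous_on)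
      (simp add: linear_conv_bounded_linear)
  from measurable_compose[OF L2_measurable[OF assms(2)] this]
  show ?thesis using B by (intro L2_bound[OF assms(2), of _ B]) auto
qed

lemma L2_scaleR: "f \<in> L2 \<Omega> \<Longrightarrow> (\<lambda>x. c *\<^sub>R f x) \<in> L2 \<Omega>"
  by (rule L2_linear_image) (auto intro: linearI simp: algebra_simps)

lemma L2_diff: "f \<in> L2 \<Omega> \<Longrightarrow> g \<in> L2 \<Omega> \<Longrightarrow> (\<lambda>x. f x - g x) \<in> L2 \<Omega>"
  using L2_add[of f \<Omega> "\<lambda>x. (- 1) *\<^sub>R g x"] L2_scaleR[of g \<Omega> "- 1"] by simp

lemma L2_zero [simp]: "(\<lambda>x. 0) \<in> L2 \<Omega>"
  by (simp add: L2_def)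

lemma L2_Pair:
  fixes f :: "vec3 \<Rightarrow> 'a::euclidean_space" and g :: "vec3 \<Rightarrow> 'b::euclidean_space"
  assumes "f \<in> L2 \<Omega>" "g \<in> L2 \<Omega>"
  shows "(\<lambda>x. (f x, g x)) \<in> L2 \<Omega>"
proof -
  have "linear (\<lambda>a::'a. (a, 0::'b))" "linear (\<lambda>b::'b. (0::'a, b))"
    by (auto intro: linearI)
  then show ?thesis
    using L2_add[OF L2_linear_image[OF _ assms(1)] L2_linear_image[OF _ assms(2)],
      of "\<lambda>a. (a, 0)" "\<lambda>b. (0, b)"] by simp
qed

lemma L2_norm_cong_AE:
  assumes "AE x in lebesgue_on \<Omega>. norm (f x) = norm (g x)"
    and "f \<in> L2 \<Omega>" "g \<in> L2 \<Omega>"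
  shows "L2_norm \<Omega> f = L2_norm \<Omega> g"
proof -
  have "(\<integral>x. (norm (f x))\<^sup>2 \<partial>lebesgue_on \<Omega>) = (\<integral>x. (norm (g x))\<^sup>2 \<partial>lebesgue_on \<Omega>)"
    using assms by (intro integral_cong_AE) (auto simp: L2_def)
  then show ?thesis by (simp add: L2_norm_def)
qed

lemma L2_norm_le:
  assumes "AE x in lebesgue_on \<Omega>. norm (f x) \<le> c * norm (g x)" "0 \<le> c"
    and "f \<in> L2 \<Omega>" "g \<in> L2 \<Omega>"
  shows "L2_norm \<Omega> f \<le> c * L2_norm \<Omega> g"
proof -
  have "(L2_norm \<Omega> f)\<^sup>2 \<le> (\<integral>x. c\<^sup>2 * (norm (g x))\<^sup>2 \<partial>lebesgue_on \<Omega>)"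
    unfolding L2_norm_power2
  proof (rule integral_mono_AE)
    show "AE x in lebesgue_on \<Omega>. (norm (f x))\<^sup>2 \<le> c\<^sup>2 * (norm (g x))\<^sup>2"
      using assms(1) by eventually_elim (metis norm_ge_zero power_mono power_mult_distrib)
  qed (use assms in \<open>auto simp: L2_def\<close>)
  also have "\<dots> = (c * L2_norm \<Omega> g)\<^sup>2"
    by (simp add: L2_norm_power2 power_mult_distrib)
  finally show ?thesis using assms(2) by (simp add: power2_le_iff_abs_le)
qed

lemma L2_norm_scaleR: "L2_norm \<Omega> (\<lambda>x. c *\<^sub>R f x) = \<bar>c\<bar> * L2_norm \<Omega> f"
  by (simp add: L2_norm_def power_mult_distrib real_sqrt_mult)

lemma L2_norm_minus_commute: "L2_norm \<Omega> (\<lambda>x. f x - g x) = L2_norm \<Omega> (\<lambda>x. g x - f x)"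
  by (simp add: L2_norm_def norm_minus_commute)

lemma L2_norm_zero [simp]: "L2_norm \<Omega> (\<lambda>x. 0) = 0"
  by (simp add: L2_norm_def)

lemma L2_norm_eq_0_iff:
  assumes "f \<in> L2 \<Omega>"
  shows "L2_norm \<Omega> f = 0 \<longleftrightarrow> (AE x in lebesgue_on \<Omega>. f x = 0)"
  using integral_nonneg_eq_0_iff_AE[of "lebesgue_on \<Omega>" "\<lambda>x. (norm (f x))\<^sup>2"] assms
  by (simp add: L2_def L2_norm_def)

lemma L2_mult_integrable:
  assumes "f \<in> L2 \<Omega>" "g \<in> L2 \<Omega>"
  shows "integrable (lebesgue_on \<Omega>) (\<lambda>x. norm (f x) * norm (g x))"
proof (rule Bochner_Integration.integrable_bound)
  show "integrable (lebesgue_on \<Omega>) (\<lambda>x. (norm (f x))\<^sup>2 + (norm (g x))\<^sup>2)"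
    using assms by (simp add: L2_def)
  have "norm (f x) * norm (g x) \<le> (norm (f x))\<^sup>2 + (norm (g x))\<^sup>2" for x
    using zero_le_power2[of "norm (f x) - norm (g x)"] zero_le_power2[of "norm (f x)"] zero_le_power2[of "norm (g x)"]
    unfolding power2_diff by linarith
  then show "AE x in lebesgue_on \<Omega>. norm (norm (f x) * norm (g x)) \<le> norm ((norm (f x))\<^sup>2 + (norm (g x))\<^sup>2)"
    by (simp add: abs_mult)
qed (use assms in \<open>auto simp: L2_def\<close>)

lemma L2_Cauchy_Schwarz:
  assumes "f \<in> L2 \<Omega>" "g \<in> L2 \<Omega>"
  shows "(\<integral>x. norm (f x) * norm (g x) \<partial>lebesgue_on \<Omega>) \<le> L2_norm \<Omega> f * L2_norm \<Omega> g"
proof -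
  let ?I = "\<integral>x. norm (f x) * norm (g x) \<partial>lebesgue_on \<Omega>"
  have [simp]: "(\<lambda>x. ennreal (norm (f x))) \<in> borel_measurable (lebesgue_on \<Omega>)"
      "(\<lambda>x. ennreal (norm (g x))) \<in> borel_measurable (lebesgue_on \<Omega>)"
    using L2_measurable[OF assms(1)] L2_measurable[OF assms(2)] by measurable
  have nn: "(\<integral>\<^sup>+x. ennreal (norm (f x)) * ennreal (norm (g x)) \<partial>lebesgue_on \<Omega>) = ennreal ?I"
    using L2_mult_integrable[OF assms]
    by (subst nn_integral_eq_integral[symmetric]) (simp_all add: ennreal_mult)
  have sq: "(\<integral>\<^sup>+x. (ennreal (norm (h x)))\<^sup>2 \<partial>lebesgue_on \<Omega>) = ennreal ((L2_norm \<Omega> h)\<^sup>2)"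
    if "h \<in> L2 \<Omega>" for h :: "vec3 \<Rightarrow> 'x::euclidean_space"
    using that unfolding L2_norm_power2 L2_def
    by (subst nn_integral_eq_integral[symmetric]) (simp_all add: ennreal_power)
  have "(ennreal ?I)\<^sup>2 \<le> ennreal ((L2_norm \<Omega> f)\<^sup>2) * ennreal ((L2_norm \<Omega> g)\<^sup>2)"
    using Cauchy_Schwarz_nn_integral[of "\<lambda>x. ennreal (norm (f x))" "lebesgue_on \<Omega>" "\<lambda>x. ennreal (norm (g x))"]
    by (simp add: nn sq assms)
  then have "?I\<^sup>2 \<le> (L2_norm \<Omega> f)\<^sup>2 * (L2_norm \<Omega> g)\<^sup>2"
    by (simp add: ennreal_power flip: ennreal_mult)
  then have "?I\<^sup>2 \<le> (L2_norm \<Omega> f * L2_norm \<Omega> g)\<^sup>2"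
    by (simp add: power_mult_distrib)
  then show ?thesis by (rule power2_le_imp_le) simp
qed

lemma L2_norm_triangle:
  assumes "f \<in> L2 \<Omega>" "g \<in> L2 \<Omega>"
  shows "L2_norm \<Omega> (\<lambda>x. f x + g x) \<le> L2_norm \<Omega> f + L2_norm \<Omega> g"
proof -
  have i: "integrable (lebesgue_on \<Omega>) (\<lambda>x. (norm (f x))\<^sup>2)" "integrable (lebesgue_on \<Omega>) (\<lambda>x. (norm (g x))\<^sup>2)"
    using assms by (simp_all add: L2_def)
  have "(L2_norm \<Omega> (\<lambda>x. f x + g x))\<^sup>2 \<le>
      (\<integral>x. (norm (f x))\<^sup>2 + (norm (g x))\<^sup>2 + 2 * (norm (f x) * norm (g x)) \<partial>lebesgue_on \<Omega>)"
    unfolding L2_norm_power2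
  proof (rule integral_mono_AE)
    show "AE x in lebesgue_on \<Omega>. (norm (f x + g x))\<^sup>2 \<le> (norm (f x))\<^sup>2 + (norm (g x))\<^sup>2 + 2 * (norm (f x) * norm (g x))"
    proof (rule AE_I2)
      fix x
      have "(norm (f x + g x))\<^sup>2 \<le> (norm (f x) + norm (g x))\<^sup>2"
        by (intro power_mono norm_triangle_ineq) simp
      then show "(norm (f x + g x))\<^sup>2 \<le> (norm (f x))\<^sup>2 + (norm (g x))\<^sup>2 + 2 * (norm (f x) * norm (g x))"
        by (simp add: power2_eq_square algebra_simps)
    qed
  qed (use i L2_mult_integrable[OF assms] L2_add[OF assms] in \<open>auto simp: L2_def\<close>)
  also have "\<dots> = (L2_norm \<Omega> f)\<^sup>2 + (L2_norm \<Omega> g)\<^sup>2 + 2 * (\<integral>x. norm (f x) * norm (g x) \<partial>lebesgue_on \<Omega>)"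
    using i L2_mult_integrable[OF assms] by (simp add: L2_norm_power2)
  also have "\<dots> \<le> (L2_norm \<Omega> f + L2_norm \<Omega> g)\<^sup>2"
    using L2_Cauchy_Schwarz[OF assms] by (simp add: power2_eq_square algebra_simps)
  finally show ?thesis by (rule power2_le_imp_le) simp
qed

lemma L2_norm_triangle_diff:
  assumes "f \<in> L2 \<Omega>" "g \<in> L2 \<Omega>" "h \<in> L2 \<Omega>"
  shows "L2_norm \<Omega> (\<lambda>x. f x - h x) \<le> L2_norm \<Omega> (\<lambda>x. f x - g x) + L2_norm \<Omega> (\<lambda>x. g x - h x)"
  using L2_norm_triangle[OF L2_diff[OF assms(1,2)] L2_diff[OF assms(2,3)]] by simp

lemma L2_one: "\<Omega> \<in> lmeasurable \<Longrightarrow> (\<lambda>x. 1::real) \<in> L2 \<Omega>"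
  by (simp add: L2_def finite_measure.integrable_const finite_measure_lebesgue_on)

text \<open>Cauchy-Schwarz against the constant function 1, which is square integrable because the
  domain has finite measure.\<close>

lemma L2_imp_integrable_norm:
  assumes "\<Omega> \<in> lmeasurable" "f \<in> L2 \<Omega>"
  shows "integrable (lebesgue_on \<Omega>) (\<lambda>x. norm (f x))"
    and "(\<integral>x. norm (f x) \<partial>lebesgue_on \<Omega>) \<le> L2_norm \<Omega> (\<lambda>x. 1::real) * L2_norm \<Omega> f"
  using L2_mult_integrable[OF assms(2) L2_one[OF assms(1)]]
    L2_Cauchy_Schwarz[OF assms(2) L2_one[OF assms(1)]] by (simp_all add: mult.commute)

lemma L2_imp_integrable:
  assumes "\<Omega> \<in> lmeasurable" "f \<in> L2 \<Omega>"
  shows "integrable (lebesgue_on \<Omega>) f"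
  using L2_imp_integrable_norm(1)[OF assms] L2_measurable[OF assms(2)] by (simp add: integrable_norm_iff)

text \<open>The Riesz-Fischer argument. On a domain of finite measure an L^2 Cauchy sequence is
  Cauchy in L^1, so a subsequence converges almost everywhere; Fatou's lemma then identifies its
  limit as the L^2 limit of the whole sequence.\<close>

lemma L2_complete:
  fixes f :: "nat \<Rightarrow> vec3 \<Rightarrow> 'b::euclidean_space"
  assumes \<Omega>: "\<Omega> \<in> lmeasurable" and f: "\<And>n. f n \<in> L2 \<Omega>"
    and cauchy: "\<And>e. e > 0 \<Longrightarrow> \<exists>N. \<forall>m\<ge>N. \<forall>n\<ge>N. L2_norm \<Omega> (\<lambda>x. f m x - f n x) < e"
  obtains g where "g \<in> L2 \<Omega>" "(\<lambda>n. L2_norm \<Omega> (\<lambda>x. f n x - g x)) \<longlonglongrightarrow> 0"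
proof -
  let ?M = "lebesgue_on \<Omega>"
  define K where "K = L2_norm \<Omega> (\<lambda>x. 1::real)"
  have L1: "\<exists>N. \<forall>i\<ge>N. \<forall>j\<ge>N. (\<integral>x. norm (f i x - f j x) \<partial>?M) < e" if "e > 0" for e
  proof -
    have "0 < e / (K + 1)" using that by (simp add: K_def add_nonneg_pos)
    from cauchy[OF this] obtain N where N: "\<And>m n. m \<ge> N \<Longrightarrow> n \<ge> N \<Longrightarrow> L2_norm \<Omega> (\<lambda>x. f m x - f n x) < e / (K + 1)"
      by blast
    have "(\<integral>x. norm (f i x - f j x) \<partial>?M) < e" if "i \<ge> N" "j \<ge> N" for i j
    proof -
      have "(\<integral>x. norm (f i x - f j x) \<partial>?M) \<le> K * L2_norm \<Omega> (\<lambda>x. f i x - f j x)"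
        unfolding K_def by (rule L2_imp_integrable_norm(2)[OF \<Omega> L2_diff[OF f f]])
      also have "\<dots> \<le> (K + 1) * L2_norm \<Omega> (\<lambda>x. f i x - f j x)"
        by (simp add: algebra_simps)
      also have "\<dots> < e"
        using N[OF that] by (simp add: pos_less_divide_eq add_nonneg_pos K_def mult.commute)
      finally show ?thesis .
    qed
    then show ?thesis by blast
  qed
  obtain r where r: "strict_mono r" "AE x in ?M. Cauchy (\<lambda>i. f (r i) x)"
    using cauchy_L1_AE_cauchy_subseq[of ?M f, OF L2_imp_integrable[OF \<Omega> f] L1] by blast
  define g where "g x = lim (\<lambda>i. f (r i) x)" for x
  have [measurable]: "f n \<in> borel_measurable ?M" for n
    using L2_measurable[OF f] .
  have [measurable]: "g \<in> borel_measurable ?M"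
    unfolding g_def by measurable
  have lim: "AE x in ?M. (\<lambda>i. f (r i) x) \<longlonglongrightarrow> g x"
    using r(2) by eventually_elim (simp add: g_def Cauchy_convergent_iff convergent_LIMSEQ_iff)
  \<comment> \<open>Fatou in the subsequence index \<open>i\<close>, with \<open>n\<close> held
    fixed. In \<open>ennreal\<close> this is possible before \<open>g\<close> is known to be square
    integrable; membership then follows from the finite bound.\<close>
  have key: "\<exists>N. \<forall>n\<ge>N. (\<integral>\<^sup>+x. ennreal ((norm (f n x - g x))\<^sup>2) \<partial>?M) \<le> ennreal (e\<^sup>2)" if e: "e > 0" for e
  proof -
    obtain N where N: "\<And>m n. m \<ge> N \<Longrightarrow> n \<ge> N \<Longrightarrow> L2_norm \<Omega> (\<lambda>x. f m x - f n x) < e"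
      using cauchy[OF e] by blast
    have "(\<integral>\<^sup>+x. ennreal ((norm (f n x - g x))\<^sup>2) \<partial>?M) \<le> ennreal (e\<^sup>2)" if n: "n \<ge> N" for n
    proof -
      have "(\<integral>\<^sup>+x. ennreal ((norm (f n x - g x))\<^sup>2) \<partial>?M)
          = (\<integral>\<^sup>+x. liminf (\<lambda>i. ennreal ((norm (f n x - f (r i) x))\<^sup>2)) \<partial>?M)"
      proof (rule nn_integral_cong_AE)
        show "AE x in ?M. ennreal ((norm (f n x - g x))\<^sup>2) = liminf (\<lambda>i. ennreal ((norm (f n x - f (r i) x))\<^sup>2))"
          using lim
        proof eventually_elim
          case (elim x)
          have "(\<lambda>i. ennreal ((norm (f n x - f (r i) x))\<^sup>2)) \<longlonglongrightarrow> ennreal ((norm (f n x - g x))\<^sup>2)"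
            by (intro tendsto_intros elim)
          from lim_imp_Liminf[OF sequentially_bot this] show ?case by simp
        qed
      qed
      also have "\<dots> \<le> liminf (\<lambda>i. \<integral>\<^sup>+x. ennreal ((norm (f n x - f (r i) x))\<^sup>2) \<partial>?M)"
        by (rule nn_integral_liminf) measurable
      also have "\<dots> \<le> liminf (\<lambda>i::nat. ennreal (e\<^sup>2))"
      proof (rule Liminf_mono, unfold eventually_sequentially, intro exI[of _ N] allI impI)
        fix i assume "N \<le> i"
        then have "N \<le> r i" using seq_suble[OF r(1), of i] by simp
        have "(\<integral>\<^sup>+x. ennreal ((norm (f n x - f (r i) x))\<^sup>2) \<partial>?M) = ennreal ((L2_norm \<Omega> (\<lambda>x. f n x - f (r i) x))\<^sup>2)"
          unfolding L2_norm_power2 using L2_diff[OF f f, of n "r i"]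
          by (intro nn_integral_eq_integral) (auto simp: L2_def)
        also have "\<dots> \<le> ennreal (e\<^sup>2)"
          using N[OF n \<open>N \<le> r i\<close>] by (intro ennreal_leI power_mono) auto
        finally show "(\<integral>\<^sup>+x. ennreal ((norm (f n x - f (r i) x))\<^sup>2) \<partial>?M) \<le> ennreal (e\<^sup>2)" .
      qed
      also have "\<dots> = ennreal (e\<^sup>2)"
        by (simp add: Liminf_const)
      finally show ?thesis .
    qed
    then show ?thesis by blast
  qed
  have mem: "(\<lambda>x. f n x - g x) \<in> L2 \<Omega>" if "(\<integral>\<^sup>+x. ennreal ((norm (f n x - g x))\<^sup>2) \<partial>?M) \<le> ennreal (e\<^sup>2)" for n e
    using that unfolding L2_def by (auto intro!: integrableI_nonneg elim: order.strict_trans1)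
  obtain n0 where "(\<integral>\<^sup>+x. ennreal ((norm (f n0 x - g x))\<^sup>2) \<partial>?M) \<le> ennreal (1\<^sup>2)"
    using key[of 1] by auto
  from L2_diff[OF f mem[OF this], of n0] have g: "g \<in> L2 \<Omega>" by simp
  have "(\<lambda>n. L2_norm \<Omega> (\<lambda>x. f n x - g x)) \<longlonglongrightarrow> 0"
  proof (rule LIMSEQ_I)
    fix e :: real assume "0 < e"
    then obtain N where N: "\<And>n. n \<ge> N \<Longrightarrow> (\<integral>\<^sup>+x. ennreal ((norm (f n x - g x))\<^sup>2) \<partial>?M) \<le> ennreal ((e/2)\<^sup>2)"
      using key[of "e/2"] by auto
    have "norm (L2_norm \<Omega> (\<lambda>x. f n x - g x) - 0) < e" if "n \<ge> N" for n
    proof -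
      have "ennreal ((L2_norm \<Omega> (\<lambda>x. f n x - g x))\<^sup>2) \<le> ennreal ((e/2)\<^sup>2)"
        unfolding L2_norm_power2 using N[OF that] L2_diff[OF f g, of n]
        by (subst nn_integral_eq_integral[symmetric]) (auto simp: L2_def)
      then have "(L2_norm \<Omega> (\<lambda>x. f n x - g x))\<^sup>2 \<le> (e/2)\<^sup>2" by simp
      then have "L2_norm \<Omega> (\<lambda>x. f n x - g x) \<le> e/2"
        using \<open>0 < e\<close> power2_le_imp_le[of _ "e/2"] by auto
      then show ?thesis using \<open>0 < e\<close> by simp
    qed
    then show "\<exists>N. \<forall>n\<ge>N. norm (L2_norm \<Omega> (\<lambda>x. f n x - g x) - 0) < e" by blast
  qed
  with g show ?thesis by (rule that)
qed

section \<open>The space \<open>H\<^sup>1\<close>\<close>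

lemma continuous_vanishing_outside_compact_bounded:
  fixes g :: "'a::euclidean_space \<Rightarrow> 'b::euclidean_space"
  assumes "continuous_on UNIV g" "compact K" "\<And>x. x \<notin> K \<Longrightarrow> g x = 0"
  obtains B where "0 < B" "\<And>x. norm (g x) \<le> B"
proof -
  have "bounded (g ` K)"
    using assms continuous_on_subset[OF assms(1) subset_UNIV] by (intro compact_imp_bounded compact_continuous_image) auto
  then obtain B where B: "0 < B" "\<And>x. x \<in> K \<Longrightarrow> norm (g x) \<le> B"
    by (auto simp: bounded_pos)
  have "norm (g x) \<le> B" for x
    using B assms(3)[of x] by (cases "x \<in> K") auto
  with B(1) show ?thesis by (rule that)
qed

lemma integrable_lborel_bounded_support:
  fixes g :: "'a::euclidean_space \<Rightarrow> 'b::euclidean_space"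
  assumes "g \<in> borel_measurable borel" "\<And>x. norm (g x) \<le> B * indicat_real (cball a R) x"
  shows "integrable lborel g"
proof (rule Bochner_Integration.integrable_bound)
  show "integrable lborel (\<lambda>x. B * indicat_real (cball a R) x)"
    using emeasure_bounded_finite[of "cball a R"] by simp
  show "AE x in lborel. norm (g x) \<le> norm (B * indicat_real (cball a R) x)"
    using assms(2) by (intro AE_I2 order_trans[OF assms(2)]) auto
qed (use assms in simp)

text \<open>For the product of a test function and a smooth function this becomes integration by
  parts.\<close>

lemma integral_directional_derivative_eq_0:
  fixes g g' :: "'a::euclidean_space \<Rightarrow> 'b::euclidean_space"
  assumes der: "\<And>x t. ((\<lambda>t. g (x + t *\<^sub>R e)) has_vector_derivative g' (x + t *\<^sub>R e)) (at t)"
    and cont: "continuous_on UNIV g" "continuous_on UNIV g'"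
    and K: "compact K" "\<And>x. x \<notin> K \<Longrightarrow> g x = 0" "\<And>x. x \<notin> K \<Longrightarrow> g' x = 0"
  shows "(\<integral>x. g' x \<partial>lborel) = 0"
proof -
  \<comment> \<open>The integrals of the difference quotients vanish by translation invariance.\<close>
  obtain B where B: "0 < B" "\<And>x. norm (g' x) \<le> B"
    using continuous_vanishing_outside_compact_bounded[OF cont(2) K(1,3)] by blast
  obtain B0 where B0: "0 < B0" "\<And>x. norm (g x) \<le> B0"
    using continuous_vanishing_outside_compact_bounded[OF cont(1) K(1,2)] by blast
  obtain R where R: "\<And>x. x \<in> K \<Longrightarrow> norm x \<le> R"
    using compact_imp_bounded[OF K(1)] by (auto simp: bounded_iff)
  \<comment> \<open>The radius is enlarged by \<open>norm e\<close> because the shifts by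
    \<open>s n *\<^sub>R e\<close> have \<open>s n \<le> 1\<close>: all difference quotients then
    vanish outside one common ball, as the dominating function requires.\<close>
  define C where "C = cball (0::'a) (R + norm e)"
  have K0: "g x = 0" if "norm x > R" for x
    using K(2) R[of x] that by fastforce
  have gm [measurable]: "g \<in> borel_measurable borel"
    using cont(1) by (rule borel_measurable_continuous_onI)
  have g'm [measurable]: "g' \<in> borel_measurable borel"
    using cont(2) by (rule borel_measurable_continuous_onI)
  have gi: "integrable lborel g"
    by (rule integrable_lborel_bounded_support[where B = B0 and a = 0 and R = R])
      (use B0 K0 in \<open>auto simp: indicator_def not_le\<close>)
  have lip: "norm (g (x + t *\<^sub>R e) - g x) \<le> B * \<bar>t\<bar>" for x t
  proof -
    have "norm (g (x + t *\<^sub>R e) - g (x + 0 *\<^sub>R e)) \<le> B * norm (t - 0)"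
    proof (rule differentiable_bound[of UNIV _ "\<lambda>s h. h *\<^sub>R g' (x + s *\<^sub>R e)"])
      show "((\<lambda>t. g (x + t *\<^sub>R e)) has_derivative (\<lambda>h. h *\<^sub>R g' (x + s *\<^sub>R e))) (at s)" for s
        using der[of x s] by (simp add: has_vector_derivative_def)
      show "onorm (\<lambda>h::real. h *\<^sub>R g' (x + s *\<^sub>R e)) \<le> B" for s
        using B(2)[of "x + s *\<^sub>R e"] by (intro onorm_le) (simp add: mult.commute[of B] mult_left_mono)
    qed auto
    then show ?thesis by simp
  qed
  define s where "s n = 1 / real (Suc n)" for n
  have s: "0 < s n" "s n \<le> 1" for n by (auto simp: s_def)
  define D where "D n x = (1 / s n) *\<^sub>R (g (x + s n *\<^sub>R e) - g x)" for n x
  have Dm [measurable]: "D n \<in> borel_measurable borel" for n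
    unfolding D_def by measurable
  have "(\<lambda>n. \<integral>x. D n x \<partial>lborel) \<longlonglongrightarrow> (\<integral>x. g' x \<partial>lborel)"
  proof (rule integral_dominated_convergence)
    show "integrable lborel (\<lambda>x. B * indicat_real C x)"
      using emeasure_bounded_finite[of C] by (simp add: C_def)
    show "AE x in lborel. (\<lambda>n. D n x) \<longlonglongrightarrow> g' x"
    proof (rule AE_I2)
      fix x
      have "filterlim s (at 0) sequentially"
        unfolding filterlim_at
      proof
        show "\<forall>\<^sub>F n in sequentially. s n \<in> UNIV \<and> s n \<noteq> 0"
          using s(1) by (auto intro!: always_eventually simp: less_imp_neq[symmetric])
        show "s \<longlonglongrightarrow> 0" unfolding s_def using LIMSEQ_inverse_real_of_nat by (simp add: inverse_eq_divide)
      qed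
      moreover have "((\<lambda>t. (1 / t) *\<^sub>R (g (x + t *\<^sub>R e) - g x)) \<longlongrightarrow> g' x) (at 0)"
      proof (rule LIM_zero_cancel, rule tendsto_norm_zero_cancel)
        have "((\<lambda>y. norm (g (x + y *\<^sub>R e) - g x - y *\<^sub>R g' x) / norm y) \<longlongrightarrow> 0) (at 0)"
          using der[of x 0] by (simp add: has_vector_derivative_def has_derivative_iff_norm)
        then show "((\<lambda>y. norm ((1 / y) *\<^sub>R (g (x + y *\<^sub>R e) - g x) - g' x)) \<longlongrightarrow> 0) (at 0)"
        proof (rule Lim_transform_eventually)
          have "norm (g (x + y *\<^sub>R e) - g x - y *\<^sub>R g' x) / norm y
              = norm ((1 / y) *\<^sub>R (g (x + y *\<^sub>R e) - g x) - g' x)" if "y \<noteq> 0" for y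
          proof -
            have "(1 / y) *\<^sub>R (g (x + y *\<^sub>R e) - g x) - g' x = (1 / y) *\<^sub>R (g (x + y *\<^sub>R e) - g x - y *\<^sub>R g' x)"
              using that by (simp add: scaleR_diff_right)
            then show ?thesis by simp
          qed
          then show "\<forall>\<^sub>F y in at 0. norm (g (x + y *\<^sub>R e) - g x - y *\<^sub>R g' x) / norm y
              = norm ((1 / y) *\<^sub>R (g (x + y *\<^sub>R e) - g x) - g' x)"
            by (auto simp: eventually_at_filter)
        qed
      qed
      ultimately show "(\<lambda>n. D n x) \<longlonglongrightarrow> g' x"
        unfolding D_def by (rule filterlim_compose[rotated])
    qed
    show "AE x in lborel. norm (D n x) \<le> B * indicat_real C x" for n
    proof (rule AE_I2)
      fix x
      show "norm (D n x) \<le> B * indicat_real C x"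
      proof (cases "x \<in> C")
        case True
        have "norm (D n x) \<le> (1 / s n) * (B * \<bar>s n\<bar>)"
          unfolding D_def using lip[of x "s n"] s(1)[of n] by (simp add: divide_le_eq)
        then show ?thesis using True s(1)[of n] by simp
      next
        case False
        then have x: "norm x > R + norm e" by (simp add: C_def)
        have "norm (s n *\<^sub>R e) \<le> norm e" using s[of n] by (simp add: mult_left_le_one_le)
        then have "norm (x + s n *\<^sub>R e) > R"
          using x norm_triangle_ineq2[of x "- (s n *\<^sub>R e)"] by simp
        moreover have "norm x > R" using x norm_ge_zero[of e] by linarith
        ultimately show ?thesis using False by (simp add: D_def K0)
      qed
    qed
  qed (use g'm Dm in simp_all)
  moreover have "(\<integral>x. D n x \<partial>lborel) = 0" for n
  proof -
    have "(\<integral>x. g (s n *\<^sub>R e + x) \<partial>lborel) = (\<integral>x. g x \<partial>distr lborel borel ((+) (s n *\<^sub>R e)))"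
      by (rule integral_distr[symmetric]) auto
    then have eq: "(\<integral>x. g (x + s n *\<^sub>R e) \<partial>lborel) = (\<integral>x. g x \<partial>lborel)"
      by (simp add: lborel_distr_plus add.commute)
    have "integrable (distr lborel borel ((+) (s n *\<^sub>R e))) g"
      using gi by (simp add: lborel_distr_plus)
    then have "integrable lborel (\<lambda>x. g (x + s n *\<^sub>R e))"
      by (subst (asm) integrable_distr_eq) (auto simp: add.commute)
    then show ?thesis
      unfolding D_def using gi eq by simp
  qed
  ultimately show ?thesis by (simp add: LIMSEQ_const_iff)
qed

lemma test_functionD:
  assumes "test_function \<Omega> \<psi>"
  shows "\<psi> differentiable (at x)" "continuous_on UNIV \<psi>"
    "continuous_on UNIV (\<lambda>x. frechet_derivative \<psi> (at x) v)"
    "compact (closure {x. \<psi> x \<noteq> 0})" "closure {x. \<psi> x \<noteq> 0} \<subseteq> \<Omega>"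
    "x \<notin> closure {x. \<psi> x \<noteq> 0} \<Longrightarrow> \<psi> x = 0"
    "x \<notin> closure {x. \<psi> x \<noteq> 0} \<Longrightarrow> frechet_derivative \<psi> (at x) v = 0"
proof -
  have s: "smooth \<psi>" and K: "compact (closure {x. \<psi> x \<noteq> 0})" "closure {x. \<psi> x \<noteq> 0} \<subseteq> \<Omega>"
    using assms by (auto simp: test_function_def)
  have "Cn (Suc 0) \<psi>" using s unfolding smooth_def by blast
  then show "\<psi> differentiable (at x)" "continuous_on UNIV (\<lambda>x. frechet_derivative \<psi> (at x) v)"
    by simp_all
  show "continuous_on UNIV \<psi>" using s by (rule smooth_imp_continuous)
  show "compact (closure {x. \<psi> x \<noteq> 0})" "closure {x. \<psi> x \<noteq> 0} \<subseteq> \<Omega>" by fact+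
  show z: "\<psi> x = 0" if "x \<notin> closure {x. \<psi> x \<noteq> 0}" for x
    using that closure_subset[of "{x. \<psi> x \<noteq> 0}"] by auto
  show "frechet_derivative \<psi> (at x) v = 0" if "x \<notin> closure {x. \<psi> x \<noteq> 0}"
  proof -
    have "(\<psi> has_derivative (\<lambda>_. 0)) (at x)"
    proof (rule has_derivative_transform_within_open)
      show "((\<lambda>_. 0) has_derivative (\<lambda>_. 0)) (at x)" by (rule has_derivative_const)
      show "open (- closure {x. \<psi> x \<noteq> 0})" by (rule open_Compl[OF closed_closure])
      show "x \<in> - closure {x. \<psi> x \<noteq> 0}" unfolding Compl_iff by (rule that)
      show "0 = \<psi> y" if "y \<in> - closure {x. \<psi> x \<noteq> 0}" for y
        using that unfolding Compl_iff by (rule z[symmetric])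
    qed
    from frechet_derivative_at[OF this, symmetric] show ?thesis by simp
  qed
qed

lemma smooth_differentiable: "smooth f \<Longrightarrow> f differentiable (at x)"
  and smooth_continuous_derivative: "smooth f \<Longrightarrow> continuous_on UNIV (\<lambda>x. frechet_derivative f (at x) v)"
proof -
  assume "smooth f"
  then have "Cn (Suc 0) f" unfolding smooth_def by blast
  then show "f differentiable (at x)" "continuous_on UNIV (\<lambda>x. frechet_derivative f (at x) v)" by simp_all
qed

lemma differentiable_imp_line_derivative:
  assumes "f differentiable (at (x + t *\<^sub>R e))"
  shows "((\<lambda>t. f (x + t *\<^sub>R e)) has_vector_derivative frechet_derivative f (at (x + t *\<^sub>R e)) e) (at t)"
proof -
  have "((\<lambda>t. x + t *\<^sub>R e) has_derivative (\<lambda>h. h *\<^sub>R e)) (at t)"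
    by (auto intro!: derivative_eq_intros)
  from has_derivative_compose[OF this assms[unfolded frechet_derivative_works]]
  have "((\<lambda>t. f (x + t *\<^sub>R e)) has_derivative (\<lambda>h. frechet_derivative f (at (x + t *\<^sub>R e)) (h *\<^sub>R e))) (at t)" .
  moreover have "linear (frechet_derivative f (at (x + t *\<^sub>R e)))"
    using assms by (simp add: linear_frechet_derivative)
  ultimately show ?thesis
    by (simp add: has_vector_derivative_def linear_scale)
qed

lemma integral_lebesgue_on_eq_lborel:
  fixes f :: "vec3 \<Rightarrow> 'b::euclidean_space"
  assumes "open \<Omega>" "f \<in> borel_measurable borel" "\<And>x. x \<notin> \<Omega> \<Longrightarrow> f x = 0"
  shows "(\<integral>x. f x \<partial>lebesgue_on \<Omega>) = (\<integral>x. f x \<partial>lborel)"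
proof -
  have "\<Omega> \<in> sets borel" using assms(1) by simp
  then have "\<Omega> \<inter> space lebesgue \<in> sets lebesgue" by simp
  from integral_restrict_space[OF this, of f]
  have "(\<integral>x. f x \<partial>lebesgue_on \<Omega>) = (\<integral>x. indicat_real \<Omega> x *\<^sub>R f x \<partial>lebesgue)" by simp
  also have "(\<lambda>x. indicat_real \<Omega> x *\<^sub>R f x) = f"
    using assms(3) by (auto simp: indicator_def)
  also have "(\<integral>x. f x \<partial>lebesgue) = (\<integral>x. f x \<partial>lborel)"
    by (rule integral_completion) (use assms in simp)
  finally show ?thesis .
qed

lemma linear_vec_nth: "linear (\<lambda>a::'b::euclidean_space^3. a $ i)"
  by (auto intro: linearI)

lemma norm_fst_le_norm: "norm (fst p) \<le> norm p"
  using norm_fst_le[of "fst p" "snd p"] by simp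

lemma norm_snd_le_norm: "norm (snd p) \<le> norm p"
  using norm_snd_le[of "snd p" "fst p"] by simp

text \<open>Value and gradient in one vector: the H^1 norm becomes the L^2 norm of a single
  function, so the triangle inequality and the Cauchy criterion transfer from L^2.\<close>

definition jet1 :: "vec3 set \<Rightarrow> (vec3 \<Rightarrow> 'b::euclidean_space) \<Rightarrow> vec3 \<Rightarrow> 'b \<times> ('b^3)" where
  "jet1 \<Omega> u x = (u x, wgrad \<Omega> u x)"

section \<open>Weak gradients and completeness of H^1 on a bounded open set\<close>

locale bounded_open =
  fixes \<Omega> :: "vec3 set"
  assumes open_domain: "open \<Omega>" and bounded_domain: "bounded \<Omega>"
begin

abbreviation "M \<equiv> lebesgue_on \<Omega>"

lemma lmeasurable_domain: "\<Omega> \<in> lmeasurable"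
  using open_domain bounded_domain by (rule lmeasurable_open[rotated])

lemma continuous_imp_measurable_domain:
  fixes g :: "vec3 \<Rightarrow> 'b::euclidean_space"
  assumes "continuous_on UNIV g" shows "g \<in> borel_measurable M"
proof -
  have "g \<in> borel_measurable borel" using assms by (rule borel_measurable_continuous_onI)
  then have "g \<in> borel_measurable lebesgue" using measurable_completion measurable_lborel2 by blast
  then show ?thesis by (rule measurable_restrict_space1)
qed

lemma L2_continuous:
  fixes g :: "vec3 \<Rightarrow> 'b::euclidean_space"
  assumes "continuous_on UNIV g" shows "g \<in> L2 \<Omega>"
proof -
  have "bounded (g ` closure \<Omega>)"
    using assms bounded_domain continuous_on_subset[OF assms subset_UNIV]
    by (intro compact_imp_bounded compact_continuous_image) auto
  then obtain B where B: "\<And>x. x \<in> closure \<Omega> \<Longrightarrow> norm (g x) \<le> B" by (auto simp: bounded_iff)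
  show ?thesis
    by (rule L2_bound[OF L2_one[OF lmeasurable_domain] continuous_imp_measurable_domain[OF assms], of B])
      (use B closure_subset[of \<Omega>] in \<open>auto intro!: AE_I2\<close>)
qed

lemma weighted_L2:
  fixes f :: "vec3 \<Rightarrow> 'b::euclidean_space" and g :: "vec3 \<Rightarrow> real"
  assumes "f \<in> L2 \<Omega>" "g \<in> borel_measurable M" "\<And>x. \<bar>g x\<bar> \<le> B"
  shows "(\<lambda>x. g x *\<^sub>R f x) \<in> L2 \<Omega>"
  using borel_measurable_scaleR[OF assms(2) L2_measurable[OF assms(1)]]
  by (rule L2_bound[OF assms(1), of _ B]) (use assms(3) in \<open>auto intro!: AE_I2 mult_right_mono\<close>)

text \<open>Both sides of the identity that defines a weak gradient are such integrals, the weight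
  being a derivative of the test function or the test function itself. Hence weak gradients pass to
  L^2 limits.\<close>

lemma weighted_integral_tendsto:
  fixes f :: "vec3 \<Rightarrow> 'b::euclidean_space" and g :: "vec3 \<Rightarrow> real"
  assumes "\<And>n. F n \<in> L2 \<Omega>" "f \<in> L2 \<Omega>" "(\<lambda>n. L2_norm \<Omega> (\<lambda>x. F n x - f x)) \<longlonglongrightarrow> 0"
    and g: "g \<in> borel_measurable M" "\<And>x. \<bar>g x\<bar> \<le> B"
  shows "(\<lambda>n. \<integral>x. g x *\<^sub>R F n x \<partial>M) \<longlonglongrightarrow> (\<integral>x. g x *\<^sub>R f x \<partial>M)"
proof (rule Lim_null_comparison[THEN LIM_zero_cancel])
  let ?K = "L2_norm \<Omega> (\<lambda>x. 1::real)"
  have "(\<lambda>n. ?K * (B * L2_norm \<Omega> (\<lambda>x. F n x - f x))) \<longlonglongrightarrow> ?K * (B * 0)"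
    by (intro tendsto_intros assms)
  then show "(\<lambda>n. ?K * (B * L2_norm \<Omega> (\<lambda>x. F n x - f x))) \<longlonglongrightarrow> 0" by simp
  have B: "0 \<le> B" using g(2)[of undefined] by linarith
  note w = weighted_L2[OF _ g]
  show "\<forall>\<^sub>F n in sequentially. norm ((\<integral>x. g x *\<^sub>R F n x \<partial>M) - (\<integral>x. g x *\<^sub>R f x \<partial>M))
      \<le> ?K * (B * L2_norm \<Omega> (\<lambda>x. F n x - f x))"
  proof (intro always_eventually allI)
    fix n
    have d: "(\<lambda>x. F n x - f x) \<in> L2 \<Omega>" using assms by (intro L2_diff)
    have "norm ((\<integral>x. g x *\<^sub>R F n x \<partial>M) - (\<integral>x. g x *\<^sub>R f x \<partial>M))
        = norm (\<integral>x. g x *\<^sub>R (F n x - f x) \<partial>M)"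
      by (simp add: scaleR_diff_right Bochner_Integration.integral_diff[OF
            L2_imp_integrable[OF lmeasurable_domain w[OF assms(1)]] L2_imp_integrable[OF lmeasurable_domain w[OF assms(2)]]])
    also have "\<dots> \<le> (\<integral>x. norm (g x *\<^sub>R (F n x - f x)) \<partial>M)"
      by (rule integral_norm_bound)
    also have "\<dots> \<le> ?K * L2_norm \<Omega> (\<lambda>x. g x *\<^sub>R (F n x - f x))"
      by (rule L2_imp_integrable_norm(2)[OF lmeasurable_domain w[OF d]])
    also have "\<dots> \<le> ?K * (B * L2_norm \<Omega> (\<lambda>x. F n x - f x))"
      using g(2) by (intro mult_left_mono L2_norm_le[OF _ B w[OF d] d]) (auto intro!: AE_I2 mult_right_mono)
    finally show "norm ((\<integral>x. g x *\<^sub>R F n x \<partial>M) - (\<integral>x. g x *\<^sub>R f x \<partial>M))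
      \<le> ?K * (B * L2_norm \<Omega> (\<lambda>x. F n x - f x))" .
  qed
qed

lemma test_function_weights:
  assumes "test_function \<Omega> \<psi>"
  obtains B where "\<psi> \<in> borel_measurable M" "\<And>x. \<bar>\<psi> x\<bar> \<le> B"
    "(\<lambda>x. frechet_derivative \<psi> (at x) v) \<in> borel_measurable M"
    "\<And>x. \<bar>frechet_derivative \<psi> (at x) v\<bar> \<le> B"
proof -
  note t = test_functionD[OF assms]
  obtain B1 where B1: "\<And>x. norm (\<psi> x) \<le> B1"
    using continuous_vanishing_outside_compact_bounded[OF t(2) t(4) t(6)] by blast
  obtain B2 where B2: "\<And>x. norm (frechet_derivative \<psi> (at x) v) \<le> B2"
    using continuous_vanishing_outside_compact_bounded[OF t(3) t(4) t(7)] by blast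
  show ?thesis
    by (rule that[of "max B1 B2"])
      (use B1 B2 in \<open>auto intro: continuous_imp_measurable_domain t order_trans[OF _ max.cobounded1] order_trans[OF _ max.cobounded2]\<close>)
qed

lemma weak_gradient_lincomb:
  fixes u v :: "vec3 \<Rightarrow> 'b::euclidean_space"
  assumes "weak_gradient \<Omega> u G" "weak_gradient \<Omega> v H" "u \<in> L2 \<Omega>" "v \<in> L2 \<Omega>" "G \<in> L2 \<Omega>" "H \<in> L2 \<Omega>"
  shows "weak_gradient \<Omega> (\<lambda>x. a *\<^sub>R u x + b *\<^sub>R v x) (\<lambda>x. a *\<^sub>R G x + b *\<^sub>R H x)"
  unfolding weak_gradient_def
proof (intro allI impI)
  fix \<psi> i assume \<psi>: "test_function \<Omega> \<psi>"
  obtain B where B: "\<psi> \<in> borel_measurable M" "\<And>x. \<bar>\<psi> x\<bar> \<le> B"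
    "(\<lambda>x. frechet_derivative \<psi> (at x) (axis i 1)) \<in> borel_measurable M"
    "\<And>x. \<bar>frechet_derivative \<psi> (at x) (axis i 1)\<bar> \<le> B"
    using test_function_weights[OF \<psi>] by blast
  have i1: "integrable M (\<lambda>x. frechet_derivative \<psi> (at x) (axis i 1) *\<^sub>R f x)"
    if "f \<in> L2 \<Omega>" for f :: "vec3 \<Rightarrow> 'b"
    by (rule L2_imp_integrable[OF lmeasurable_domain weighted_L2[OF that B(3,4)]])
  have i2: "integrable M (\<lambda>x. \<psi> x *\<^sub>R (F x $ i))" if "F \<in> L2 \<Omega>" for F :: "vec3 \<Rightarrow> 'b^3"
    by (rule L2_imp_integrable[OF lmeasurable_domain weighted_L2[OF L2_linear_image[OF linear_vec_nth that] B(1,2)]])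
  have "(\<integral>x. frechet_derivative \<psi> (at x) (axis i 1) *\<^sub>R (a *\<^sub>R u x + b *\<^sub>R v x) \<partial>M)
      = (\<integral>x. a *\<^sub>R (frechet_derivative \<psi> (at x) (axis i 1) *\<^sub>R u x) + b *\<^sub>R (frechet_derivative \<psi> (at x) (axis i 1) *\<^sub>R v x) \<partial>M)"
    by (simp add: scaleR_add_right mult.commute)
  also have "\<dots> = a *\<^sub>R (\<integral>x. frechet_derivative \<psi> (at x) (axis i 1) *\<^sub>R u x \<partial>M)
      + b *\<^sub>R (\<integral>x. frechet_derivative \<psi> (at x) (axis i 1) *\<^sub>R v x \<partial>M)"
    using i1[OF assms(3)] i1[OF assms(4)]
    by (subst Bochner_Integration.integral_add) (simp_all del: scaleR_scaleR)
  also have "\<dots> = - (a *\<^sub>R (\<integral>x. \<psi> x *\<^sub>R (G x $ i) \<partial>M) + b *\<^sub>R (\<integral>x. \<psi> x *\<^sub>R (H x $ i) \<partial>M))"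
    using assms(1,2) \<psi> unfolding weak_gradient_def by simp
  also have "a *\<^sub>R (\<integral>x. \<psi> x *\<^sub>R (G x $ i) \<partial>M) + b *\<^sub>R (\<integral>x. \<psi> x *\<^sub>R (H x $ i) \<partial>M)
      = (\<integral>x. a *\<^sub>R (\<psi> x *\<^sub>R (G x $ i)) + b *\<^sub>R (\<psi> x *\<^sub>R (H x $ i)) \<partial>M)"
    using i2[OF assms(5)] i2[OF assms(6)]
    by (subst Bochner_Integration.integral_add) (simp_all del: scaleR_scaleR)
  also have "\<dots> = (\<integral>x. \<psi> x *\<^sub>R ((a *\<^sub>R G x + b *\<^sub>R H x) $ i) \<partial>M)"
    by (simp add: scaleR_add_right mult.commute)
  finally show "(\<integral>x. frechet_derivative \<psi> (at x) (axis i 1) *\<^sub>R (a *\<^sub>R u x + b *\<^sub>R v x) \<partial>M)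
      = - (\<integral>x. \<psi> x *\<^sub>R ((a *\<^sub>R G x + b *\<^sub>R H x) $ i) \<partial>M)" .
qed

text \<open>This makes the choice in \<open>wgrad\<close> harmless: any square integrable weak
  gradient found by other means agrees with the chosen one almost everywhere.\<close>

lemma weak_gradient_unique:
  fixes u :: "vec3 \<Rightarrow> 'b::euclidean_space"
  assumes "weak_gradient \<Omega> u G" "weak_gradient \<Omega> u H" "G \<in> L2 \<Omega>" "H \<in> L2 \<Omega>"
  shows "AE x in M. G x = H x"
proof -
  have "AE x in M. G x $ i - H x $ i = 0" for i
  proof (rule fundamental_lemma_calculus_of_variations[OF open_domain])
    show "integrable M (\<lambda>x. G x $ i - H x $ i)"
      by (intro L2_imp_integrable[OF lmeasurable_domain] L2_diff L2_linear_image[OF linear_vec_nth] assms)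
    fix \<psi> assume \<psi>: "test_function \<Omega> \<psi>"
    obtain B where B: "\<psi> \<in> borel_measurable M" "\<And>x. \<bar>\<psi> x\<bar> \<le> B"
      using test_function_weights[OF \<psi>] by blast
    have i2: "integrable M (\<lambda>x. \<psi> x *\<^sub>R (F x $ i))" if "F \<in> L2 \<Omega>" for F :: "vec3 \<Rightarrow> 'b^3"
      by (rule L2_imp_integrable[OF lmeasurable_domain weighted_L2[OF L2_linear_image[OF linear_vec_nth that] B(1,2)]])
    have "(\<integral>x. \<psi> x *\<^sub>R (G x $ i) \<partial>M) = (\<integral>x. \<psi> x *\<^sub>R (H x $ i) \<partial>M)"
    proof -
      have "- (\<integral>x. \<psi> x *\<^sub>R (G x $ i) \<partial>M) = - (\<integral>x. \<psi> x *\<^sub>R (H x $ i) \<partial>M)"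
        using assms(1)[unfolded weak_gradient_def, rule_format, OF \<psi>, of i]
          assms(2)[unfolded weak_gradient_def, rule_format, OF \<psi>, of i] by (rule trans[OF sym])
      then show ?thesis by simp
    qed
    then show "(\<integral>x. \<psi> x *\<^sub>R (G x $ i - H x $ i) \<partial>M) = 0"
      using i2[OF assms(3)] i2[OF assms(4)] by (simp add: scaleR_diff_right)
  qed
  then have "AE x in M. \<forall>i\<in>UNIV. G x $ i - H x $ i = 0"
    by (subst AE_ball_countable) (auto intro: countable_finite)
  then show ?thesis by eventually_elim (simp add: vec_eq_iff)
qed

lemma wgrad:
  assumes "u \<in> H1 \<Omega>"
  shows wgrad_L2: "wgrad \<Omega> u \<in> L2 \<Omega>" and weak_gradient_wgrad: "weak_gradient \<Omega> u (wgrad \<Omega> u)"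
proof -
  have "\<exists>G. G \<in> L2 \<Omega> \<and> weak_gradient \<Omega> u G" using assms by (auto simp: H1_def)
  from someI_ex[OF this] show "wgrad \<Omega> u \<in> L2 \<Omega>" "weak_gradient \<Omega> u (wgrad \<Omega> u)"
    by (simp_all add: wgrad_def)
qed

lemma H1_imp_L2: "u \<in> H1 \<Omega> \<Longrightarrow> u \<in> L2 \<Omega>"
  by (simp add: H1_def)

lemma wgrad_AE_eq:
  assumes "G \<in> L2 \<Omega>" "weak_gradient \<Omega> u G" "u \<in> L2 \<Omega>"
  shows "u \<in> H1 \<Omega>" "AE x in M. wgrad \<Omega> u x = G x"
proof -
  show u: "u \<in> H1 \<Omega>" using assms by (auto simp: H1_def)
  show "AE x in M. wgrad \<Omega> u x = G x"
    by (rule weak_gradient_unique[OF weak_gradient_wgrad[OF u] assms(2) wgrad_L2[OF u] assms(1)])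
qed

text \<open>The gradient identity holds only almost everywhere: \<open>wgrad\<close> chooses for
  each function separately, so linearity is a consequence of uniqueness and not an identity of
  functions.\<close>

lemma H1_lincomb:
  assumes "u \<in> H1 \<Omega>" "v \<in> H1 \<Omega>"
  shows "(\<lambda>x. a *\<^sub>R u x + b *\<^sub>R v x) \<in> H1 \<Omega>"
    and "AE x in M. wgrad \<Omega> (\<lambda>x. a *\<^sub>R u x + b *\<^sub>R v x) x = a *\<^sub>R wgrad \<Omega> u x + b *\<^sub>R wgrad \<Omega> v x"
proof -
  note * = wgrad_AE_eq[OF _ weak_gradient_lincomb[OF weak_gradient_wgrad[OF assms(1)] weak_gradient_wgrad[OF assms(2)]]]
  show "(\<lambda>x. a *\<^sub>R u x + b *\<^sub>R v x) \<in> H1 \<Omega>"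
    by (rule *(1)) (intro L2_add L2_scaleR wgrad_L2 H1_imp_L2 assms)+
  show "AE x in M. wgrad \<Omega> (\<lambda>x. a *\<^sub>R u x + b *\<^sub>R v x) x = a *\<^sub>R wgrad \<Omega> u x + b *\<^sub>R wgrad \<Omega> v x"
    by (rule *(2)) (intro L2_add L2_scaleR wgrad_L2 H1_imp_L2 assms)+
qed

lemma jet1_L2: "u \<in> H1 \<Omega> \<Longrightarrow> jet1 \<Omega> u \<in> L2 \<Omega>"
  unfolding jet1_def[abs_def] by (intro L2_Pair H1_imp_L2 wgrad_L2)

lemma jet1_lincomb:
  assumes "u \<in> H1 \<Omega>" "v \<in> H1 \<Omega>"
  shows "AE x in M. jet1 \<Omega> (\<lambda>x. a *\<^sub>R u x + b *\<^sub>R v x) x = a *\<^sub>R jet1 \<Omega> u x + b *\<^sub>R jet1 \<Omega> v x"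
  using H1_lincomb(2)[OF assms, of a b] by eventually_elim (simp add: jet1_def)

lemma H1_norm_eq_jet1:
  assumes "u \<in> H1 \<Omega>" shows "H1_norm \<Omega> u = L2_norm \<Omega> (jet1 \<Omega> u)"
proof -
  have i: "integrable M (\<lambda>x. (norm (u x))\<^sup>2)"
    "integrable M (\<lambda>x. (norm (wgrad \<Omega> u x))\<^sup>2)"
    using H1_imp_L2[OF assms] wgrad_L2[OF assms] by (simp_all add: L2_def)
  have "(L2_norm \<Omega> (jet1 \<Omega> u))\<^sup>2 = (L2_norm \<Omega> u)\<^sup>2 + (L2_norm \<Omega> (wgrad \<Omega> u))\<^sup>2"
    unfolding L2_norm_power2 jet1_def using i by (simp add: norm_Pair)
  then show ?thesis unfolding H1_norm_def by (simp add: real_sqrt_unique)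
qed

lemma H1_add: "u \<in> H1 \<Omega> \<Longrightarrow> v \<in> H1 \<Omega> \<Longrightarrow> (\<lambda>x. u x + v x) \<in> H1 \<Omega>"
  using H1_lincomb(1)[of u v 1 1] by simp

lemma H1_diff: "u \<in> H1 \<Omega> \<Longrightarrow> v \<in> H1 \<Omega> \<Longrightarrow> (\<lambda>x. u x - v x) \<in> H1 \<Omega>"
  using H1_lincomb(1)[of u v 1 "- 1"] by simp

lemma H1_scaleR: "u \<in> H1 \<Omega> \<Longrightarrow> (\<lambda>x. a *\<^sub>R u x) \<in> H1 \<Omega>"
  using H1_lincomb(1)[of u u a 0] by simp

text \<open>The left side involves the gradient chosen for the difference, the right side the
  difference of two chosen gradients. Metric statements about H^1 are reduced to L^2 through
  this.\<close>

lemma H1_norm_diff_eq: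
  assumes "u \<in> H1 \<Omega>" "v \<in> H1 \<Omega>"
  shows "H1_norm \<Omega> (\<lambda>x. u x - v x) = L2_norm \<Omega> (\<lambda>x. jet1 \<Omega> u x - jet1 \<Omega> v x)"
proof -
  have "AE x in M. jet1 \<Omega> (\<lambda>x. u x - v x) x = jet1 \<Omega> u x - jet1 \<Omega> v x"
    using jet1_lincomb[OF assms, of 1 "- 1"] by simp
  then have "L2_norm \<Omega> (jet1 \<Omega> (\<lambda>x. u x - v x)) = L2_norm \<Omega> (\<lambda>x. jet1 \<Omega> u x - jet1 \<Omega> v x)"
    by (intro L2_norm_cong_AE jet1_L2 L2_diff H1_diff assms) auto
  then show ?thesis by (simp add: H1_norm_eq_jet1 H1_diff assms)
qed

lemma H1_norm_triangle:
  assumes "u \<in> H1 \<Omega>" "v \<in> H1 \<Omega>"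
  shows "H1_norm \<Omega> (\<lambda>x. a *\<^sub>R u x + b *\<^sub>R v x) \<le> \<bar>a\<bar> * H1_norm \<Omega> u + \<bar>b\<bar> * H1_norm \<Omega> v"
proof -
  have "H1_norm \<Omega> (\<lambda>x. a *\<^sub>R u x + b *\<^sub>R v x) = L2_norm \<Omega> (\<lambda>x. a *\<^sub>R jet1 \<Omega> u x + b *\<^sub>R jet1 \<Omega> v x)"
    using jet1_lincomb[OF assms, of a b] unfolding H1_norm_eq_jet1[OF H1_lincomb(1)[OF assms]]
    by (intro L2_norm_cong_AE jet1_L2 L2_add L2_scaleR H1_lincomb(1) assms) auto
  also have "\<dots> \<le> L2_norm \<Omega> (\<lambda>x. a *\<^sub>R jet1 \<Omega> u x) + L2_norm \<Omega> (\<lambda>x. b *\<^sub>R jet1 \<Omega> v x)"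
    by (intro L2_norm_triangle L2_scaleR jet1_L2 assms)
  finally show ?thesis by (simp add: L2_norm_scaleR H1_norm_eq_jet1 assms)
qed

text \<open>The jets are Cauchy in L^2. The first component of their limit is the limit function,
  and the second is a weak gradient of it because the defining identity survives L^2
  convergence.\<close>

lemma H1_complete:
  fixes u :: "nat \<Rightarrow> vec3 \<Rightarrow> 'b::euclidean_space"
  assumes u: "\<And>n. u n \<in> H1 \<Omega>"
    and cauchy: "\<And>e. e > 0 \<Longrightarrow> \<exists>N. \<forall>m\<ge>N. \<forall>n\<ge>N. H1_norm \<Omega> (\<lambda>x. u m x - u n x) < e"
  obtains v where "v \<in> H1 \<Omega>" "(\<lambda>n. H1_norm \<Omega> (\<lambda>x. u n x - v x)) \<longlonglongrightarrow> 0"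
proof -
  obtain J where J: "J \<in> L2 \<Omega>" "(\<lambda>n. L2_norm \<Omega> (\<lambda>x. jet1 \<Omega> (u n) x - J x)) \<longlonglongrightarrow> 0"
    by (rule L2_complete[OF lmeasurable_domain jet1_L2[OF u] cauchy[unfolded H1_norm_diff_eq[OF u u]]])
  define v where "v x = fst (J x)" for x
  define G where "G x = snd (J x)" for x
  have v: "v \<in> L2 \<Omega>" and G: "G \<in> L2 \<Omega>"
    unfolding v_def[abs_def] G_def[abs_def]
    by (intro L2_linear_image[OF _ J(1)] bounded_linear.linear bounded_linear_fst bounded_linear_snd)+
  \<comment> \<open>Values and gradient components are dominated pointwise by the difference of the
    jets, so one estimate gives both convergences.\<close>
  have null: "(\<lambda>n. L2_norm \<Omega> (f n)) \<longlonglongrightarrow> 0"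
    if "\<And>n. f n \<in> L2 \<Omega>" "\<And>n x. norm (f n x) \<le> norm (jet1 \<Omega> (u n) x - J x)" for f :: "nat \<Rightarrow> vec3 \<Rightarrow> 'x::euclidean_space"
  proof (rule tendsto_sandwich[OF _ _ tendsto_const J(2)])
    have "L2_norm \<Omega> (f n) \<le> 1 * L2_norm \<Omega> (\<lambda>x. jet1 \<Omega> (u n) x - J x)" for n
      using that by (intro L2_norm_le L2_diff jet1_L2 u J) auto
    then show "\<forall>\<^sub>F n in sequentially. L2_norm \<Omega> (f n) \<le> L2_norm \<Omega> (\<lambda>x. jet1 \<Omega> (u n) x - J x)"
      by simp
  qed simp
  have lim_v: "(\<lambda>n. L2_norm \<Omega> (\<lambda>x. u n x - v x)) \<longlonglongrightarrow> 0"
  proof (rule null)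
    show "norm (u n x - v x) \<le> norm (jet1 \<Omega> (u n) x - J x)" for n x
      using norm_fst_le_norm[of "jet1 \<Omega> (u n) x - J x"] by (simp add: jet1_def v_def)
  qed (intro L2_diff v H1_imp_L2 u)
  have lim_G: "(\<lambda>n. L2_norm \<Omega> (\<lambda>x. wgrad \<Omega> (u n) x $ i - G x $ i)) \<longlonglongrightarrow> 0" for i
  proof (rule null)
    show "norm (wgrad \<Omega> (u n) x $ i - G x $ i) \<le> norm (jet1 \<Omega> (u n) x - J x)" for n x
      using norm_snd_le_norm[of "jet1 \<Omega> (u n) x - J x"] Finite_Cartesian_Product.norm_nth_le[of "snd (jet1 \<Omega> (u n) x - J x)" i]
      by (simp add: jet1_def G_def)
  qed (intro L2_diff L2_linear_image[OF linear_vec_nth] G wgrad_L2 u)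
  have wg: "weak_gradient \<Omega> v G"
    unfolding weak_gradient_def
  proof (intro allI impI)
    fix \<psi> i assume \<psi>: "test_function \<Omega> \<psi>"
    obtain B where B: "\<psi> \<in> borel_measurable M" "\<And>x. \<bar>\<psi> x\<bar> \<le> B"
      "(\<lambda>x. frechet_derivative \<psi> (at x) (axis i 1)) \<in> borel_measurable M"
      "\<And>x. \<bar>frechet_derivative \<psi> (at x) (axis i 1)\<bar> \<le> B"
      using test_function_weights[OF \<psi>] by blast
    have "(\<lambda>n. \<integral>x. frechet_derivative \<psi> (at x) (axis i 1) *\<^sub>R u n x \<partial>M)
        \<longlonglongrightarrow> (\<integral>x. frechet_derivative \<psi> (at x) (axis i 1) *\<^sub>R v x \<partial>M)"
      by (rule weighted_integral_tendsto[OF H1_imp_L2[OF u] v lim_v B(3,4)])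
    moreover have "(\<lambda>n. - (\<integral>x. \<psi> x *\<^sub>R (wgrad \<Omega> (u n) x $ i) \<partial>M))
        \<longlonglongrightarrow> - (\<integral>x. \<psi> x *\<^sub>R (G x $ i) \<partial>M)"
      by (intro tendsto_minus weighted_integral_tendsto[OF _ _ lim_G B(1,2)]
          L2_linear_image[OF linear_vec_nth] G wgrad_L2 u)
    ultimately show "(\<integral>x. frechet_derivative \<psi> (at x) (axis i 1) *\<^sub>R v x \<partial>M) =
        - (\<integral>x. \<psi> x *\<^sub>R (G x $ i) \<partial>M)"
      using weak_gradient_wgrad[OF u] \<psi> unfolding weak_gradient_def
      by (auto intro: LIMSEQ_unique)
  qed
  note vH = wgrad_AE_eq[OF G wg v]
  have "H1_norm \<Omega> (\<lambda>x. u n x - v x) = L2_norm \<Omega> (\<lambda>x. jet1 \<Omega> (u n) x - J x)" for n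
    unfolding H1_norm_diff_eq[OF u vH(1)]
  proof (rule L2_norm_cong_AE)
    show "AE x in M. norm (jet1 \<Omega> (u n) x - jet1 \<Omega> v x) = norm (jet1 \<Omega> (u n) x - J x)"
      using vH(2) by eventually_elim (simp add: jet1_def v_def G_def)
  qed (intro L2_diff jet1_L2 u vH J)+
  with J(2) vH(1) show ?thesis using that by simp
qed

text \<open>Without this, the distances in \<open>has_trace\<close> would involve \<open>wgrad\<close> of functions outside \<open>H\<^sup>1\<close>,
  about which nothing is known.\<close>

lemma smooth_in_H1:
  fixes w :: "vec3 \<Rightarrow> 'b::euclidean_space"
  assumes w: "smooth w" shows "w \<in> H1 \<Omega>"
proof (rule wgrad_AE_eq(1))
  define G where "G x = (\<chi> i. frechet_derivative w (at x) (axis i 1))" for x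
  show "G \<in> L2 \<Omega>"
    by (intro L2_continuous) (simp add: G_def[abs_def] smooth_continuous_derivative[OF w] continuous_on_vec_lambda)
  show "w \<in> L2 \<Omega>"
    by (intro L2_continuous smooth_imp_continuous w)
  show "weak_gradient \<Omega> w G"
    unfolding weak_gradient_def
  proof (intro allI impI)
    fix \<psi> i assume \<psi>: "test_function \<Omega> \<psi>"
    note t = test_functionD[OF \<psi>]
    let ?K = "closure {x. \<psi> x \<noteq> 0}" and ?e = "axis i 1 :: vec3"
    let ?d\<psi> = "\<lambda>x. frechet_derivative \<psi> (at x) ?e" and ?dw = "\<lambda>x. frechet_derivative w (at x) ?e"
    have cont: "continuous_on UNIV (\<lambda>x. ?d\<psi> x *\<^sub>R w x)" "continuous_on UNIV (\<lambda>x. \<psi> x *\<^sub>R ?dw x)"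
      by (intro continuous_intros t smooth_imp_continuous smooth_continuous_derivative w)+
    have "(\<integral>x. ?d\<psi> x *\<^sub>R w x + \<psi> x *\<^sub>R ?dw x \<partial>lborel) = 0"
    proof (rule integral_directional_derivative_eq_0[where g = "\<lambda>x. \<psi> x *\<^sub>R w x" and e = ?e and K = ?K])
      fix x :: vec3 and s :: real
      have "((\<lambda>s. \<psi> (x + s *\<^sub>R ?e) *\<^sub>R w (x + s *\<^sub>R ?e)) has_vector_derivative
          \<psi> (x + s *\<^sub>R ?e) *\<^sub>R ?dw (x + s *\<^sub>R ?e) + ?d\<psi> (x + s *\<^sub>R ?e) *\<^sub>R w (x + s *\<^sub>R ?e)) (at s)"
        by (rule has_vector_derivative_scaleR)
          (use differentiable_imp_line_derivative[OF t(1)] differentiable_imp_line_derivative[OF smooth_differentiable[OF w]]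
           in \<open>auto simp: has_real_derivative_iff_has_vector_derivative\<close>)
      then show "((\<lambda>s. \<psi> (x + s *\<^sub>R ?e) *\<^sub>R w (x + s *\<^sub>R ?e)) has_vector_derivative
          ?d\<psi> (x + s *\<^sub>R ?e) *\<^sub>R w (x + s *\<^sub>R ?e) + \<psi> (x + s *\<^sub>R ?e) *\<^sub>R ?dw (x + s *\<^sub>R ?e)) (at s)"
        by (simp add: add.commute)
      show "continuous_on UNIV (\<lambda>x. \<psi> x *\<^sub>R w x)"
        by (intro continuous_intros t smooth_imp_continuous w)
      show "continuous_on UNIV (\<lambda>x. ?d\<psi> x *\<^sub>R w x + \<psi> x *\<^sub>R ?dw x)"
        using cont by (rule continuous_on_add)
      show "compact ?K" by (rule t(4))
      show "\<psi> x *\<^sub>R w x = 0" if "x \<notin> ?K" for x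
        unfolding t(6)[OF that] by (rule scaleR_zero_left)
      show "?d\<psi> x *\<^sub>R w x + \<psi> x *\<^sub>R ?dw x = 0" if "x \<notin> ?K" for x
        unfolding t(6)[OF that] t(7)[OF that] scaleR_zero_left by (rule add_0_left)
    qed
    \<comment> \<open>The support of the test function lies in \<Omega>, so the integral over
      \<Omega> equals the integral over the whole space, where translation invariance was
      used.\<close>
    moreover have "(\<integral>x. ?d\<psi> x *\<^sub>R w x + \<psi> x *\<^sub>R ?dw x \<partial>M) = (\<integral>x. ?d\<psi> x *\<^sub>R w x + \<psi> x *\<^sub>R ?dw x \<partial>lborel)"
    proof (rule integral_lebesgue_on_eq_lborel[OF open_domain])
      show "(\<lambda>x. ?d\<psi> x *\<^sub>R w x + \<psi> x *\<^sub>R ?dw x) \<in> borel_measurable borel"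
        using cont by (intro borel_measurable_continuous_onI continuous_on_add)
      show "?d\<psi> x *\<^sub>R w x + \<psi> x *\<^sub>R ?dw x = 0" if "x \<notin> \<Omega>" for x
      proof -
        have "x \<notin> ?K" using t(5) that by (rule contra_subsetD)
        from t(6)[OF this] t(7)[OF this] show ?thesis by (simp only: scaleR_zero_left add_0_left)
      qed
    qed
    moreover have "(\<integral>x. ?d\<psi> x *\<^sub>R w x + \<psi> x *\<^sub>R ?dw x \<partial>M)
        = (\<integral>x. ?d\<psi> x *\<^sub>R w x \<partial>M) + (\<integral>x. \<psi> x *\<^sub>R ?dw x \<partial>M)"
      using cont by (intro Bochner_Integration.integral_add L2_imp_integrable[OF lmeasurable_domain] L2_continuous)
    ultimately show "(\<integral>x. ?d\<psi> x *\<^sub>R w x \<partial>M) = - (\<integral>x. \<psi> x *\<^sub>R (G x $ i) \<partial>M)"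
      by (simp add: G_def eq_neg_iff_add_eq_0)
  qed
qed

end

section \<open>Traces and states\<close>

text \<open>The orthogonal projection onto \<open>dev3\<close>. It turns membership in
  \<open>dev3\<close> into a linear equation, which is stable under L^2 limits, and serves to extend
  \<open>D\<close> to all matrices.\<close>

definition dev_part :: "tensor3 \<Rightarrow> tensor3" where
  "dev_part a = (1/2) *\<^sub>R (a + transpose a) - (trace a / 3) *\<^sub>R mat 1"

lemma linear_transpose: "linear (transpose :: tensor3 \<Rightarrow> tensor3)"
  by (auto intro!: linearI simp: transpose_def vec_eq_iff)

lemma linear_trace: "linear (trace :: tensor3 \<Rightarrow> real)"
  by (auto intro!: linearI simp: trace_def sum.distrib sum_distrib_left)

lemma linear_dev_part: "linear dev_part"
proof (rule linearI)
  show "dev_part (a + b) = dev_part a + dev_part b" for a b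
    by (simp add: dev_part_def linear_add[OF linear_transpose] linear_add[OF linear_trace]
        algebra_simps add_divide_distrib)
  show "dev_part (c *\<^sub>R a) = c *\<^sub>R dev_part a" for c a
    by (simp add: dev_part_def linear_scale[OF linear_transpose] linear_scale[OF linear_trace]
        algebra_simps)
qed

lemma dev_part_in_dev3: "dev_part a \<in> dev3"
proof -
  have tr: "transpose (mat 1 :: tensor3) = mat 1" "trace (mat 1 :: tensor3) = 3" "trace (transpose a) = trace a"
    by (rule transpose_mat) (simp_all add: trace_def mat_def transpose_def)
  have "transpose (dev_part a) = dev_part a"
    by (simp add: dev_part_def linear_diff[OF linear_transpose] linear_scale[OF linear_transpose]
        linear_add[OF linear_transpose] tr add.commute)
  moreover have "trace (dev_part a) = 0"
    by (simp add: dev_part_def linear_diff[OF linear_trace] linear_scale[OF linear_trace]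
        linear_add[OF linear_trace] tr)
  ultimately show ?thesis by (simp add: dev3_def sym3_def)
qed

lemma dev_part_id: "a \<in> dev3 \<Longrightarrow> dev_part a = a"
  by (simp add: dev_part_def dev3_def sym3_def flip: scaleR_2)

lemma dev3_iff: "a \<in> dev3 \<longleftrightarrow> dev_part a = a"
  by (metis dev_part_id dev_part_in_dev3)

lemma subspace_dev3: "subspace dev3"
  unfolding subspace_def by (simp add: dev3_iff linear_0[OF linear_dev_part]
      linear_add[OF linear_dev_part] linear_scale[OF linear_dev_part])

text \<open>By construction the measurable sets of \<open>hausdorff2\<close> are the Borel sets,
  whatever values the outer measure assigns to them.\<close>

lemma continuous_imp_surface_measurable:
  fixes f :: "vec3 \<Rightarrow> 'b::euclidean_space"
  assumes "continuous_on UNIV f" shows "f \<in> borel_measurable (surface_on \<Gamma>)"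
proof -
  have s: "sets hausdorff2 = sets borel"
    unfolding hausdorff2_def using sets.sigma_sets_eq[of "borel :: vec3 measure"]
    by (simp add: sets_measure_of)
  have "f \<in> borel_measurable borel" using assms by (rule borel_measurable_continuous_onI)
  then have "f \<in> borel_measurable hausdorff2" by (simp add: measurable_cong_sets[OF s refl])
  then show ?thesis unfolding surface_on_def by (rule measurable_restrict_space1)
qed

definition state_comb :: "real \<Rightarrow> state \<Rightarrow> real \<Rightarrow> state \<Rightarrow> state" where
  "state_comb a w b y = (\<lambda>x. a *\<^sub>R fst w x + b *\<^sub>R fst y x, \<lambda>x. a *\<^sub>R snd w x + b *\<^sub>R snd y x)"

definition jet :: "vec3 set \<Rightarrow> state \<Rightarrow> vec3 \<Rightarrow> (vec3 \<times> (vec3^3)) \<times> (tensor3 \<times> (tensor3^3))" where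
  "jet \<Omega> w x = (jet1 \<Omega> (fst w) x, jet1 \<Omega> (snd w) x)"

text \<open>A closed linear subspace of the states with zero Dirichlet trace, expressed on
  representatives. The notion covers \<open>h = 0\<close> and \<open>h > 0\<close> alike, so the
  convergence argument need not distinguish them.\<close>

definition admissible_variations :: "vec3 set \<Rightarrow> vec3 set \<Rightarrow> state set \<Rightarrow> bool" where
  "admissible_variations \<Omega> \<Gamma> S \<longleftrightarrow>
     S \<subseteq> Y_bc \<Omega> \<Gamma> (\<lambda>x. 0) \<and> (\<lambda>x. 0, \<lambda>x. 0) \<in> S \<and>
     (\<forall>w\<in>S. \<forall>y\<in>S. \<forall>a b. state_comb a w b y \<in> S) \<and>
     (\<forall>W y. (\<forall>n::nat. W n \<in> S) \<and> fst y \<in> H1 \<Omega> \<and> snd y \<in> H1 \<Omega> \<and>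
        (\<lambda>n. H1_norm \<Omega> (\<lambda>x. fst (W n) x - fst y x)) \<longlonglongrightarrow> 0 \<and>
        (\<lambda>n. H1_norm \<Omega> (\<lambda>x. snd (W n) x - snd y x)) \<longlonglongrightarrow> 0 \<longrightarrow> y \<in> S)"

section \<open>Zero traces, deviatoric fields and the metric on states\<close>

context bounded_open
begin

lemma H1_zero: "(\<lambda>x. 0) \<in> H1 \<Omega>"
  by (rule smooth_in_H1[OF smooth_const])

lemma H1_norm_self_diff: "u \<in> H1 \<Omega> \<Longrightarrow> H1_norm \<Omega> (\<lambda>x. u x - u x) = 0"
  by (simp only: H1_norm_diff_eq) simp

lemma H1_norm_nonneg: "0 \<le> H1_norm \<Omega> u"
  by (simp add: H1_norm_def)

lemma L2_norm_le_H1_norm_diff: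
  assumes "u \<in> H1 \<Omega>" "v \<in> H1 \<Omega>"
  shows "L2_norm \<Omega> (\<lambda>x. u x - v x) \<le> H1_norm \<Omega> (\<lambda>x. u x - v x)"
proof -
  have "L2_norm \<Omega> (\<lambda>x. u x - v x) \<le> 1 * L2_norm \<Omega> (jet1 \<Omega> (\<lambda>x. u x - v x))"
    by (intro L2_norm_le H1_imp_L2 jet1_L2 H1_diff assms) (auto simp: jet1_def norm_fst_le)
  then show ?thesis by (simp add: H1_norm_eq_jet1 H1_diff assms)
qed

text \<open>The witness is the same combination of the two approximating sequences. The boundary
  estimate is made in \<open>ennreal\<close>, where the squared norms need not be known to be
  integrable.\<close>

lemma zero_trace_lincomb:
  assumes "has_trace \<Omega> \<Gamma> u (\<lambda>x. 0)" "has_trace \<Omega> \<Gamma> v (\<lambda>x. 0)"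
  shows "has_trace \<Omega> \<Gamma> (\<lambda>x. a *\<^sub>R u x + b *\<^sub>R v x) (\<lambda>x. 0)"
proof -
  have uv: "u \<in> H1 \<Omega>" "v \<in> H1 \<Omega>" using assms by (simp_all add: has_trace_def)
  obtain w where w: "\<And>n. smooth (w n)" "(\<lambda>n. H1_norm \<Omega> (\<lambda>x. w n x - u x)) \<longlonglongrightarrow> 0"
     "(\<lambda>n. \<integral>\<^sup>+x. ennreal ((norm (w n x))\<^sup>2) \<partial>surface_on \<Gamma>) \<longlonglongrightarrow> 0"
    using assms(1) by (auto simp: has_trace_def)
  obtain w' where w': "\<And>n. smooth (w' n)" "(\<lambda>n. H1_norm \<Omega> (\<lambda>x. w' n x - v x)) \<longlonglongrightarrow> 0"
     "(\<lambda>n. \<integral>\<^sup>+x. ennreal ((norm (w' n x))\<^sup>2) \<partial>surface_on \<Gamma>) \<longlonglongrightarrow> 0"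
    using assms(2) by (auto simp: has_trace_def)
  define W where "W n x = a *\<^sub>R w n x + b *\<^sub>R w' n x" for n :: nat and x
  have "smooth (W n)" for n
    unfolding W_def[abs_def] by (intro smooth_add smooth_scaleR w w')
  moreover have "(\<lambda>n. H1_norm \<Omega> (\<lambda>x. W n x - (a *\<^sub>R u x + b *\<^sub>R v x))) \<longlonglongrightarrow> 0"
  proof (rule tendsto_sandwich[OF _ _ tendsto_const])
    have "H1_norm \<Omega> (\<lambda>x. W n x - (a *\<^sub>R u x + b *\<^sub>R v x))
        \<le> \<bar>a\<bar> * H1_norm \<Omega> (\<lambda>x. w n x - u x) + \<bar>b\<bar> * H1_norm \<Omega> (\<lambda>x. w' n x - v x)" for n
      using H1_norm_triangle[OF H1_diff[OF smooth_in_H1[OF w(1)] uv(1)] H1_diff[OF smooth_in_H1[OF w'(1)] uv(2)], of a n b n]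
      by (simp add: W_def scaleR_diff_right algebra_simps)
    then show "\<forall>\<^sub>F n in sequentially. H1_norm \<Omega> (\<lambda>x. W n x - (a *\<^sub>R u x + b *\<^sub>R v x))
        \<le> \<bar>a\<bar> * H1_norm \<Omega> (\<lambda>x. w n x - u x) + \<bar>b\<bar> * H1_norm \<Omega> (\<lambda>x. w' n x - v x)" by simp
    show "(\<lambda>n. \<bar>a\<bar> * H1_norm \<Omega> (\<lambda>x. w n x - u x) + \<bar>b\<bar> * H1_norm \<Omega> (\<lambda>x. w' n x - v x)) \<longlonglongrightarrow> 0"
      using tendsto_add[OF tendsto_mult_right_zero[OF w(2), of "\<bar>a\<bar>"] tendsto_mult_right_zero[OF w'(2), of "\<bar>b\<bar>"]] by simp
  qed (simp add: H1_norm_nonneg)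
  moreover have "(\<lambda>n. \<integral>\<^sup>+x. ennreal ((norm (W n x))\<^sup>2) \<partial>surface_on \<Gamma>) \<longlonglongrightarrow> 0"
  proof (rule tendsto_sandwich[OF _ _ tendsto_const])
    let ?I = "\<lambda>w n. \<integral>\<^sup>+x. ennreal ((norm (w n x))\<^sup>2) \<partial>surface_on \<Gamma>"
    have m: "(\<lambda>x. ennreal ((norm (w n x))\<^sup>2)) \<in> borel_measurable (surface_on \<Gamma>)"
      if "\<And>n. smooth (w n)" for w :: "nat \<Rightarrow> vec3 \<Rightarrow> vec3" and n
    proof -
      have [measurable]: "w n \<in> borel_measurable (surface_on \<Gamma>)"
        using that by (intro continuous_imp_surface_measurable smooth_imp_continuous)
      show ?thesis by measurable
    qed
    have "?I W n \<le> ennreal (2 * a\<^sup>2) * ?I w n + ennreal (2 * b\<^sup>2) * ?I w' n" for n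
    proof -
      have "?I W n \<le> (\<integral>\<^sup>+x. ennreal (2 * a\<^sup>2) * ennreal ((norm (w n x))\<^sup>2) + ennreal (2 * b\<^sup>2) * ennreal ((norm (w' n x))\<^sup>2) \<partial>surface_on \<Gamma>)"
      proof (rule nn_integral_mono)
        fix x
        have "ennreal ((norm (W n x))\<^sup>2) \<le> ennreal ((2 * a\<^sup>2) * (norm (w n x))\<^sup>2 + (2 * b\<^sup>2) * (norm (w' n x))\<^sup>2)"
          using norm_add_power2_le[of "a *\<^sub>R w n x" "b *\<^sub>R w' n x"]
          by (intro ennreal_leI) (simp add: W_def power_mult_distrib mult.assoc)
        also have "\<dots> = ennreal (2 * a\<^sup>2) * ennreal ((norm (w n x))\<^sup>2) + ennreal (2 * b\<^sup>2) * ennreal ((norm (w' n x))\<^sup>2)"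
          by (subst ennreal_plus) (simp_all only: ennreal_mult zero_le_power2 mult_nonneg_nonneg zero_le_numeral)
        finally show "ennreal ((norm (W n x))\<^sup>2) \<le> ennreal (2 * a\<^sup>2) * ennreal ((norm (w n x))\<^sup>2) + ennreal (2 * b\<^sup>2) * ennreal ((norm (w' n x))\<^sup>2)" .
      qed
      also have "\<dots> = ennreal (2 * a\<^sup>2) * ?I w n + ennreal (2 * b\<^sup>2) * ?I w' n"
        using m[OF w(1)] m[OF w'(1)] by (simp add: nn_integral_add nn_integral_cmult)
      finally show ?thesis .
    qed
    then show "\<forall>\<^sub>F n in sequentially. ?I W n \<le> ennreal (2 * a\<^sup>2) * ?I w n + ennreal (2 * b\<^sup>2) * ?I w' n" by simp
    show "(\<lambda>n. ennreal (2 * a\<^sup>2) * ?I w n + ennreal (2 * b\<^sup>2) * ?I w' n) \<longlonglongrightarrow> 0"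
      using tendsto_add[OF ennreal_tendsto_cmult[OF _ w(3), of "ennreal (2 * a\<^sup>2)"] ennreal_tendsto_cmult[OF _ w'(3), of "ennreal (2 * b\<^sup>2)"]]
      by simp
  qed simp
  ultimately show ?thesis
    using H1_lincomb(1)[OF uv, of a b] by (auto simp: has_trace_def intro!: exI[of _ W])
qed

text \<open>A diagonal choice: for each \<open>n\<close> a smooth function closer than
  \<open>1 / (n + 1)\<close> to \<open>u n\<close> in H^1, whose boundary integral is below the same
  bound.\<close>

lemma zero_trace_closed:
  assumes u: "\<And>n. has_trace \<Omega> \<Gamma> (u n) (\<lambda>x. 0)" and v: "v \<in> H1 \<Omega>"
    and lim: "(\<lambda>n. H1_norm \<Omega> (\<lambda>x. u n x - v x)) \<longlonglongrightarrow> 0"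
  shows "has_trace \<Omega> \<Gamma> v (\<lambda>x. 0)"
proof -
  have uH: "u n \<in> H1 \<Omega>" for n using u by (simp add: has_trace_def)
  have "\<exists>w. smooth w \<and> H1_norm \<Omega> (\<lambda>x. w x - u n x) < inverse (real (Suc n)) \<and>
      (\<integral>\<^sup>+x. ennreal ((norm (w x))\<^sup>2) \<partial>surface_on \<Gamma>) < ennreal (inverse (real (Suc n)))" for n
  proof -
    obtain w where w: "\<And>k. smooth (w k)" "(\<lambda>k. H1_norm \<Omega> (\<lambda>x. w k x - u n x)) \<longlonglongrightarrow> 0"
       "(\<lambda>k. \<integral>\<^sup>+x. ennreal ((norm (w k x))\<^sup>2) \<partial>surface_on \<Gamma>) \<longlonglongrightarrow> 0"
      using u[of n] by (auto simp: has_trace_def)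
    have "0 < inverse (real (Suc n))" "0 < ennreal (inverse (real (Suc n)))" by simp_all
    then have "\<forall>\<^sub>F k in sequentially. H1_norm \<Omega> (\<lambda>x. w k x - u n x) < inverse (real (Suc n)) \<and>
        (\<integral>\<^sup>+x. ennreal ((norm (w k x))\<^sup>2) \<partial>surface_on \<Gamma>) < ennreal (inverse (real (Suc n)))"
      using w(2,3) by (intro eventually_conj order_tendstoD(2))
    then obtain k where "H1_norm \<Omega> (\<lambda>x. w k x - u n x) < inverse (real (Suc n)) \<and>
        (\<integral>\<^sup>+x. ennreal ((norm (w k x))\<^sup>2) \<partial>surface_on \<Gamma>) < ennreal (inverse (real (Suc n)))"
      by (auto simp: eventually_sequentially)
    then show ?thesis using w(1) by blast
  qed
  then have "\<exists>w. \<forall>n. smooth (w n) \<and> H1_norm \<Omega> (\<lambda>x. w n x - u n x) < inverse (real (Suc n)) \<and>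
      (\<integral>\<^sup>+x. ennreal ((norm (w n x))\<^sup>2) \<partial>surface_on \<Gamma>) < ennreal (inverse (real (Suc n)))"
    by (intro choice allI)
  then obtain w where w: "\<And>n. smooth (w n)" "\<And>n. H1_norm \<Omega> (\<lambda>x. w n x - u n x) < inverse (real (Suc n))"
      "\<And>n. (\<integral>\<^sup>+x. ennreal ((norm (w n x))\<^sup>2) \<partial>surface_on \<Gamma>) < ennreal (inverse (real (Suc n)))"
    by blast
  have "(\<lambda>n. H1_norm \<Omega> (\<lambda>x. w n x - v x)) \<longlonglongrightarrow> 0"
  proof (rule tendsto_sandwich[OF _ _ tendsto_const])
    have "H1_norm \<Omega> (\<lambda>x. w n x - v x) \<le> inverse (real (Suc n)) + H1_norm \<Omega> (\<lambda>x. u n x - v x)" for n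
      using H1_norm_triangle[OF H1_diff[OF smooth_in_H1[OF w(1)[of n]] uH[of n]] H1_diff[OF uH[of n] v], of 1 1] w(2)[of n]
      by simp
    then show "\<forall>\<^sub>F n in sequentially. H1_norm \<Omega> (\<lambda>x. w n x - v x) \<le> inverse (real (Suc n)) + H1_norm \<Omega> (\<lambda>x. u n x - v x)" by simp
    show "(\<lambda>n. inverse (real (Suc n)) + H1_norm \<Omega> (\<lambda>x. u n x - v x)) \<longlonglongrightarrow> 0"
      using tendsto_add[OF LIMSEQ_inverse_real_of_nat lim] by simp
  qed (simp add: H1_norm_nonneg)
  moreover have "(\<lambda>n. \<integral>\<^sup>+x. ennreal ((norm (w n x))\<^sup>2) \<partial>surface_on \<Gamma>) \<longlonglongrightarrow> 0"
  proof (rule tendsto_sandwich[OF _ _ tendsto_const])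
    show "\<forall>\<^sub>F n in sequentially. (\<integral>\<^sup>+x. ennreal ((norm (w n x))\<^sup>2) \<partial>surface_on \<Gamma>) \<le> ennreal (inverse (real (Suc n)))"
      using w(3) by (intro always_eventually allI less_imp_le)
    show "(\<lambda>n. ennreal (inverse (real (Suc n)))) \<longlonglongrightarrow> 0"
      using tendsto_ennrealI[OF LIMSEQ_inverse_real_of_nat] by simp
  qed simp
  ultimately show ?thesis using v w(1) by (auto simp: has_trace_def intro!: exI[of _ w])
qed

lemma zero_trace_zero: "has_trace \<Omega> \<Gamma> (\<lambda>x. 0) (\<lambda>x. 0)"
proof -
  have "H1_norm \<Omega> (\<lambda>x. 0 :: vec3) = 0"
    using H1_norm_self_diff[of "\<lambda>x. 0 :: vec3"] H1_zero by simp
  then show ?thesis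
    unfolding has_trace_def using H1_zero by (auto intro!: exI[of _ "\<lambda>n x. 0"] smooth_const)
qed

lemma Zspace_lincomb:
  assumes "z \<in> Zspace \<Omega>" "z' \<in> Zspace \<Omega>"
  shows "(\<lambda>x. a *\<^sub>R z x + b *\<^sub>R z' x) \<in> Zspace \<Omega>"
proof -
  have "AE x in M. z x \<in> dev3" "AE x in M. z' x \<in> dev3"
    using assms by (auto simp: Zspace_def)
  then have "AE x in M. a *\<^sub>R z x + b *\<^sub>R z' x \<in> dev3"
    by eventually_elim (simp add: subspace_add subspace_scale subspace_dev3)
  then show ?thesis using assms H1_lincomb(1) by (auto simp: Zspace_def)
qed

text \<open>The residual \<open>a - dev_part a\<close> is linear, bounded and zero exactly on
  \<open>dev3\<close>. As it vanishes along \<open>z n\<close>, the residual of the limit is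
  controlled by the distance to \<open>z n\<close>, which tends to 0.\<close>

lemma Zspace_closed:
  assumes z: "\<And>n. z n \<in> Zspace \<Omega>" and v: "v \<in> H1 \<Omega>"
    and lim: "(\<lambda>n. H1_norm \<Omega> (\<lambda>x. z n x - v x)) \<longlonglongrightarrow> 0"
  shows "v \<in> Zspace \<Omega>"
proof -
  have zH: "z n \<in> H1 \<Omega>" and zd: "AE x in M. z n x \<in> dev3" for n
    using z by (auto simp: Zspace_def)
  have lin: "linear (\<lambda>a. a - dev_part a)"
    using linear_dev_part by (intro linear_compose_sub linear_ident)
  obtain B where B: "0 < B" "\<And>a. norm (a - dev_part a) \<le> B * norm a"
    using linear_bounded_pos[OF lin] by blast
  have "L2_norm \<Omega> (\<lambda>x. v x - dev_part (v x)) \<le> B * H1_norm \<Omega> (\<lambda>x. z n x - v x)" for n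
  proof -
    have "L2_norm \<Omega> (\<lambda>x. v x - dev_part (v x)) \<le> B * L2_norm \<Omega> (\<lambda>x. z n x - v x)"
    proof (rule L2_norm_le)
      show "AE x in M. norm (v x - dev_part (v x)) \<le> B * norm (z n x - v x)"
        using zd[of n]
      proof eventually_elim
        case (elim x)
        have "v x - dev_part (v x) = - ((z n x - v x) - dev_part (z n x - v x))"
          by (simp add: linear_diff[OF linear_dev_part] dev_part_id[OF elim])
        then show ?case using B(2)[of "z n x - v x"] by (simp only: norm_minus_cancel)
      qed
      show "(\<lambda>x. v x - dev_part (v x)) \<in> L2 \<Omega>"
        by (rule L2_linear_image[OF lin H1_imp_L2[OF v]])
    qed (use B zH v in \<open>auto intro: L2_diff H1_imp_L2\<close>)
    also have "\<dots> \<le> B * H1_norm \<Omega> (\<lambda>x. z n x - v x)"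
      using B by (intro mult_left_mono L2_norm_le_H1_norm_diff zH v) auto
    finally show ?thesis .
  qed
  then have "L2_norm \<Omega> (\<lambda>x. v x - dev_part (v x)) \<le> 0"
    using LIMSEQ_le_const[OF tendsto_mult_right_zero[OF lim, of B]] by blast
  then have "L2_norm \<Omega> (\<lambda>x. v x - dev_part (v x)) = 0" by (simp add: antisym)
  then have "AE x in M. v x - dev_part (v x) = 0"
    using L2_norm_eq_0_iff[OF L2_linear_image[OF lin H1_imp_L2[OF v]]] by simp
  then have "AE x in M. v x \<in> dev3"
    by eventually_elim (simp add: dev3_iff)
  then show ?thesis using v by (simp add: Zspace_def)
qed

text \<open>For \<open>h = 0\<close> closedness is that of zero traces and of deviatoric fields; for
  \<open>h > 0\<close> it is combined with the closedness of \<open>U h\<close> and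
  \<open>Z h\<close>.\<close>

lemma admissible_variations_Y_h0:
  assumes "space_approximation \<Omega> \<Gamma> c U Z q r" "0 \<le> h"
  shows "admissible_variations \<Omega> \<Gamma> (Y_h0 \<Omega> \<Gamma> U Z h)"
proof -
  have z0: "(\<lambda>x. 0) \<in> Zspace \<Omega>"
    using subspace_0[OF subspace_dev3] by (simp add: Zspace_def H1_zero)
  have bc: "w \<in> Y_bc \<Omega> \<Gamma> (\<lambda>x. 0) \<longleftrightarrow> fst w \<in> H1 \<Omega> \<and> snd w \<in> Zspace \<Omega> \<and> has_trace \<Omega> \<Gamma> (fst w) (\<lambda>x. 0)" for w
    by (cases w) (auto simp: Y_bc_def Yspace_def equal_on_boundary_def)
  have lin: "state_comb a w b y \<in> Y_bc \<Omega> \<Gamma> (\<lambda>x. 0)" if "w \<in> Y_bc \<Omega> \<Gamma> (\<lambda>x. 0)" "y \<in> Y_bc \<Omega> \<Gamma> (\<lambda>x. 0)" for a b w y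
    using that by (auto simp: bc state_comb_def intro: H1_lincomb Zspace_lincomb zero_trace_lincomb)
  show ?thesis
  proof (cases "h = 0")
    case True
    show ?thesis
      unfolding admissible_variations_def Y_h0_def if_P[OF True]
    proof (intro conjI ballI allI impI)
      fix W :: "nat \<Rightarrow> state" and y
      assume a: "(\<forall>n. W n \<in> Y_bc \<Omega> \<Gamma> (\<lambda>x. 0)) \<and> fst y \<in> H1 \<Omega> \<and> snd y \<in> H1 \<Omega> \<and>
        (\<lambda>n. H1_norm \<Omega> (\<lambda>x. fst (W n) x - fst y x)) \<longlonglongrightarrow> 0 \<and>
        (\<lambda>n. H1_norm \<Omega> (\<lambda>x. snd (W n) x - snd y x)) \<longlonglongrightarrow> 0"
      then show "y \<in> Y_bc \<Omega> \<Gamma> (\<lambda>x. 0)"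
        unfolding bc using zero_trace_closed[of \<Gamma> "\<lambda>n. fst (W n)" "fst y"] Zspace_closed[of "\<lambda>n. snd (W n)" "snd y"]
        by simp
    qed (use zero_trace_zero lin z0 in \<open>auto simp: bc H1_zero\<close>)
  next
    case False
    then have h: "0 < h" using assms(2) by simp
    have U: "closed_subspace_of_H1 \<Omega> (U h)" and Z: "closed_subspace_of_H1 \<Omega> (Z h)"
      using assms(1) h by (auto simp: space_approximation_def)
    note UD = U[unfolded closed_subspace_of_H1_def] and ZD = Z[unfolded closed_subspace_of_H1_def]
    have "Y_h0 \<Omega> \<Gamma> U Z h = {w. fst w \<in> U h \<and> snd w \<in> Z h \<and> w \<in> Y_bc \<Omega> \<Gamma> (\<lambda>x. 0)}"
      using False by (auto simp: Y_h0_def)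
    note S = this
    show ?thesis
      unfolding admissible_variations_def S
    proof (intro conjI ballI allI impI)
      fix w y a b
      assume "w \<in> {w. fst w \<in> U h \<and> snd w \<in> Z h \<and> w \<in> Y_bc \<Omega> \<Gamma> (\<lambda>x. 0)}"
        "y \<in> {w. fst w \<in> U h \<and> snd w \<in> Z h \<and> w \<in> Y_bc \<Omega> \<Gamma> (\<lambda>x. 0)}"
      then show "state_comb a w b y \<in> {w. fst w \<in> U h \<and> snd w \<in> Z h \<and> w \<in> Y_bc \<Omega> \<Gamma> (\<lambda>x. 0)}"
        using lin[of w y a b] UD ZD by (simp add: state_comb_def)
    next
      fix W :: "nat \<Rightarrow> state" and y
      assume a: "(\<forall>n. W n \<in> {w. fst w \<in> U h \<and> snd w \<in> Z h \<and> w \<in> Y_bc \<Omega> \<Gamma> (\<lambda>x. 0)}) \<and> fst y \<in> H1 \<Omega> \<and> snd y \<in> H1 \<Omega> \<and>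
        (\<lambda>n. H1_norm \<Omega> (\<lambda>x. fst (W n) x - fst y x)) \<longlonglongrightarrow> 0 \<and>
        (\<lambda>n. H1_norm \<Omega> (\<lambda>x. snd (W n) x - snd y x)) \<longlonglongrightarrow> 0"
      have "y \<in> Y_bc \<Omega> \<Gamma> (\<lambda>x. 0)"
        using a unfolding bc using zero_trace_closed[of \<Gamma> "\<lambda>n. fst (W n)" "fst y"] Zspace_closed[of "\<lambda>n. snd (W n)" "snd y"]
        by simp
      moreover have "\<forall>w u. (\<forall>n::nat. w n \<in> U h) \<and> u \<in> H1 \<Omega> \<and> (\<lambda>n. H1_norm \<Omega> (\<lambda>x. w n x - u x)) \<longlonglongrightarrow> 0 \<longrightarrow> u \<in> U h"
        using UD by (elim conjE)
      from this[rule_format, of "\<lambda>n. fst (W n)" "fst y"] have "fst y \<in> U h" using a by simp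
      moreover have "\<forall>w u. (\<forall>n::nat. w n \<in> Z h) \<and> u \<in> H1 \<Omega> \<and> (\<lambda>n. H1_norm \<Omega> (\<lambda>x. w n x - u x)) \<longlonglongrightarrow> 0 \<longrightarrow> u \<in> Z h"
        using ZD by (elim conjE)
      from this[rule_format, of "\<lambda>n. snd (W n)" "snd y"] have "snd y \<in> Z h" using a by simp
      ultimately show "y \<in> {w. fst w \<in> U h \<and> snd w \<in> Z h \<and> w \<in> Y_bc \<Omega> \<Gamma> (\<lambda>x. 0)}" by simp
    qed (use zero_trace_zero UD ZD z0 in \<open>auto simp: bc H1_zero\<close>)
  qed
qed

lemma jet_L2: "fst w \<in> H1 \<Omega> \<Longrightarrow> snd w \<in> H1 \<Omega> \<Longrightarrow> jet \<Omega> w \<in> L2 \<Omega>"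
  unfolding jet_def[abs_def] by (intro L2_Pair jet1_L2)

lemma jet_state_comb:
  assumes "fst w \<in> H1 \<Omega>" "snd w \<in> H1 \<Omega>" "fst y \<in> H1 \<Omega>" "snd y \<in> H1 \<Omega>"
  shows "AE x in M. jet \<Omega> (state_comb a w b y) x = a *\<^sub>R jet \<Omega> w x + b *\<^sub>R jet \<Omega> y x"
  using jet1_lincomb[OF assms(1,3), of a b] jet1_lincomb[OF assms(2,4), of a b]
  by eventually_elim (simp add: jet_def state_comb_def)

lemma Yspace_H1: "w \<in> Yspace \<Omega> \<Longrightarrow> fst w \<in> H1 \<Omega>" "w \<in> Yspace \<Omega> \<Longrightarrow> snd w \<in> H1 \<Omega>"
  by (auto simp: Yspace_def Zspace_def)

lemma Y_dist_eq_jet: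
  assumes "w \<in> Yspace \<Omega>" "y \<in> Yspace \<Omega>"
  shows "Y_dist \<Omega> w y = L2_norm \<Omega> (\<lambda>x. jet \<Omega> w x - jet \<Omega> y x)"
proof -
  note H = Yspace_H1[OF assms(1)] Yspace_H1[OF assms(2)]
  have i: "integrable M (\<lambda>x. (norm (jet1 \<Omega> (fst w) x - jet1 \<Omega> (fst y) x))\<^sup>2)"
    "integrable M (\<lambda>x. (norm (jet1 \<Omega> (snd w) x - jet1 \<Omega> (snd y) x))\<^sup>2)"
    using L2_diff[OF jet1_L2[OF H(1)] jet1_L2[OF H(3)]] L2_diff[OF jet1_L2[OF H(2)] jet1_L2[OF H(4)]]
    by (simp_all add: L2_def)
  have "(L2_norm \<Omega> (\<lambda>x. jet \<Omega> w x - jet \<Omega> y x))\<^sup>2 =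
      (L2_norm \<Omega> (\<lambda>x. jet1 \<Omega> (fst w) x - jet1 \<Omega> (fst y) x))\<^sup>2 + (L2_norm \<Omega> (\<lambda>x. jet1 \<Omega> (snd w) x - jet1 \<Omega> (snd y) x))\<^sup>2"
    unfolding L2_norm_power2 jet_def using i by (simp add: norm_Pair)
  then show ?thesis
    unfolding Y_dist_def by (simp add: H1_norm_diff_eq H real_sqrt_unique)
qed

lemma Y_dist_triangle:
  assumes "w \<in> Yspace \<Omega>" "y \<in> Yspace \<Omega>" "v \<in> Yspace \<Omega>"
  shows "Y_dist \<Omega> w v \<le> Y_dist \<Omega> w y + Y_dist \<Omega> y v"
  unfolding Y_dist_eq_jet[OF assms(1,3)] Y_dist_eq_jet[OF assms(1,2)] Y_dist_eq_jet[OF assms(2,3)]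
  by (intro L2_norm_triangle_diff jet_L2 Yspace_H1 assms)

lemma Y_dist_commute:
  assumes "w \<in> Yspace \<Omega>" "y \<in> Yspace \<Omega>"
  shows "Y_dist \<Omega> w y = Y_dist \<Omega> y w"
  by (simp add: Y_dist_eq_jet assms L2_norm_minus_commute[of \<Omega> "jet \<Omega> w"])

lemma Y_dist_nonneg: "0 \<le> Y_dist \<Omega> w y"
  by (simp add: Y_dist_def)

lemma Y_dist_self: "w \<in> Yspace \<Omega> \<Longrightarrow> Y_dist \<Omega> w w = 0"
  by (simp add: Y_dist_eq_jet)

lemma H1_norm_le_Y_dist:
  shows "H1_norm \<Omega> (\<lambda>x. fst w x - fst y x) \<le> Y_dist \<Omega> w y"
    and "H1_norm \<Omega> (\<lambda>x. snd w x - snd y x) \<le> Y_dist \<Omega> w y"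
  unfolding Y_dist_def by (auto intro: real_le_rsqrt)

lemma Y_dist_le_add:
  "Y_dist \<Omega> w y \<le> H1_norm \<Omega> (\<lambda>x. fst w x - fst y x) + H1_norm \<Omega> (\<lambda>x. snd w x - snd y x)"
  unfolding Y_dist_def by (intro sqrt_sum_squares_le_sum H1_norm_nonneg)

lemma shifted_Yspace:
  assumes "admissible_variations \<Omega> \<Gamma> S" "v \<in> H1 \<Omega>" "w \<in> shifted v S"
  shows "w \<in> Yspace \<Omega>"
proof -
  have "(\<lambda>x. fst w x - v x, snd w) \<in> S" using assms(3) by (auto simp: shifted_def)
  then have "(\<lambda>x. fst w x - v x, snd w) \<in> Y_bc \<Omega> \<Gamma> (\<lambda>x. 0)"
    using assms(1) by (auto simp: admissible_variations_def)
  then have *: "(\<lambda>x. fst w x - v x) \<in> H1 \<Omega>" "snd w \<in> Zspace \<Omega>" by (auto simp: Y_bc_def Yspace_def)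
  from H1_add[OF *(1) assms(2)] have "fst w \<in> H1 \<Omega>" by simp
  with * show ?thesis by (cases w) (simp add: Yspace_def)
qed

lemma shifted_midpoint:
  assumes "admissible_variations \<Omega> \<Gamma> S" "w \<in> shifted v S" "y \<in> shifted v S"
  shows "state_comb (1/2) w (1/2) y \<in> shifted v S"
proof -
  have "state_comb (1/2) (\<lambda>x. fst w x - v x, snd w) (1/2) (\<lambda>x. fst y x - v x, snd y) \<in> S"
    using assms by (auto simp: admissible_variations_def shifted_def)
  moreover have "(1/2) *\<^sub>R (a - c) + (1/2) *\<^sub>R (b - c) = (1/2) *\<^sub>R a + (1/2) *\<^sub>R b - c" for a b c :: vec3
  proof -
    have "(1/2) *\<^sub>R c + (1/2) *\<^sub>R c = c" by (simp flip: scaleR_add_left)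
    then show ?thesis by (simp add: scaleR_diff_right algebra_simps)
  qed
  ultimately show ?thesis by (simp add: shifted_def state_comb_def)
qed

text \<open>Two states with the same Dirichlet datum differ by a function of zero trace, which
  removes the boundary term from Korn's inequality.\<close>

lemma shifted_diff_zero_trace:
  assumes "admissible_variations \<Omega> \<Gamma> S" "w \<in> shifted v S" "y \<in> shifted v S"
  shows "has_trace \<Omega> \<Gamma> (\<lambda>x. fst w x - fst y x) (\<lambda>x. 0)"
proof -
  have "state_comb 1 (\<lambda>x. fst w x - v x, snd w) (- 1) (\<lambda>x. fst y x - v x, snd y) \<in> S"
    using assms by (auto simp: admissible_variations_def shifted_def)
  then have "state_comb 1 (\<lambda>x. fst w x - v x, snd w) (- 1) (\<lambda>x. fst y x - v x, snd y) \<in> Y_bc \<Omega> \<Gamma> (\<lambda>x. 0)"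
    using assms(1) by (auto simp: admissible_variations_def)
  then show ?thesis by (simp add: Y_bc_def state_comb_def equal_on_boundary_def)
qed

text \<open>Closedness of the variations combined with completeness of H^1 in each component. It
  supplies the limit of near-minimizers once uniform convexity has made them a Cauchy
  sequence.\<close>

lemma shifted_complete:
  assumes S: "admissible_variations \<Omega> \<Gamma> S" and v: "v \<in> H1 \<Omega>"
    and W: "\<And>n. W n \<in> shifted v S"
    and cauchy: "\<And>e. e > 0 \<Longrightarrow> \<exists>N. \<forall>m\<ge>N. \<forall>n\<ge>N. Y_dist \<Omega> (W m) (W n) < e"
  obtains y where "y \<in> shifted v S" "(\<lambda>n. Y_dist \<Omega> (W n) y) \<longlonglongrightarrow> 0"
proof -
  note WY = shifted_Yspace[OF S v W]
  have c1: "\<exists>N. \<forall>m\<ge>N. \<forall>n\<ge>N. H1_norm \<Omega> (\<lambda>x. fst (W m) x - fst (W n) x) < e" if "e > 0" for e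
    using cauchy[OF that] H1_norm_le_Y_dist(1) by (meson order.strict_trans1)
  obtain u where u: "u \<in> H1 \<Omega>" "(\<lambda>n. H1_norm \<Omega> (\<lambda>x. fst (W n) x - u x)) \<longlonglongrightarrow> 0"
    by (rule H1_complete[of "\<lambda>n. fst (W n)", OF Yspace_H1(1)[OF WY] c1])
  have c2: "\<exists>N. \<forall>m\<ge>N. \<forall>n\<ge>N. H1_norm \<Omega> (\<lambda>x. snd (W m) x - snd (W n) x) < e" if "e > 0" for e
    using cauchy[OF that] H1_norm_le_Y_dist(2) by (meson order.strict_trans1)
  obtain z where z: "z \<in> H1 \<Omega>" "(\<lambda>n. H1_norm \<Omega> (\<lambda>x. snd (W n) x - z x)) \<longlonglongrightarrow> 0"
    by (rule H1_complete[of "\<lambda>n. snd (W n)", OF Yspace_H1(2)[OF WY] c2])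
  have cl: "\<forall>V y. (\<forall>n::nat. V n \<in> S) \<and> fst y \<in> H1 \<Omega> \<and> snd y \<in> H1 \<Omega> \<and>
        (\<lambda>n. H1_norm \<Omega> (\<lambda>x. fst (V n) x - fst y x)) \<longlonglongrightarrow> 0 \<and>
        (\<lambda>n. H1_norm \<Omega> (\<lambda>x. snd (V n) x - snd y x)) \<longlonglongrightarrow> 0 \<longrightarrow> y \<in> S"
    using S unfolding admissible_variations_def by (elim conjE)
  have "(\<lambda>x. u x - v x, z) \<in> S"
    using cl[THEN spec, THEN spec, of "\<lambda>n. (\<lambda>x. fst (W n) x - v x, snd (W n))" "(\<lambda>x. u x - v x, z)"] W u z H1_diff[OF u(1) v]
    by (simp add: shifted_def split_beta)
  then have "(u, z) \<in> shifted v S" by (simp add: shifted_def)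
  moreover have "(\<lambda>n. Y_dist \<Omega> (W n) (u, z)) \<longlonglongrightarrow> 0"
  proof (rule tendsto_sandwich[OF _ _ tendsto_const])
    show "\<forall>\<^sub>F n in sequentially. Y_dist \<Omega> (W n) (u, z) \<le> H1_norm \<Omega> (\<lambda>x. fst (W n) x - u x) + H1_norm \<Omega> (\<lambda>x. snd (W n) x - z x)"
      using Y_dist_le_add[of _ "(u, z)"] by simp
    show "(\<lambda>n. H1_norm \<Omega> (\<lambda>x. fst (W n) x - u x) + H1_norm \<Omega> (\<lambda>x. snd (W n) x - z x)) \<longlonglongrightarrow> 0"
      using tendsto_add[OF u(2) z(2)] by simp
  qed (simp add: Y_dist_nonneg)
  ultimately show ?thesis by (rule that)
qed

end

section \<open>Pointwise properties of the energy density\<close>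

definition sym_part :: "tensor3 \<Rightarrow> tensor3" where
  "sym_part a = (1/2) *\<^sub>R (a + transpose a)"

lemma linear_sym_part: "linear sym_part"
  by (rule linearI) (simp_all add: sym_part_def linear_add[OF linear_transpose]
      linear_scale[OF linear_transpose] algebra_simps)

lemma sym_part_in_sym3: "sym_part a \<in> sym3"
  by (simp add: sym3_def sym_part_def linear_scale[OF linear_transpose] linear_add[OF linear_transpose] add.commute)

lemma sym_part_id: "a \<in> sym3 \<Longrightarrow> sym_part a = a"
  by (simp add: sym_part_def sym3_def flip: scaleR_2)

lemma dev3_subset_sym3: "dev3 \<subseteq> sym3"
  by (auto simp: dev3_def)

lemma subspace_sym3: "subspace sym3"
  unfolding subspace_def sym3_def
  by (simp add: linear_0[OF linear_transpose] linear_add[OF linear_transpose] linear_scale[OF linear_transpose])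

type_synonym jet_value = "(vec3 \<times> (vec3^3)) \<times> (tensor3 \<times> (tensor3^3))"

definition jet_grad :: "jet_value \<Rightarrow> tensor3" where "jet_grad p = snd (fst p)"
definition jet_z :: "jet_value \<Rightarrow> tensor3" where "jet_z p = fst (snd p)"
definition jet_dz :: "jet_value \<Rightarrow> tensor3^3" where "jet_dz p = snd (snd p)"

text \<open>The outer \<open>sym_part\<close> changes nothing for \<open>z\<close> in \<open>dev3\<close>. It is there because \<open>\<C>\<close> is unspecified
  outside \<open>sym3\<close>, whereas \<open>z\<close> takes values in \<open>dev3\<close> only almost everywhere.\<close>

definition elastic_strain :: "jet_value \<Rightarrow> tensor3" where
  "elastic_strain p = sym_part (sym_part (jet_grad p) - jet_z p)"

lemma linear_jet_z: "linear jet_z" and linear_jet_dz: "linear jet_dz" and linear_jet_grad: "linear jet_grad"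
  by (auto intro: linearI simp: jet_z_def jet_dz_def jet_grad_def)

lemma linear_elastic_strain: "linear elastic_strain"
  by (rule linearI) (simp_all add: elastic_strain_def linear_add[OF linear_sym_part] linear_diff[OF linear_sym_part]
      linear_scale[OF linear_sym_part] linear_add[OF linear_jet_z] linear_add[OF linear_jet_grad]
      linear_scale[OF linear_jet_z] linear_scale[OF linear_jet_grad] algebra_simps)

lemma norm_jet_z_le: "norm (jet_z p) \<le> norm p" and norm_jet_dz_le: "norm (jet_dz p) \<le> norm p"
  unfolding jet_z_def jet_dz_def
  by (rule order_trans[OF norm_fst_le_norm norm_snd_le_norm], rule order_trans[OF norm_snd_le_norm norm_snd_le_norm])

lemma elastic_strain_in_sym3: "elastic_strain p \<in> sym3"
  by (simp add: elastic_strain_def sym_part_in_sym3)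

section \<open>Convexity, growth and continuity of the densities\<close>

locale material =
  fixes \<C> :: "tensor3 \<Rightarrow> tensor3" and c\<^sub>1 c\<^sub>2 c\<^sub>3 \<nu> :: real and \<phi> :: "real \<Rightarrow> real" and D :: "tensor3 \<Rightarrow> real"
  assumes elasticity: "elasticity_tensor \<C>"
    and constants: "c\<^sub>1 > 0" "c\<^sub>2 > 0" "c\<^sub>3 > 0" "\<nu> > 0"
    and pen: "penalty c\<^sub>3 \<phi>"
    and diss: "dissipation_potential D"
begin

text \<open>The term with \<open>c\<^sub>2\<close> is taken out of the hardening function, so that
  the quadratic form controls \<open>z\<close> as well as its gradient and the elastic strain. What
  remains of the hardening, \<open>hard\<close>, is merely convex.\<close>

definition quad :: "jet_value \<Rightarrow> real" where
  "quad p = 1/2 * (\<C> (elastic_strain p) \<bullet> elastic_strain p) + \<nu>/2 * (norm (jet_dz p))\<^sup>2 + c\<^sub>2 * (norm (jet_z p))\<^sup>2"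

text \<open>Since \<open>\<phi> s / 0 = 0\<close>, \<open>hard 0 s\<close> is \<open>c\<^sub>1 \<bar>s\<bar>\<close>: the constraint in \<open>F\<^sub>0\<close> is not included.\<close>

definition hard :: "real \<Rightarrow> real \<Rightarrow> real" where
  "hard \<rho> s = c\<^sub>1 * (sqrt (\<rho>\<^sup>2 + s\<^sup>2) - \<rho>) + \<phi> s / \<rho>"

text \<open>\<open>D\<close> is specified only on \<open>dev3\<close>. Composed with the projection
  it is sublinear on all matrices, and the two agree at the values that occur almost
  everywhere.\<close>

definition D_dev :: "tensor3 \<Rightarrow> real" where "D_dev a = D (dev_part a)"

lemma C_lincomb:
  assumes "a \<in> sym3" "b \<in> sym3"
  shows "\<C> (s *\<^sub>R a + t *\<^sub>R b) = s *\<^sub>R \<C> a + t *\<^sub>R \<C> b"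
proof -
  have add: "\<forall>a\<in>sym3. \<forall>b\<in>sym3. \<C> (a + b) = \<C> a + \<C> b"
    and scale: "\<forall>a\<in>sym3. \<forall>s. \<C> (s *\<^sub>R a) = s *\<^sub>R \<C> a"
    using elasticity unfolding elasticity_tensor_def by simp_all
  show ?thesis
    using add[rule_format, of "s *\<^sub>R a" "t *\<^sub>R b"] scale assms subspace_scale[OF subspace_sym3] by simp
qed

lemma C_symmetric:
  assumes "a \<in> sym3" "b \<in> sym3" shows "\<C> a \<bullet> b = \<C> b \<bullet> a"
proof -
  have "\<forall>a\<in>sym3. \<forall>b\<in>sym3. \<C> a \<bullet> b = a \<bullet> \<C> b"
    using elasticity unfolding elasticity_tensor_def by (elim conjE)
  then show ?thesis using assms by (simp add: inner_commute)
qed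

lemma linear_C_sym_part: "linear (\<lambda>a. \<C> (sym_part a))"
proof (rule linearI)
  show "\<C> (sym_part (a + b)) = \<C> (sym_part a) + \<C> (sym_part b)" for a b
    using C_lincomb[OF sym_part_in_sym3[of a] sym_part_in_sym3[of b], of 1 1] by (simp add: linear_add[OF linear_sym_part])
  show "\<C> (sym_part (s *\<^sub>R a)) = s *\<^sub>R \<C> (sym_part a)" for s a
    using C_lincomb[OF sym_part_in_sym3[of a] sym_part_in_sym3[of a], of s 0] by (simp add: linear_scale[OF linear_sym_part])
qed

lemma C_bounded: obtains K where "K > 0" "\<And>a. a \<in> sym3 \<Longrightarrow> norm (\<C> a) \<le> K * norm a"
proof -
  obtain K where "K > 0" "\<And>a. norm (\<C> (sym_part a)) \<le> K * norm a"
    using linear_bounded_pos[OF linear_C_sym_part] by blast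
  then show ?thesis using that[of K] by (metis sym_part_id)
qed

text \<open>Positivity becomes a uniform bound because the form attains its minimum on the compact
  unit sphere of \<open>sym3\<close>; homogeneity does the rest.\<close>

lemma C_coercive: obtains \<alpha> where "\<alpha> > 0" "\<And>a. a \<in> sym3 \<Longrightarrow> \<alpha> * (norm a)\<^sup>2 \<le> \<C> a \<bullet> a"
proof -
  let ?S = "sphere 0 1 \<inter> sym3"
  define f where "f a = \<C> (sym_part a) \<bullet> a" for a
  have "compact ?S" using closed_subspace[OF subspace_sym3] by (intro compact_Int_closed) auto
  moreover have "?S \<noteq> {}"
  proof -
    have m: "(mat 1 :: tensor3) \<in> sym3" by (simp add: sym3_def transpose_mat)
    have "(mat 1 :: tensor3) \<noteq> 0" by (simp add: mat_def vec_eq_iff exI[of _ 1])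
    then have "(1 / norm (mat 1 :: tensor3)) *\<^sub>R mat 1 \<in> ?S"
      using subspace_scale[OF subspace_sym3 m] by simp
    then show ?thesis by blast
  qed
  moreover have "continuous_on ?S f"
    unfolding f_def[abs_def]
    by (intro continuous_on_inner linear_continuous_on continuous_on_id linear_conv_bounded_linear[THEN iffD1] linear_C_sym_part)
  ultimately obtain m where m: "m \<in> ?S" "\<And>a. a \<in> ?S \<Longrightarrow> f m \<le> f a"
    by (meson continuous_attains_inf)
  have "m \<noteq> 0" using m(1) by auto
  moreover have "\<forall>a\<in>sym3. a \<noteq> 0 \<longrightarrow> 0 < \<C> a \<bullet> a"
    using elasticity unfolding elasticity_tensor_def by (elim conjE)
  ultimately have pos: "f m > 0"
    using m(1) by (simp add: f_def sym_part_id)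
  have "f m * (norm a)\<^sup>2 \<le> \<C> a \<bullet> a" if a: "a \<in> sym3" for a
  proof (cases "a = 0")
    case True
    then show ?thesis using linear_0[OF linear_C_sym_part] sym_part_id[OF a] by simp
  next
    case False
    let ?b = "(1 / norm a) *\<^sub>R a"
    have b: "?b \<in> ?S" using False subspace_scale[OF subspace_sym3 a] by simp
    have "f ?b = (\<C> a \<bullet> a) / (norm a)\<^sup>2"
      using linear_scale[OF linear_C_sym_part, of "1 / norm a" a] sym_part_id[OF a]
      by (simp add: f_def power2_eq_square)
    then show ?thesis using mult_right_mono[OF m(2)[OF b], of "(norm a)\<^sup>2"] False by simp
  qed
  with pos show ?thesis by (rule that)
qed

definition bilin :: "jet_value \<Rightarrow> jet_value \<Rightarrow> real" where
  "bilin p p' = 1/2 * (\<C> (elastic_strain p) \<bullet> elastic_strain p') + \<nu>/2 * (jet_dz p \<bullet> jet_dz p') + c\<^sub>2 * (jet_z p \<bullet> jet_z p')"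

lemma quad_eq_bilin: "quad p = bilin p p"
  by (simp add: quad_def bilin_def power2_norm_eq_inner)

lemma bilin_commute: "bilin p p' = bilin p' p"
  using C_symmetric[OF elastic_strain_in_sym3[of p] elastic_strain_in_sym3[of p']]
  by (simp add: bilin_def inner_commute)

lemma bilin_lincomb: "bilin (s *\<^sub>R p + t *\<^sub>R p') r = s * bilin p r + t * bilin p' r"
  by (simp add: bilin_def linear_add[OF linear_elastic_strain] linear_scale[OF linear_elastic_strain]
      linear_add[OF linear_jet_z] linear_scale[OF linear_jet_z] linear_add[OF linear_jet_dz] linear_scale[OF linear_jet_dz]
      C_lincomb[OF elastic_strain_in_sym3 elastic_strain_in_sym3] inner_add_left algebra_simps)

lemma quad_lincomb: "quad (s *\<^sub>R p + t *\<^sub>R p') = s\<^sup>2 * quad p + 2 * s * t * bilin p p' + t\<^sup>2 * quad p'"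
proof -
  have "quad (s *\<^sub>R p + t *\<^sub>R p') = s * bilin (s *\<^sub>R p + t *\<^sub>R p') p + t * bilin (s *\<^sub>R p + t *\<^sub>R p') p'"
    by (simp add: quad_eq_bilin bilin_lincomb[of s p t p' "s *\<^sub>R p + t *\<^sub>R p'"] bilin_commute[of p "s *\<^sub>R p + t *\<^sub>R p'"] bilin_commute[of p' "s *\<^sub>R p + t *\<^sub>R p'"])
  then show ?thesis
    by (simp add: bilin_lincomb quad_eq_bilin bilin_commute[of p' p] power2_eq_square algebra_simps)
qed

text \<open>The parallelogram identity. Its last term is the only source of uniform convexity in the
  whole proof.\<close>

lemma quad_midpoint: "quad ((1/2) *\<^sub>R p + (1/2) *\<^sub>R p') = 1/2 * quad p + 1/2 * quad p' - 1/4 * quad (p - p')"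
  using quad_lincomb[of "1/2" p "1/2" p'] quad_lincomb[of 1 p "- 1" p'] by (simp add: power2_eq_square field_simps)

lemma quad_coercive:
  obtains \<alpha> where "\<alpha> > 0"
    "\<And>p. \<alpha> * (norm (elastic_strain p))\<^sup>2 + \<nu>/2 * (norm (jet_dz p))\<^sup>2 + c\<^sub>2 * (norm (jet_z p))\<^sup>2 \<le> quad p"
proof -
  obtain \<alpha> where "\<alpha> > 0" "\<And>a. a \<in> sym3 \<Longrightarrow> \<alpha> * (norm a)\<^sup>2 \<le> \<C> a \<bullet> a"
    using C_coercive by blast
  then show ?thesis
    by (intro that[of "\<alpha>/2"]) (auto simp: quad_def elastic_strain_in_sym3)
qed

lemma quad_nonneg: "0 \<le> quad p"
proof -
  obtain \<alpha> where \<alpha>: "\<alpha> > 0"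
    "\<alpha> * (norm (elastic_strain p))\<^sup>2 + \<nu>/2 * (norm (jet_dz p))\<^sup>2 + c\<^sub>2 * (norm (jet_z p))\<^sup>2 \<le> quad p"
    using quad_coercive by metis
  moreover have "0 \<le> \<alpha> * (norm (elastic_strain p))\<^sup>2 + \<nu>/2 * (norm (jet_dz p))\<^sup>2 + c\<^sub>2 * (norm (jet_z p))\<^sup>2"
    using \<alpha>(1) constants by (intro add_nonneg_nonneg mult_nonneg_nonneg) auto
  ultimately show ?thesis by linarith
qed

text \<open>The parallelogram identity with \<open>quad (p + p')\<close> dropped. It converts
  coercivity in the distance to a reference state into a lower bound for the energy itself.\<close>

lemma quad_diff_ge: "1/2 * quad (p - p') - quad p' \<le> quad p"
  using quad_lincomb[of 1 p "- 1" p'] quad_lincomb[of 1 p 1 p'] quad_nonneg[of "p + p'"] by simp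

lemma bilin_bounded: obtains K where "K > 0" "\<And>p p'. \<bar>bilin p p'\<bar> \<le> K * norm p * norm p'"
proof -
  obtain K where K: "K > 0" "\<And>a. a \<in> sym3 \<Longrightarrow> norm (\<C> a) \<le> K * norm a" using C_bounded by blast
  obtain B where B: "B > 0" "\<And>p. norm (elastic_strain p) \<le> B * norm p"
    using linear_bounded_pos[OF linear_elastic_strain] by blast
  have "\<bar>bilin p p'\<bar> \<le> (K * B * B + \<nu> + c\<^sub>2) * norm p * norm p'" for p p'
  proof -
    have 1: "\<bar>\<C> (elastic_strain p) \<bullet> elastic_strain p'\<bar> \<le> (K * (B * norm p)) * (B * norm p')"
    proof (rule order_trans[OF Cauchy_Schwarz_ineq2], rule mult_mono)
      show "norm (\<C> (elastic_strain p)) \<le> K * (B * norm p)"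
        using K(2)[OF elastic_strain_in_sym3[of p]] mult_left_mono[OF B(2)[of p], of K] K(1) by linarith
    qed (use B K in auto)
    have 2: "\<bar>jet_dz p \<bullet> jet_dz p'\<bar> \<le> norm p * norm p'"
      by (rule order_trans[OF Cauchy_Schwarz_ineq2], rule mult_mono) (auto simp: norm_jet_dz_le)
    have 3: "\<bar>jet_z p \<bullet> jet_z p'\<bar> \<le> norm p * norm p'"
      by (rule order_trans[OF Cauchy_Schwarz_ineq2], rule mult_mono) (auto simp: norm_jet_z_le)
    have "\<bar>bilin p p'\<bar> \<le> 1/2 * \<bar>\<C> (elastic_strain p) \<bullet> elastic_strain p'\<bar> + \<nu>/2 * \<bar>jet_dz p \<bullet> jet_dz p'\<bar> + c\<^sub>2 * \<bar>jet_z p \<bullet> jet_z p'\<bar>"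
      unfolding bilin_def using constants
      by (intro order_trans[OF abs_triangle_ineq] add_mono) (auto simp: abs_mult)
    also have "\<dots> \<le> 1/2 * ((K * (B * norm p)) * (B * norm p')) + \<nu>/2 * (norm p * norm p') + c\<^sub>2 * (norm p * norm p')"
      using 1 2 3 constants by (intro add_mono mult_left_mono) auto
    also have "\<dots> \<le> 1 * ((K * (B * norm p)) * (B * norm p')) + \<nu> * (norm p * norm p') + c\<^sub>2 * (norm p * norm p')"
      using K(1) B(1) constants by (intro add_mono mult_right_mono) auto
    finally show ?thesis by (simp add: algebra_simps)
  qed
  moreover have "K * B * B + \<nu> + c\<^sub>2 > 0" using K(1) B(1) constants by (intro add_pos_pos mult_pos_pos) auto
  ultimately show ?thesis using that by blast
qed

text \<open>The difference of two values factors as \<open>bilin (p - p') (p + p')\<close>.\<close>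

lemma quad_lipschitz:
  obtains K where "K > 0" "\<And>p p'. \<bar>quad p - quad p'\<bar> \<le> K * (norm p + norm p') * norm (p - p')"
    "\<And>p. \<bar>quad p\<bar> \<le> K * (norm p)\<^sup>2"
proof -
  obtain K where K: "K > 0" "\<And>p p'. \<bar>bilin p p'\<bar> \<le> K * norm p * norm p'" using bilin_bounded by blast
  have "\<bar>quad p - quad p'\<bar> \<le> K * (norm p + norm p') * norm (p - p')" for p p'
  proof -
    have "bilin (p - p') (p + p') = bilin p (p + p') - bilin p' (p + p')"
      using bilin_lincomb[of 1 p "- 1" p' "p + p'"] by simp
    also have "\<dots> = quad p - quad p'"
      using bilin_lincomb[of 1 p 1 p' p] bilin_lincomb[of 1 p 1 p' p']
      by (simp add: bilin_commute[of _ "p + p'"] quad_eq_bilin bilin_commute[of p' p])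
    finally have "\<bar>quad p - quad p'\<bar> \<le> K * norm (p - p') * norm (p + p')" using K(2) by metis
    also have "\<dots> \<le> K * norm (p - p') * (norm p + norm p')"
      using K(1) by (intro mult_left_mono norm_triangle_ineq) auto
    finally show ?thesis by (simp add: mult.commute mult.left_commute)
  qed
  moreover have "\<bar>quad p\<bar> \<le> K * (norm p)\<^sup>2" for p
    using K(2)[of p p] by (simp add: quad_eq_bilin power2_eq_square mult.assoc)
  ultimately show ?thesis using K(1) that by blast
qed

lemma \<phi>_nonneg: "0 \<le> \<phi> s"
proof -
  have "\<phi> (min s c\<^sub>3) = 0" "mono \<phi>" using pen by (auto simp: penalty_def)
  then show ?thesis by (metis min.cobounded1 monoD)
qed

lemma \<phi>_eq_0_iff: "\<phi> s = 0 \<longleftrightarrow> s \<le> c\<^sub>3"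
  using pen by (simp add: penalty_def)

lemma \<phi>_lipschitz: obtains L where "L > 0" "\<And>s t. \<bar>\<phi> s - \<phi> t\<bar> \<le> L * \<bar>s - t\<bar>"
proof -
  have "Cn (Suc (Suc 0)) \<phi>" using pen by (simp add: penalty_def numeral_2_eq_2)
  then have "\<phi> differentiable (at s)" for s by simp
  then have d: "(\<phi> has_real_derivative deriv \<phi> s) (at s)" for s
    by (simp add: DERIV_deriv_iff_real_differentiable)
  obtain L where L: "L > 0" "\<And>s. \<bar>deriv \<phi> s\<bar> \<le> L"
    using pen by (auto simp: penalty_def bounded_pos)
  have "\<bar>\<phi> s - \<phi> t\<bar> \<le> L * \<bar>s - t\<bar>" for s t
    using field_differentiable_bound[of UNIV \<phi> "deriv \<phi>" L s t] d L(2) by simp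
  with L(1) show ?thesis by (rule that)
qed

text \<open>The root is the norm of the pair \<open>(\<rho>, s)\<close>, and the claim is the
  triangle inequality for changing its first entry.\<close>

lemma sqrt_minus_antimono:
  fixes \<rho> \<rho>' s :: real assumes "\<rho>' \<le> \<rho>"
  shows "sqrt (\<rho>\<^sup>2 + s\<^sup>2) - \<rho> \<le> sqrt (\<rho>'\<^sup>2 + s\<^sup>2) - \<rho>'"
proof -
  have "norm (\<rho>, s) \<le> norm (\<rho>', s) + norm (\<rho> - \<rho>', 0 :: real)"
    using norm_triangle_ineq[of "(\<rho>', s)" "(\<rho> - \<rho>', 0)"] by simp
  then show ?thesis using assms by (simp add: norm_Pair)
qed

lemma hard_0: "hard 0 s = c\<^sub>1 * \<bar>s\<bar>"
  by (simp add: hard_def)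

lemma hard_nonneg: assumes "0 \<le> \<rho>" shows "0 \<le> hard \<rho> s"
proof -
  have "\<rho> \<le> sqrt (\<rho>\<^sup>2 + s\<^sup>2)" using assms by (intro real_le_rsqrt) simp
  then show ?thesis using assms \<phi>_nonneg constants by (simp add: hard_def)
qed

text \<open>The condition \<open>0 < \<rho>'\<close> is essential: \<open>hard 0\<close> carries no
  penalty, so the inequality can fail at \<open>\<rho>' = 0\<close> where \<phi> is
  positive.\<close>

lemma hard_antimono:
  assumes "0 < \<rho>'" "\<rho>' \<le> \<rho>" shows "hard \<rho> s \<le> hard \<rho>' s"
  unfolding hard_def using assms constants \<phi>_nonneg[of s] sqrt_minus_antimono[OF assms(2), of s]
  by (intro add_mono mult_left_mono) (auto intro: divide_left_mono)

text \<open>Below the threshold the penalty vanishes, so here monotonicity extends to the limit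
  value 0. This is the inequality behind the upper bound along recovery states.\<close>

lemma hard_le_hard_0:
  assumes "0 \<le> \<rho>" "s \<le> c\<^sub>3" shows "hard \<rho> s \<le> hard 0 s"
  using sqrt_minus_antimono[OF assms(1), of s] constants assms \<phi>_eq_0_iff[of s] by (simp add: hard_def)

text \<open>The converse comparison, up to an error linear in \<rho>. The penalty is kept on the
  left because it later forces the constraint on the limit.\<close>

lemma hard_0_le: "hard 0 s + \<phi> s / \<rho> \<le> hard \<rho> s + c\<^sub>1 * \<rho>"
proof -
  have "c\<^sub>1 * \<bar>s\<bar> \<le> c\<^sub>1 * sqrt (\<rho>\<^sup>2 + s\<^sup>2)"
    using constants by (intro mult_left_mono real_le_rsqrt) auto
  then show ?thesis by (simp add: hard_0) (simp add: hard_def algebra_simps)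
qed

text \<open>The constant \<open>c\<^sub>1 + L / \<rho>\<close> blows up for small positive \<rho>,
  so continuity estimates built on this are valid only at fixed \<rho>. At \<open>\<rho> = 0\<close>
  the convention for division by zero gives the correct constant \<open>c\<^sub>1\<close>.\<close>

lemma hard_lipschitz:
  assumes "0 \<le> \<rho>"
  obtains L where "L > 0" "\<And>s t. \<bar>hard \<rho> s - hard \<rho> t\<bar> \<le> L * \<bar>s - t\<bar>"
proof -
  obtain L where L: "L > 0" "\<And>s t. \<bar>\<phi> s - \<phi> t\<bar> \<le> L * \<bar>s - t\<bar>" using \<phi>_lipschitz by blast
  have "\<bar>hard \<rho> s - hard \<rho> t\<bar> \<le> (c\<^sub>1 + L / \<rho>) * \<bar>s - t\<bar>" for s t
  proof -
    have "\<bar>norm (\<rho>, s) - norm (\<rho>, t)\<bar> \<le> norm ((\<rho>, s) - (\<rho>, t))" by (rule norm_triangle_ineq3)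
    then have 1: "c\<^sub>1 * \<bar>sqrt (\<rho>\<^sup>2 + s\<^sup>2) - sqrt (\<rho>\<^sup>2 + t\<^sup>2)\<bar> \<le> c\<^sub>1 * \<bar>s - t\<bar>"
      using constants by (intro mult_left_mono) (auto simp: norm_Pair)
    have 2: "\<bar>\<phi> s - \<phi> t\<bar> / \<rho> \<le> L * \<bar>s - t\<bar> / \<rho>"
      using L(2) assms by (intro divide_right_mono)
    have "hard \<rho> s - hard \<rho> t = c\<^sub>1 * (sqrt (\<rho>\<^sup>2 + s\<^sup>2) - sqrt (\<rho>\<^sup>2 + t\<^sup>2)) + (\<phi> s - \<phi> t) / \<rho>"
      by (simp add: hard_def algebra_simps diff_divide_distrib)
    then have "\<bar>hard \<rho> s - hard \<rho> t\<bar> \<le> c\<^sub>1 * \<bar>sqrt (\<rho>\<^sup>2 + s\<^sup>2) - sqrt (\<rho>\<^sup>2 + t\<^sup>2)\<bar> + \<bar>\<phi> s - \<phi> t\<bar> / \<rho>"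
      using constants assms abs_triangle_ineq[of "c\<^sub>1 * (sqrt (\<rho>\<^sup>2 + s\<^sup>2) - sqrt (\<rho>\<^sup>2 + t\<^sup>2))" "(\<phi> s - \<phi> t) / \<rho>"]
      by (simp add: abs_mult)
    with 1 2 show ?thesis by (simp add: algebra_simps)
  qed
  moreover have "c\<^sub>1 + L / \<rho> > 0" using constants L(1) assms by (simp add: add_pos_nonneg)
  ultimately show ?thesis using that by blast
qed

lemma hard_mono: assumes "0 \<le> \<rho>" "0 \<le> s" "s \<le> t" shows "hard \<rho> s \<le> hard \<rho> t"
proof -
  have "mono \<phi>" using pen by (simp add: penalty_def)
  then have "\<phi> s \<le> \<phi> t" using assms(3) by (rule monoD)
  then show ?thesis
    unfolding hard_def using assms constants
    by (intro add_mono mult_left_mono divide_right_mono diff_right_mono real_sqrt_le_mono add_left_mono power_mono) auto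
qed

lemma hard_midpoint: assumes "0 \<le> \<rho>" shows "hard \<rho> (1/2 * s + 1/2 * t) \<le> 1/2 * hard \<rho> s + 1/2 * hard \<rho> t"
proof -
  have "convex_on UNIV \<phi>" using pen by (simp add: penalty_def)
  from convex_onD[OF this, of "1/2" s t]
  have "\<phi> (1/2 * s + 1/2 * t) \<le> 1/2 * \<phi> s + 1/2 * \<phi> t" by simp
  then have 1: "\<phi> (1/2 * s + 1/2 * t) / \<rho> \<le> 1/2 * (\<phi> s / \<rho>) + 1/2 * (\<phi> t / \<rho>)"
    using assms divide_right_mono[of "\<phi> (1/2 * s + 1/2 * t)" "1/2 * \<phi> s + 1/2 * \<phi> t" \<rho>] by (simp add: add_divide_distrib)
  have "norm ((1/2) *\<^sub>R (\<rho>, s) + (1/2) *\<^sub>R (\<rho>, t)) \<le> 1/2 * norm (\<rho>, s) + 1/2 * norm (\<rho>, t)"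
    by (rule order_trans[OF norm_triangle_ineq]) (simp del: scaleR_Pair)
  then have "c\<^sub>1 * sqrt (\<rho>\<^sup>2 + (1/2 * s + 1/2 * t)\<^sup>2) \<le> c\<^sub>1 * (1/2 * sqrt (\<rho>\<^sup>2 + s\<^sup>2) + 1/2 * sqrt (\<rho>\<^sup>2 + t\<^sup>2))"
    using constants by (intro mult_left_mono) (auto simp: norm_Pair)
  with 1 show ?thesis by (simp add: hard_def algebra_simps)
qed

text \<open>Convexity survives composition with the norm because \<open>hard \<rho>\<close> is
  nondecreasing on nonnegative arguments.\<close>

lemma hard_norm_midpoint:
  fixes a b :: "'a::real_normed_vector"
  assumes "0 \<le> \<rho>" shows "hard \<rho> (norm ((1/2) *\<^sub>R a + (1/2) *\<^sub>R b)) \<le> 1/2 * hard \<rho> (norm a) + 1/2 * hard \<rho> (norm b)"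
proof -
  have "norm ((1/2) *\<^sub>R a + (1/2) *\<^sub>R b) \<le> 1/2 * norm a + 1/2 * norm b"
    by (rule order_trans[OF norm_triangle_ineq]) simp
  from hard_mono[OF assms norm_ge_zero this] hard_midpoint[OF assms, of "norm a" "norm b"] show ?thesis by linarith
qed

lemma D_dev_nonneg: "0 \<le> D_dev a"
  using diss dev_part_in_dev3 by (simp add: D_dev_def dissipation_potential_def)

lemma D_dev_scaleR: "0 \<le> s \<Longrightarrow> D_dev (s *\<^sub>R a) = s * D_dev a"
  using diss dev_part_in_dev3 by (simp add: D_dev_def dissipation_potential_def linear_scale[OF linear_dev_part])

lemma D_dev_add: "D_dev (a + b) \<le> D_dev a + D_dev b"
  using diss dev_part_in_dev3 by (simp add: D_dev_def dissipation_potential_def linear_add[OF linear_dev_part])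

text \<open>A sublinear function on a finite-dimensional space grows at most linearly: expand in the
  basis and use subadditivity. Both \<open>b\<close> and \<open>- b\<close> enter the constant since
  \<open>D\<close> need not be even.\<close>

lemma D_dev_bounded: obtains K where "K > 0" "\<And>a. D_dev a \<le> K * norm a"
proof -
  define K where "K = (\<Sum>b\<in>Basis. D_dev b + D_dev (- b))"
  have sum: "D_dev (\<Sum>b\<in>B. f b) \<le> (\<Sum>b\<in>B. D_dev (f b))" if "finite B" for B and f :: "tensor3 \<Rightarrow> tensor3"
    using that
  proof (induction B)
    case empty
    then show ?case using D_dev_scaleR[of 0 0] by simp
  next
    case (insert b B)
    then show ?case using D_dev_add[of "f b" "sum f B"] by simp
  qed
  have "D_dev a \<le> K * norm a" for a
  proof -
    have "D_dev a = D_dev (\<Sum>b\<in>Basis. (a \<bullet> b) *\<^sub>R b)" by (simp add: euclidean_representation)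
    also have "\<dots> \<le> (\<Sum>b\<in>Basis. D_dev ((a \<bullet> b) *\<^sub>R b))" by (rule sum) simp
    also have "\<dots> \<le> (\<Sum>b\<in>Basis. (D_dev b + D_dev (- b)) * norm a)"
    proof (rule sum_mono)
      fix b :: tensor3 assume b: "b \<in> Basis"
      have "D_dev ((a \<bullet> b) *\<^sub>R b) \<le> \<bar>a \<bullet> b\<bar> * (D_dev b + D_dev (- b))"
      proof (cases "0 \<le> a \<bullet> b")
        case True
        then show ?thesis using D_dev_nonneg[of "- b"] by (simp add: D_dev_scaleR algebra_simps)
      next
        case False
        then have "D_dev ((- (a \<bullet> b)) *\<^sub>R (- b)) = - (a \<bullet> b) * D_dev (- b)" by (intro D_dev_scaleR) simp
        then show ?thesis using False D_dev_nonneg[of b] by (simp add: algebra_simps mult_nonneg_nonpos2)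
      qed
      also have "\<dots> \<le> norm a * (D_dev b + D_dev (- b))"
        using Basis_le_norm[OF b] D_dev_nonneg by (intro mult_right_mono add_nonneg_nonneg) auto
      finally show "D_dev ((a \<bullet> b) *\<^sub>R b) \<le> (D_dev b + D_dev (- b)) * norm a" by (simp add: mult.commute)
    qed
    finally show ?thesis by (simp add: K_def sum_distrib_right)
  qed
  moreover have "K \<ge> 0" unfolding K_def by (intro sum_nonneg add_nonneg_nonneg D_dev_nonneg)
  ultimately show ?thesis
    by (intro that[of "K + 1"]) (auto intro: order_trans[OF _ mult_right_mono[of K "K + 1"]])
qed

text \<open>Subadditivity for \<open>a = b + (a - b)\<close> turns linear growth into a Lipschitz
  bound with the same constant.\<close>

lemma D_dev_lipschitz: obtains K where "K > 0" "\<And>a b. \<bar>D_dev a - D_dev b\<bar> \<le> K * norm (a - b)"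
proof -
  obtain K where K: "K > 0" "\<And>a. D_dev a \<le> K * norm a" using D_dev_bounded by blast
  have "D_dev a - D_dev b \<le> K * norm (a - b)" for a b
    using D_dev_add[of b "a - b"] K(2)[of "a - b"] by simp
  then have "\<bar>D_dev a - D_dev b\<bar> \<le> K * norm (a - b)" for a b
    by (metis abs_le_iff minus_diff_eq norm_minus_commute)
  with K(1) show ?thesis by (rule that)
qed

lemma D_dev_midpoint: "D_dev ((1/2) *\<^sub>R a + (1/2) *\<^sub>R b) \<le> 1/2 * D_dev a + 1/2 * D_dev b"
  using D_dev_add[of "(1/2) *\<^sub>R a" "(1/2) *\<^sub>R b"] D_dev_scaleR[of "1/2"] by simp

definition dens :: "real \<Rightarrow> tensor3 \<Rightarrow> jet_value \<Rightarrow> real" where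
  "dens \<rho> a p = quad p + hard \<rho> (norm (jet_z p)) + D_dev (jet_z p - a)"

text \<open>The hardening and dissipation terms are convex and contribute nothing beyond that; the
  gain is exactly the one of \<open>quad_midpoint\<close>, hence independent of \<rho> and of
  \<open>a\<close>.\<close>

lemma dens_midpoint:
  assumes "0 \<le> \<rho>"
  shows "dens \<rho> a ((1/2) *\<^sub>R p + (1/2) *\<^sub>R p') \<le> 1/2 * dens \<rho> a p + 1/2 * dens \<rho> a p' - 1/4 * quad (p - p')"
proof -
  have z: "jet_z ((1/2) *\<^sub>R p + (1/2) *\<^sub>R p') = (1/2) *\<^sub>R jet_z p + (1/2) *\<^sub>R jet_z p'"
    by (simp add: linear_add[OF linear_jet_z] linear_scale[OF linear_jet_z])
  have "(1/2) *\<^sub>R jet_z p + (1/2) *\<^sub>R jet_z p' - a = (1/2) *\<^sub>R (jet_z p - a) + (1/2) *\<^sub>R (jet_z p' - a)"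
  proof -
    have "(1/2) *\<^sub>R a + (1/2) *\<^sub>R a = a" by (simp flip: scaleR_add_left)
    then show ?thesis by (simp add: scaleR_diff_right algebra_simps)
  qed
  then have "D_dev ((1/2) *\<^sub>R jet_z p + (1/2) *\<^sub>R jet_z p' - a) \<le> 1/2 * D_dev (jet_z p - a) + 1/2 * D_dev (jet_z p' - a)"
    using D_dev_midpoint by simp
  then show ?thesis
    using quad_midpoint[of p p'] hard_norm_midpoint[OF assms, of "jet_z p" "jet_z p'"] unfolding dens_def z
    by (simp add: distrib_left)
qed

text \<open>The bound is written around \<open>p'\<close> so that, after integration, only the norm
  of a fixed jet and the distance appear; no bound on \<open>p\<close> is presupposed.\<close>

lemma dens_lipschitz:
  assumes "0 \<le> \<rho>"
  obtains K where "K > 0" "\<And>a p p'. \<bar>dens \<rho> a p - dens \<rho> a p'\<bar> \<le> K * ((1 + 2 * norm p' + norm (p - p')) * norm (p - p'))"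
proof -
  obtain K1 where K1: "K1 > 0" "\<And>p p'. \<bar>quad p - quad p'\<bar> \<le> K1 * (norm p + norm p') * norm (p - p')"
    "\<And>p. \<bar>quad p\<bar> \<le> K1 * (norm p)\<^sup>2" by (rule quad_lipschitz) (rule that)
  obtain K2 where K2: "K2 > 0" "\<And>s t. \<bar>hard \<rho> s - hard \<rho> t\<bar> \<le> K2 * \<bar>s - t\<bar>" by (rule hard_lipschitz[OF assms]) (rule that)
  obtain K3 where K3: "K3 > 0" "\<And>a b. \<bar>D_dev a - D_dev b\<bar> \<le> K3 * norm (a - b)" by (rule D_dev_lipschitz) (rule that)
  have "\<bar>dens \<rho> a p - dens \<rho> a p'\<bar> \<le> (K1 + K2 + K3) * ((1 + 2 * norm p' + norm (p - p')) * norm (p - p'))" for a p p'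
  proof -
    let ?d = "norm (p - p')" and ?m = "(1 + 2 * norm p' + norm (p - p')) * norm (p - p')"
    have zd: "norm (jet_z p - jet_z p') \<le> ?d"
      using norm_jet_z_le[of "p - p'"] by (simp add: linear_diff[OF linear_jet_z])
    have dm: "?d \<le> ?m" by (simp add: algebra_simps)
    have "norm p + norm p' \<le> 1 + 2 * norm p' + ?d" using norm_triangle_ineq[of "p - p'" p'] by simp
    then have "(norm p + norm p') * ?d \<le> ?m" by (intro mult_right_mono) auto
    then have "K1 * ((norm p + norm p') * ?d) \<le> K1 * ?m" using K1(1) by (intro mult_left_mono) auto
    then have 1: "\<bar>quad p - quad p'\<bar> \<le> K1 * ?m" using K1(2)[of p p'] by (simp add: mult.assoc)
    have "\<bar>norm (jet_z p) - norm (jet_z p')\<bar> \<le> ?m" using norm_triangle_ineq3[of "jet_z p" "jet_z p'"] zd dm by linarith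
    from mult_left_mono[OF this, of K2]
    have 2: "\<bar>hard \<rho> (norm (jet_z p)) - hard \<rho> (norm (jet_z p'))\<bar> \<le> K2 * ?m"
      using K2(2)[of "norm (jet_z p)" "norm (jet_z p')"] K2(1) by linarith
    have "norm ((jet_z p - a) - (jet_z p' - a)) \<le> ?m" using zd dm by simp
    from mult_left_mono[OF this, of K3]
    have 3: "\<bar>D_dev (jet_z p - a) - D_dev (jet_z p' - a)\<bar> \<le> K3 * ?m"
      using K3(2)[of "jet_z p - a" "jet_z p' - a"] K3(1) by linarith
    show ?thesis using 1 2 3 unfolding dens_def distrib_right by linarith
  qed
  moreover have "K1 + K2 + K3 > 0" using K1 K2 K3 by simp
  ultimately show ?thesis using that by blast
qed

lemma dens_lower:
  assumes "0 \<le> \<rho>" shows "quad p \<le> dens \<rho> a p"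
  using hard_nonneg[OF assms] D_dev_nonneg by (simp add: dens_def)

end

section \<open>The energy functional\<close>

lemma continuous_on_UNIV_if_lipschitz_bound:
  fixes f :: "'a::real_normed_vector \<Rightarrow> real"
  assumes "\<And>a b. \<bar>f a - f b\<bar> \<le> K * norm (a - b)" "K > 0"
  shows "continuous_on UNIV f"
proof -
  have "K-lipschitz_on UNIV f"
    using assms by (intro lipschitz_onI) (auto simp: dist_norm)
  then show ?thesis by (rule lipschitz_on_continuous_on)
qed

context material
begin

lemma linear_C_elastic_strain: "linear (\<lambda>p. \<C> (elastic_strain p))"
  using linear_compose[OF linear_elastic_strain linear_C_sym_part] sym_part_id[OF elastic_strain_in_sym3]
  by (simp add: o_def)

lemma continuous_on_quad: "continuous_on UNIV quad"
  unfolding quad_def[abs_def]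
  by (intro continuous_intros linear_continuous_on linear_conv_bounded_linear[THEN iffD1]
      linear_C_elastic_strain linear_elastic_strain linear_jet_z linear_jet_dz)

lemma continuous_on_hard: assumes "0 \<le> \<rho>" shows "continuous_on UNIV (hard \<rho>)"
proof -
  obtain L where "L > 0" "\<And>s t. \<bar>hard \<rho> s - hard \<rho> t\<bar> \<le> L * \<bar>s - t\<bar>"
    by (rule hard_lipschitz[OF assms]) (rule that)
  then show ?thesis by (intro continuous_on_UNIV_if_lipschitz_bound) auto
qed

lemma continuous_on_D_dev: "continuous_on UNIV D_dev"
proof -
  obtain K where "K > 0" "\<And>a b. \<bar>D_dev a - D_dev b\<bar> \<le> K * norm (a - b)"
    by (rule D_dev_lipschitz) (rule that)
  then show ?thesis by (intro continuous_on_UNIV_if_lipschitz_bound)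
qed

lemma continuous_on_\<phi>: "continuous_on UNIV \<phi>"
proof -
  obtain L where "L > 0" "\<And>s t. \<bar>\<phi> s - \<phi> t\<bar> \<le> L * \<bar>s - t\<bar>" by (rule \<phi>_lipschitz) (rule that)
  then show ?thesis by (intro continuous_on_UNIV_if_lipschitz_bound) auto
qed

end

section \<open>Integrability, coercivity and continuity of the energy\<close>

locale energy = bounded_open \<Omega> + material \<C> c\<^sub>1 c\<^sub>2 c\<^sub>3 \<nu> \<phi> D
  for \<Omega> :: "vec3 set" and \<C> :: "tensor3 \<Rightarrow> tensor3" and c\<^sub>1 c\<^sub>2 c\<^sub>3 \<nu> :: real
    and \<phi> :: "real \<Rightarrow> real" and D :: "tensor3 \<Rightarrow> real" +
  fixes \<Gamma> :: "vec3 set"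
  assumes korn: "korn_inequality \<Omega> \<Gamma>"
begin

text \<open>The objective of one time step as a real number, with \<open>zp\<close> the previous
  internal variable; \<open>objective_eq\<close> shows the agreement on feasible states.\<close>

definition energy :: "real \<Rightarrow> (vec3 \<Rightarrow> tensor3) \<Rightarrow> ((vec3 \<Rightarrow> vec3) \<Rightarrow> real) \<Rightarrow> state \<Rightarrow> real" where
  "energy \<rho> zp l w = (\<integral>x. dens \<rho> (zp x) (jet \<Omega> w x) \<partial>M) - l (fst w)"

text \<open>The constraint imposed by \<open>F\<^sub>0\<close>, which the real-valued \<open>energy 0\<close> leaves out.\<close>

definition feasible :: "real \<Rightarrow> state \<Rightarrow> bool" where
  "feasible \<rho> w \<longleftrightarrow> (\<rho> = 0 \<longrightarrow> (AE x in M. norm (snd w x) \<le> c\<^sub>3))"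

lemma jet_Yspace_L2: "w \<in> Yspace \<Omega> \<Longrightarrow> jet \<Omega> w \<in> L2 \<Omega>"
  by (intro jet_L2 Yspace_H1)

lemma jet_z_jet [simp]: "jet_z (jet \<Omega> w x) = snd w x"
  by (simp add: jet_z_def jet_def jet1_def)

lemma Zspace_L2: "z \<in> Zspace \<Omega> \<Longrightarrow> z \<in> L2 \<Omega>"
  by (simp add: Zspace_def H1_imp_L2)

lemma snd_Yspace_L2: "w \<in> Yspace \<Omega> \<Longrightarrow> snd w \<in> L2 \<Omega>"
  by (intro H1_imp_L2 Yspace_H1)

lemma quad_integrable:
  assumes "p \<in> L2 \<Omega>" shows "integrable M (\<lambda>x. quad (p x))"
proof -
  obtain K where K: "K > 0" "\<And>p p'. \<bar>quad p - quad p'\<bar> \<le> K * (norm p + norm p') * norm (p - p')"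
    "\<And>p. \<bar>quad p\<bar> \<le> K * (norm p)\<^sup>2" by (rule quad_lipschitz) (rule that)
  show ?thesis
  proof (rule Bochner_Integration.integrable_bound)
    show "integrable M (\<lambda>x. K * (norm (p x))\<^sup>2)" using assms by (simp add: L2_def)
    show "(\<lambda>x. quad (p x)) \<in> borel_measurable M"
      using continuous_on_quad by (intro borel_measurable_continuous_on[OF _ L2_measurable[OF assms]])
    show "AE x in M. norm (quad (p x)) \<le> norm (K * (norm (p x))\<^sup>2)"
      using K by (auto simp: abs_mult)
  qed
qed

lemma hard_integrable:
  fixes z :: "vec3 \<Rightarrow> tensor3"
  assumes "0 \<le> \<rho>" "z \<in> L2 \<Omega>" shows "integrable M (\<lambda>x. hard \<rho> (norm (z x)))"
proof -
  obtain L where L: "L > 0" "\<And>s t. \<bar>hard \<rho> s - hard \<rho> t\<bar> \<le> L * \<bar>s - t\<bar>"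
    by (rule hard_lipschitz[OF assms(1)]) (rule that)
  have h0: "hard \<rho> 0 = 0"
    using assms(1) \<phi>_eq_0_iff[of 0] constants by (simp add: hard_def)
  show ?thesis
  proof (rule Bochner_Integration.integrable_bound)
    show "integrable M (\<lambda>x. L * norm (z x))"
      using L2_imp_integrable_norm(1)[OF lmeasurable_domain assms(2)] by simp
    show "(\<lambda>x. hard \<rho> (norm (z x))) \<in> borel_measurable M"
      by (rule borel_measurable_continuous_on[OF continuous_on_hard[OF assms(1)] measurable_compose[OF L2_measurable[OF assms(2)] borel_measurable_norm]])
    show "AE x in M. norm (hard \<rho> (norm (z x))) \<le> norm (L * norm (z x))"
      using L(1) L(2)[of "norm (z x)" 0 for x] by (intro AE_I2) (simp add: h0 abs_mult)
  qed
qed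

lemma \<phi>_integrable:
  fixes z :: "vec3 \<Rightarrow> tensor3"
  assumes "z \<in> L2 \<Omega>" shows "integrable M (\<lambda>x. \<phi> (norm (z x)))"
proof -
  obtain L where L: "L > 0" "\<And>s t. \<bar>\<phi> s - \<phi> t\<bar> \<le> L * \<bar>s - t\<bar>" by (rule \<phi>_lipschitz) (rule that)
  have h0: "\<phi> 0 = 0" using \<phi>_eq_0_iff[of 0] constants by simp
  show ?thesis
  proof (rule Bochner_Integration.integrable_bound)
    show "integrable M (\<lambda>x. L * norm (z x))"
      using L2_imp_integrable_norm(1)[OF lmeasurable_domain assms] by simp
    show "(\<lambda>x. \<phi> (norm (z x))) \<in> borel_measurable M"
      by (rule borel_measurable_continuous_on[OF continuous_on_\<phi> measurable_compose[OF L2_measurable[OF assms] borel_measurable_norm]])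
    show "AE x in M. norm (\<phi> (norm (z x))) \<le> norm (L * norm (z x))"
      using L(1) L(2)[of "norm (z x)" 0 for x] by (intro AE_I2) (simp add: h0 abs_mult)
  qed
qed

lemma D_dev_integrable:
  assumes "z \<in> L2 \<Omega>" shows "integrable M (\<lambda>x. D_dev (z x))"
proof -
  obtain K where K: "K > 0" "\<And>a. D_dev a \<le> K * norm a" by (rule D_dev_bounded) (rule that)
  show ?thesis
  proof (rule Bochner_Integration.integrable_bound)
    show "integrable M (\<lambda>x. K * norm (z x))"
      using L2_imp_integrable_norm(1)[OF lmeasurable_domain assms] by simp
    show "(\<lambda>x. D_dev (z x)) \<in> borel_measurable M"
      by (rule borel_measurable_continuous_on[OF continuous_on_D_dev L2_measurable[OF assms]])
    show "AE x in M. norm (D_dev (z x)) \<le> norm (K * norm (z x))"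
      using K D_dev_nonneg by (auto simp: abs_mult)
  qed
qed

lemma dens_integrable:
  assumes "0 \<le> \<rho>" "zp \<in> L2 \<Omega>" "w \<in> Yspace \<Omega>"
  shows "integrable M (\<lambda>x. dens \<rho> (zp x) (jet \<Omega> w x))"
  unfolding dens_def jet_z_jet
  by (intro Bochner_Integration.integrable_add quad_integrable hard_integrable D_dev_integrable
      jet_Yspace_L2 snd_Yspace_L2 L2_diff assms)

lemma loadD:
  assumes "l \<in> H1_dual \<Omega>"
  shows "u \<in> H1 \<Omega> \<Longrightarrow> v \<in> H1 \<Omega> \<Longrightarrow> l (\<lambda>x. a *\<^sub>R u x + b *\<^sub>R v x) = a * l u + b * l v"
    and "\<exists>K>0. \<forall>u\<in>H1 \<Omega>. \<bar>l u\<bar> \<le> K * H1_norm \<Omega> u"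
proof -
  have add: "\<And>u v. u \<in> H1 \<Omega> \<Longrightarrow> v \<in> H1 \<Omega> \<Longrightarrow> l (\<lambda>x. u x + v x) = l u + l v"
    and scale: "\<And>u s. u \<in> H1 \<Omega> \<Longrightarrow> l (\<lambda>x. s *\<^sub>R u x) = s * l u"
    using assms by (auto simp: H1_dual_def)
  show "l (\<lambda>x. a *\<^sub>R u x + b *\<^sub>R v x) = a * l u + b * l v" if "u \<in> H1 \<Omega>" "v \<in> H1 \<Omega>"
    using add[OF H1_scaleR[OF that(1)] H1_scaleR[OF that(2)], of a b] scale[OF that(1)] scale[OF that(2)] by simp
  obtain K where K: "\<forall>u\<in>H1 \<Omega>. \<bar>l u\<bar> \<le> K * H1_norm \<Omega> u" using assms by (auto simp: H1_dual_def)
  have "\<bar>l u\<bar> \<le> (\<bar>K\<bar> + 1) * H1_norm \<Omega> u" if "u \<in> H1 \<Omega>" for u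
    using K[rule_format, OF that] mult_right_mono[of K "\<bar>K\<bar> + 1" "H1_norm \<Omega> u"] H1_norm_nonneg[of u] abs_ge_self[of K] by linarith
  then show "\<exists>K>0. \<forall>u\<in>H1 \<Omega>. \<bar>l u\<bar> \<le> K * H1_norm \<Omega> u"
    by (intro exI[of _ "\<bar>K\<bar> + 1"]) auto
qed

lemma load_diff:
  assumes "l \<in> H1_dual \<Omega>" "u \<in> H1 \<Omega>" "v \<in> H1 \<Omega>"
  shows "l u - l v = l (\<lambda>x. u x - v x)"
  using loadD(1)[OF assms, of 1 "- 1"] by simp

lemma Yspace_comb:
  assumes "w \<in> Yspace \<Omega>" "y \<in> Yspace \<Omega>"
  shows "state_comb a w b y \<in> Yspace \<Omega>"
  using assms by (auto simp: Yspace_def state_comb_def intro: H1_lincomb(1) Zspace_lincomb)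

text \<open>Korn's inequality controls the displacement by the full strain, whereas
  \<open>quad\<close> contains only the elastic one. Their difference is \<open>z\<close>, which is
  controlled by the term with \<open>c\<^sub>2\<close>.\<close>

lemma quad_diff_coercive:
  obtains \<kappa> where "\<kappa> > 0"
    "\<And>w y. w \<in> Yspace \<Omega> \<Longrightarrow> y \<in> Yspace \<Omega> \<Longrightarrow> has_trace \<Omega> \<Gamma> (\<lambda>x. fst w x - fst y x) (\<lambda>x. 0) \<Longrightarrow>
      \<kappa> * (Y_dist \<Omega> w y)\<^sup>2 \<le> (\<integral>x. quad (jet \<Omega> w x - jet \<Omega> y x) \<partial>M)"
proof -
  obtain c0 where c0: "c0 > 0" "\<And>u g. u \<in> H1 \<Omega> \<Longrightarrow> has_trace \<Omega> \<Gamma> u g \<Longrightarrow>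
        ennreal (c0 * (H1_norm \<Omega> u)\<^sup>2) \<le>
        (\<integral>\<^sup>+x. ennreal ((norm (g x))\<^sup>2) \<partial>surface_on \<Gamma>) + ennreal ((L2_norm \<Omega> (strain \<Omega> u))\<^sup>2)"
    using korn unfolding korn_inequality_def by auto
  obtain \<alpha> where \<alpha>: "\<alpha> > 0"
    "\<And>p. \<alpha> * (norm (elastic_strain p))\<^sup>2 + \<nu>/2 * (norm (jet_dz p))\<^sup>2 + c\<^sub>2 * (norm (jet_z p))\<^sup>2 \<le> quad p"
    by (rule quad_coercive) (rule that)
  \<comment> \<open>One half of \<open>c\<^sub>2\<close> pays for the part of the strain due to
    \<open>z\<close>, the other half for the L^2 norm of \<open>z\<close> itself. The three bounds
    on \<kappa> correspond to the displacement, to \<open>z\<close> and to its gradient.\<close>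
  define m where "m = min \<alpha> (c\<^sub>2/2)"
  define \<kappa> where "\<kappa> = min (m * c0 / 2) (min (c\<^sub>2/2) (\<nu>/2))"
  have m: "m > 0" "m \<le> \<alpha>" "m \<le> c\<^sub>2/2" using \<alpha>(1) constants by (auto simp: m_def)
  have \<kappa>: "\<kappa> > 0" "\<kappa> \<le> m * c0 / 2" "\<kappa> \<le> c\<^sub>2/2" "\<kappa> \<le> \<nu>/2"
    using m(1) c0(1) constants by (auto simp: \<kappa>_def)
  have "\<kappa> * (Y_dist \<Omega> w y)\<^sup>2 \<le> (\<integral>x. quad (jet \<Omega> w x - jet \<Omega> y x) \<partial>M)"
    if w: "w \<in> Yspace \<Omega>" and y: "y \<in> Yspace \<Omega>" and tr: "has_trace \<Omega> \<Gamma> (\<lambda>x. fst w x - fst y x) (\<lambda>x. 0)" for w y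
  proof -
    define v where "v = state_comb 1 w (- 1) y"
    have v: "v \<in> Yspace \<Omega>" unfolding v_def by (rule Yspace_comb[OF w y])
    have fv: "fst v = (\<lambda>x. fst w x - fst y x)" and sv: "snd v = (\<lambda>x. snd w x - snd y x)"
      by (simp_all add: v_def state_comb_def)
    let ?p = "jet \<Omega> v"
    have pL: "?p \<in> L2 \<Omega>" by (rule jet_Yspace_L2[OF v])
    have jd: "AE x in M. ?p x = jet \<Omega> w x - jet \<Omega> y x"
      using jet_state_comb[OF Yspace_H1[OF w] Yspace_H1[OF y], of 1 "- 1"] by (simp add: v_def)
    have L2s: "(\<lambda>x. elastic_strain (?p x)) \<in> L2 \<Omega>" "(\<lambda>x. jet_z (?p x)) \<in> L2 \<Omega>" "(\<lambda>x. jet_dz (?p x)) \<in> L2 \<Omega>"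
      by (intro L2_linear_image[OF _ pL] linear_elastic_strain linear_jet_z linear_jet_dz)+
    define E Zz H where "E = (L2_norm \<Omega> (\<lambda>x. elastic_strain (?p x)))\<^sup>2"
      and "Zz = (L2_norm \<Omega> (\<lambda>x. jet_z (?p x)))\<^sup>2" and "H = (L2_norm \<Omega> (\<lambda>x. jet_dz (?p x)))\<^sup>2"
    note int = L2s[unfolded L2_def, simplified, THEN conjunct2]
    have nn: "0 \<le> E" "0 \<le> Zz" "0 \<le> H" by (simp_all add: E_def Zz_def H_def)
    have "\<alpha> * E + \<nu>/2 * H + c\<^sub>2 * Zz = (\<integral>x. \<alpha> * (norm (elastic_strain (?p x)))\<^sup>2 + \<nu>/2 * (norm (jet_dz (?p x)))\<^sup>2
        + c\<^sub>2 * (norm (jet_z (?p x)))\<^sup>2 \<partial>M)"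
      using int unfolding E_def Zz_def H_def L2_norm_power2 by simp
    also have "\<dots> \<le> (\<integral>x. quad (?p x) \<partial>M)"
    proof (rule integral_mono)
      show "\<alpha> * (norm (elastic_strain (?p x)))\<^sup>2 + \<nu>/2 * (norm (jet_dz (?p x)))\<^sup>2
        + c\<^sub>2 * (norm (jet_z (?p x)))\<^sup>2 \<le> quad (?p x)" for x by (rule \<alpha>(2))
    qed (use int quad_integrable[OF pL] in auto)
    also have "\<dots> = (\<integral>x. quad (jet \<Omega> w x - jet \<Omega> y x) \<partial>M)"
      using jd by (intro integral_cong_AE borel_measurable_integrable quad_integrable pL L2_diff jet_Yspace_L2 w y)
        (auto elim: eventually_mono)
    finally have q: "\<alpha> * E + \<nu>/2 * H + c\<^sub>2 * Zz \<le> (\<integral>x. quad (jet \<Omega> w x - jet \<Omega> y x) \<partial>M)" .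
    have zdev: "AE x in M. snd v x \<in> dev3" using v by (auto simp: Yspace_def Zspace_def)
    have strain_eq: "strain \<Omega> (fst v) x = sym_part (jet_grad (?p x))" for x
      by (simp add: strain_def sym_part_def jet_grad_def jet_def jet1_def)
    have strainL: "strain \<Omega> (fst v) \<in> L2 \<Omega>"
      unfolding strain_eq[abs_def] by (rule L2_linear_image[OF linear_sym_part L2_linear_image[OF linear_jet_grad pL]])
    have "(L2_norm \<Omega> (strain \<Omega> (fst v)))\<^sup>2 \<le> (\<integral>x. 2 * (norm (elastic_strain (?p x)))\<^sup>2 + 2 * (norm (jet_z (?p x)))\<^sup>2 \<partial>M)"
      unfolding L2_norm_power2
    proof (rule integral_mono_AE)
      show "AE x in M. (norm (strain \<Omega> (fst v) x))\<^sup>2 \<le> 2 * (norm (elastic_strain (?p x)))\<^sup>2 + 2 * (norm (jet_z (?p x)))\<^sup>2"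
        using zdev
      proof eventually_elim
        case (elim x)
        then have "sym_part (snd v x) = snd v x" using dev3_subset_sym3 by (intro sym_part_id) auto
        then have "strain \<Omega> (fst v) x = elastic_strain (?p x) + jet_z (?p x)"
          by (simp add: strain_eq elastic_strain_def linear_diff[OF linear_sym_part] sym_part_id[OF sym_part_in_sym3])
        then show ?case using norm_add_power2_le by metis
      qed
    qed (use int strainL in \<open>auto simp: L2_def\<close>)
    also have "\<dots> = 2 * E + 2 * Zz"
      using int unfolding E_def Zz_def L2_norm_power2 by simp
    finally have s: "(L2_norm \<Omega> (strain \<Omega> (fst v)))\<^sup>2 \<le> 2 * E + 2 * Zz" .
    have "ennreal (c0 * (H1_norm \<Omega> (fst v))\<^sup>2) \<le> ennreal ((L2_norm \<Omega> (strain \<Omega> (fst v)))\<^sup>2)"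
      using c0(2)[of "fst v" "\<lambda>x. 0"] Yspace_H1(1)[OF v] tr by (simp add: fv)
    then have k: "c0 * (H1_norm \<Omega> (fst v))\<^sup>2 \<le> (L2_norm \<Omega> (strain \<Omega> (fst v)))\<^sup>2" by simp
    have hz: "(H1_norm \<Omega> (snd v))\<^sup>2 = Zz + H"
      by (simp add: H1_norm_def Zz_def H_def jet_dz_def jet_def jet1_def jet_z_def)
    have d: "(Y_dist \<Omega> w y)\<^sup>2 = (H1_norm \<Omega> (fst v))\<^sup>2 + (H1_norm \<Omega> (snd v))\<^sup>2"
      by (simp add: Y_dist_def fv sv)
    have "\<kappa> * (H1_norm \<Omega> (fst v))\<^sup>2 \<le> m * c0 / 2 * (H1_norm \<Omega> (fst v))\<^sup>2"
      using \<kappa> by (intro mult_right_mono) auto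
    also have "\<dots> = m / 2 * (c0 * (H1_norm \<Omega> (fst v))\<^sup>2)" by simp
    also have "\<dots> \<le> m / 2 * (2 * E + 2 * Zz)" using k s m by (intro mult_left_mono) auto
    also have "\<dots> = m * E + m * Zz" by (simp add: algebra_simps)
    also have "\<dots> \<le> \<alpha> * E + c\<^sub>2/2 * Zz" using m nn by (intro add_mono mult_right_mono) auto
    finally have 1: "\<kappa> * (H1_norm \<Omega> (fst v))\<^sup>2 \<le> \<alpha> * E + c\<^sub>2/2 * Zz" .
    have 2: "\<kappa> * Zz \<le> c\<^sub>2/2 * Zz" "\<kappa> * H \<le> \<nu>/2 * H" by (rule mult_right_mono[OF \<kappa>(3) nn(2)] mult_right_mono[OF \<kappa>(4) nn(3)])+
    show ?thesis using 1 2 q unfolding d hz by (simp add: algebra_simps)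
  qed
  with \<kappa>(1) show ?thesis by (rule that)
qed

text \<open>The load is linear and cancels; integrating \<open>dens_midpoint\<close> gives a quarter
  of the coercivity constant. The order of quantifiers matters: one \<kappa> serves all \<rho>, all
  previous states and all loads.\<close>

lemma energy_strong_midpoint:
  obtains \<kappa> where "\<kappa> > 0"
    "\<And>\<rho> zp l w y. 0 \<le> \<rho> \<Longrightarrow> zp \<in> L2 \<Omega> \<Longrightarrow> l \<in> H1_dual \<Omega> \<Longrightarrow> w \<in> Yspace \<Omega> \<Longrightarrow> y \<in> Yspace \<Omega> \<Longrightarrow>
      has_trace \<Omega> \<Gamma> (\<lambda>x. fst w x - fst y x) (\<lambda>x. 0) \<Longrightarrow>
      energy \<rho> zp l (state_comb (1/2) w (1/2) y) \<le> 1/2 * energy \<rho> zp l w + 1/2 * energy \<rho> zp l y - \<kappa> * (Y_dist \<Omega> w y)\<^sup>2"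
proof -
  obtain \<kappa> where \<kappa>: "\<kappa> > 0"
    "\<And>w y. w \<in> Yspace \<Omega> \<Longrightarrow> y \<in> Yspace \<Omega> \<Longrightarrow> has_trace \<Omega> \<Gamma> (\<lambda>x. fst w x - fst y x) (\<lambda>x. 0) \<Longrightarrow>
      \<kappa> * (Y_dist \<Omega> w y)\<^sup>2 \<le> (\<integral>x. quad (jet \<Omega> w x - jet \<Omega> y x) \<partial>M)"
    by (rule quad_diff_coercive) (rule that)
  have "energy \<rho> zp l (state_comb (1/2) w (1/2) y) \<le> 1/2 * energy \<rho> zp l w + 1/2 * energy \<rho> zp l y - (\<kappa>/4) * (Y_dist \<Omega> w y)\<^sup>2"
    if \<rho>: "0 \<le> \<rho>" and zp: "zp \<in> L2 \<Omega>" and l: "l \<in> H1_dual \<Omega>" and w: "w \<in> Yspace \<Omega>" and y: "y \<in> Yspace \<Omega>"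
      and tr: "has_trace \<Omega> \<Gamma> (\<lambda>x. fst w x - fst y x) (\<lambda>x. 0)" for \<rho> zp l w y
  proof -
    let ?v = "state_comb (1/2) w (1/2) y"
    note iw = dens_integrable[OF \<rho> zp w] and iy = dens_integrable[OF \<rho> zp y]
    have iq: "integrable M (\<lambda>x. quad (jet \<Omega> w x - jet \<Omega> y x))"
      by (intro quad_integrable L2_diff jet_Yspace_L2 w y)
    have "(\<integral>x. dens \<rho> (zp x) (jet \<Omega> ?v x) \<partial>M) \<le> (\<integral>x. 1/2 * dens \<rho> (zp x) (jet \<Omega> w x) + 1/2 * dens \<rho> (zp x) (jet \<Omega> y x)
        - 1/4 * quad (jet \<Omega> w x - jet \<Omega> y x) \<partial>M)"
    proof (rule integral_mono_AE)
      show "AE x in M. dens \<rho> (zp x) (jet \<Omega> ?v x) \<le> 1/2 * dens \<rho> (zp x) (jet \<Omega> w x) + 1/2 * dens \<rho> (zp x) (jet \<Omega> y x)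
        - 1/4 * quad (jet \<Omega> w x - jet \<Omega> y x)"
        using jet_state_comb[OF Yspace_H1[OF w] Yspace_H1[OF y], of "1/2" "1/2"]
        by eventually_elim (simp only: dens_midpoint[OF \<rho>])
    qed (use iw iy iq dens_integrable[OF \<rho> zp Yspace_comb[OF w y]] in auto)
    also have "\<dots> = 1/2 * (\<integral>x. dens \<rho> (zp x) (jet \<Omega> w x) \<partial>M) + 1/2 * (\<integral>x. dens \<rho> (zp x) (jet \<Omega> y x) \<partial>M)
        - 1/4 * (\<integral>x. quad (jet \<Omega> w x - jet \<Omega> y x) \<partial>M)"
      using iw iy iq by simp
    finally have "(\<integral>x. dens \<rho> (zp x) (jet \<Omega> ?v x) \<partial>M) \<le> 1/2 * (\<integral>x. dens \<rho> (zp x) (jet \<Omega> w x) \<partial>M)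
        + 1/2 * (\<integral>x. dens \<rho> (zp x) (jet \<Omega> y x) \<partial>M) - 1/4 * (\<integral>x. quad (jet \<Omega> w x - jet \<Omega> y x) \<partial>M)" .
    moreover have "l (fst ?v) = 1/2 * l (fst w) + 1/2 * l (fst y)"
      using loadD(1)[OF l Yspace_H1(1)[OF w] Yspace_H1(1)[OF y]] by (simp add: state_comb_def)
    ultimately show ?thesis
      using \<kappa>(2)[OF w y tr] unfolding energy_def by (simp add: algebra_simps)
  qed
  with \<kappa>(1) show ?thesis by (intro that[of "\<kappa>/4"]) auto
qed

text \<open>Only the dissipation sees the previous state, so everything else cancels and the bound
  is uniform in \<rho> and in \<open>w\<close>.\<close>

lemma energy_lipschitz_previous:
  obtains K where "K > 0"
    "\<And>\<rho> zp zp' l w. 0 \<le> \<rho> \<Longrightarrow> zp \<in> L2 \<Omega> \<Longrightarrow> zp' \<in> L2 \<Omega> \<Longrightarrow> w \<in> Yspace \<Omega> \<Longrightarrow>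
      \<bar>energy \<rho> zp l w - energy \<rho> zp' l w\<bar> \<le> K * L2_norm \<Omega> (\<lambda>x. zp x - zp' x)"
proof -
  obtain K where K: "K > 0" "\<And>a b. \<bar>D_dev a - D_dev b\<bar> \<le> K * norm (a - b)"
    by (rule D_dev_lipschitz) (rule that)
  let ?B = "K * L2_norm \<Omega> (\<lambda>x. 1::real)"
  have "\<bar>energy \<rho> zp l w - energy \<rho> zp' l w\<bar> \<le> (?B + 1) * L2_norm \<Omega> (\<lambda>x. zp x - zp' x)"
    if \<rho>: "0 \<le> \<rho>" and zp: "zp \<in> L2 \<Omega>" and zp': "zp' \<in> L2 \<Omega>" and w: "w \<in> Yspace \<Omega>" for \<rho> zp zp' l w
  proof -
    have "\<bar>energy \<rho> zp l w - energy \<rho> zp' l w\<bar> = \<bar>\<integral>x. dens \<rho> (zp x) (jet \<Omega> w x) - dens \<rho> (zp' x) (jet \<Omega> w x) \<partial>M\<bar>"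
      using dens_integrable[OF \<rho> zp w] dens_integrable[OF \<rho> zp' w] by (simp add: energy_def)
    also have "\<dots> \<le> (\<integral>x. \<bar>dens \<rho> (zp x) (jet \<Omega> w x) - dens \<rho> (zp' x) (jet \<Omega> w x)\<bar> \<partial>M)"
      by (rule integral_abs_bound)
    also have "\<dots> \<le> (\<integral>x. K * norm (zp x - zp' x) \<partial>M)"
    proof (rule integral_mono)
      fix x
      have "\<bar>dens \<rho> (zp x) (jet \<Omega> w x) - dens \<rho> (zp' x) (jet \<Omega> w x)\<bar> \<le> K * norm ((snd w x - zp x) - (snd w x - zp' x))"
        using K(2)[of "snd w x - zp x" "snd w x - zp' x"] by (simp add: dens_def)
      then show "\<bar>dens \<rho> (zp x) (jet \<Omega> w x) - dens \<rho> (zp' x) (jet \<Omega> w x)\<bar> \<le> K * norm (zp x - zp' x)"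
        by (simp add: norm_minus_commute)
    qed (use dens_integrable[OF \<rho> zp w] dens_integrable[OF \<rho> zp' w]
        L2_imp_integrable_norm(1)[OF lmeasurable_domain L2_diff[OF zp zp']] in auto)
    also have "\<dots> = K * (\<integral>x. norm (zp x - zp' x) \<partial>M)" by simp
    also have "\<dots> \<le> K * (L2_norm \<Omega> (\<lambda>x. 1::real) * L2_norm \<Omega> (\<lambda>x. zp x - zp' x))"
      using K(1) by (intro mult_left_mono L2_imp_integrable_norm(2) lmeasurable_domain L2_diff zp zp') auto
    also have "\<dots> \<le> (?B + 1) * L2_norm \<Omega> (\<lambda>x. zp x - zp' x)" by (simp add: algebra_simps)
    finally show ?thesis .
  qed
  moreover have "?B + 1 > 0" using K(1) by (simp add: add_nonneg_pos)
  ultimately show ?thesis using that[of "?B + 1"] by blast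
qed

lemma energy_antimono:
  assumes "0 < \<rho>'" "\<rho>' \<le> \<rho>" "zp \<in> L2 \<Omega>" "w \<in> Yspace \<Omega>"
  shows "energy \<rho> zp l w \<le> energy \<rho>' zp l w"
proof -
  have "(\<integral>x. dens \<rho> (zp x) (jet \<Omega> w x) \<partial>M) \<le> (\<integral>x. dens \<rho>' (zp x) (jet \<Omega> w x) \<partial>M)"
    using assms by (intro integral_mono dens_integrable) (auto simp: dens_def hard_antimono)
  then show ?thesis by (simp add: energy_def)
qed

lemma energy_le_energy_0:
  assumes "0 \<le> \<rho>" "zp \<in> L2 \<Omega>" "w \<in> Yspace \<Omega>" "feasible 0 w"
  shows "energy \<rho> zp l w \<le> energy 0 zp l w"
proof -
  have "(\<integral>x. dens \<rho> (zp x) (jet \<Omega> w x) \<partial>M) \<le> (\<integral>x. dens 0 (zp x) (jet \<Omega> w x) \<partial>M)"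
  proof (rule integral_mono_AE)
    have "AE x in M. norm (snd w x) \<le> c\<^sub>3" using assms(4) by (simp add: feasible_def)
    then show "AE x in M. dens \<rho> (zp x) (jet \<Omega> w x) \<le> dens 0 (zp x) (jet \<Omega> w x)"
      by eventually_elim (simp add: dens_def hard_le_hard_0[OF assms(1)])
  qed (use dens_integrable assms in auto)
  then show ?thesis by (simp add: energy_def)
qed

text \<open>Integrated form of \<open>hard_0_le\<close>; the error stays finite because the domain
  has finite measure.\<close>

lemma energy_0_le:
  assumes "0 \<le> \<rho>" "zp \<in> L2 \<Omega>" "w \<in> Yspace \<Omega>"
  shows "energy 0 zp l w + (\<integral>x. \<phi> (norm (snd w x)) \<partial>M) / \<rho> \<le> energy \<rho> zp l w + c\<^sub>1 * \<rho> * measure M (space M)"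
proof -
  interpret finite_measure M using finite_measure_lebesgue_on[OF lmeasurable_domain] .
  note i = dens_integrable[OF _ assms(2,3)] \<phi>_integrable[OF snd_Yspace_L2[OF assms(3)]]
  have "(\<integral>x. dens 0 (zp x) (jet \<Omega> w x) + \<phi> (norm (snd w x)) / \<rho> \<partial>M) \<le> (\<integral>x. dens \<rho> (zp x) (jet \<Omega> w x) + c\<^sub>1 * \<rho> \<partial>M)"
  proof (rule integral_mono)
    show "dens 0 (zp x) (jet \<Omega> w x) + \<phi> (norm (snd w x)) / \<rho> \<le> dens \<rho> (zp x) (jet \<Omega> w x) + c\<^sub>1 * \<rho>" for x
      using hard_0_le[of "norm (snd w x)" \<rho>] by (simp add: dens_def)
  qed (use i assms(1) in auto)
  moreover have "(\<integral>x. dens 0 (zp x) (jet \<Omega> w x) + \<phi> (norm (snd w x)) / \<rho> \<partial>M)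
      = (\<integral>x. dens 0 (zp x) (jet \<Omega> w x) \<partial>M) + (\<integral>x. \<phi> (norm (snd w x)) \<partial>M) / \<rho>"
    using i by simp
  moreover have "(\<integral>x. dens \<rho> (zp x) (jet \<Omega> w x) + c\<^sub>1 * \<rho> \<partial>M)
      = (\<integral>x. dens \<rho> (zp x) (jet \<Omega> w x) \<partial>M) + c\<^sub>1 * \<rho> * measure M (space M)"
    using i(1)[OF assms(1)] by simp
  ultimately show ?thesis by (simp add: energy_def)
qed

text \<open>At fixed \<rho> only, since the constant inherits the Lipschitz constant of
  \<open>hard \<rho>\<close>. It is applied at the limit value of \<rho> and along a sequence of
  states with \<rho> frozen.\<close>

lemma energy_continuous:
  assumes \<rho>: "0 \<le> \<rho>" and zp: "zp \<in> L2 \<Omega>" and l: "l \<in> H1_dual \<Omega>" and y: "y \<in> Yspace \<Omega>"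
  obtains K where "K > 0"
    "\<And>w. w \<in> Yspace \<Omega> \<Longrightarrow> \<bar>energy \<rho> zp l w - energy \<rho> zp l y\<bar> \<le> K * (1 + Y_dist \<Omega> w y) * Y_dist \<Omega> w y"
proof -
  obtain K where K: "K > 0" "\<And>a p p'. \<bar>dens \<rho> a p - dens \<rho> a p'\<bar> \<le> K * ((1 + 2 * norm p' + norm (p - p')) * norm (p - p'))"
    by (rule dens_lipschitz[OF \<rho>]) (rule that)
  obtain Kl where Kl: "Kl > 0" "\<And>u. u \<in> H1 \<Omega> \<Longrightarrow> \<bar>l u\<bar> \<le> Kl * H1_norm \<Omega> u"
    using loadD(2)[OF l] by blast
  let ?o = "L2_norm \<Omega> (\<lambda>x. 1::real)"
  \<comment> \<open>The constant from Cauchy-Schwarz applied to \<open>1 + 2 * norm p'\<close> times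
    the difference of the jets.\<close>
  define B where "B = ?o + 2 * L2_norm \<Omega> (jet \<Omega> y)"
  have B: "B \<ge> 0" by (simp add: B_def)
  have "\<bar>energy \<rho> zp l w - energy \<rho> zp l y\<bar> \<le> (K * (B + 1) + Kl) * (1 + Y_dist \<Omega> w y) * Y_dist \<Omega> w y" if w: "w \<in> Yspace \<Omega>" for w
  proof -
    let ?p = "jet \<Omega> w" and ?p' = "jet \<Omega> y"
    define d where "d = Y_dist \<Omega> w y"
    have d0: "0 \<le> d" by (simp add: d_def Y_dist_nonneg)
    have pL: "?p \<in> L2 \<Omega>" "?p' \<in> L2 \<Omega>" by (rule jet_Yspace_L2[OF w] jet_Yspace_L2[OF y])+
    have dL: "(\<lambda>x. ?p x - ?p' x) \<in> L2 \<Omega>" by (rule L2_diff[OF pL])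
    have dn: "d = L2_norm \<Omega> (\<lambda>x. ?p x - ?p' x)" unfolding d_def by (rule Y_dist_eq_jet[OF w y])
    have i: "integrable M (\<lambda>x. norm (?p x - ?p' x))" "integrable M (\<lambda>x. norm (?p' x) * norm (?p x - ?p' x))"
      "integrable M (\<lambda>x. norm (?p x - ?p' x) * norm (?p x - ?p' x))"
      by (rule L2_imp_integrable_norm(1)[OF lmeasurable_domain dL] L2_mult_integrable pL dL)+
    have "\<bar>(\<integral>x. dens \<rho> (zp x) (?p x) \<partial>M) - (\<integral>x. dens \<rho> (zp x) (?p' x) \<partial>M)\<bar>
        = \<bar>\<integral>x. dens \<rho> (zp x) (?p x) - dens \<rho> (zp x) (?p' x) \<partial>M\<bar>"
      using dens_integrable[OF \<rho> zp w] dens_integrable[OF \<rho> zp y] by simp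
    also have "\<dots> \<le> (\<integral>x. \<bar>dens \<rho> (zp x) (?p x) - dens \<rho> (zp x) (?p' x)\<bar> \<partial>M)"
      by (rule integral_abs_bound)
    also have "\<dots> \<le> (\<integral>x. K * (norm (?p x - ?p' x) + 2 * (norm (?p' x) * norm (?p x - ?p' x)) + norm (?p x - ?p' x) * norm (?p x - ?p' x)) \<partial>M)"
    proof (rule integral_mono)
      show "\<bar>dens \<rho> (zp x) (?p x) - dens \<rho> (zp x) (?p' x)\<bar> \<le>
          K * (norm (?p x - ?p' x) + 2 * (norm (?p' x) * norm (?p x - ?p' x)) + norm (?p x - ?p' x) * norm (?p x - ?p' x))" for x
        using K(2)[of "zp x" "?p x" "?p' x"] by (simp only: distrib_right mult_1_left mult.assoc)
    qed (use i dens_integrable[OF \<rho> zp w] dens_integrable[OF \<rho> zp y] in auto)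
    also have "\<dots> = K * ((\<integral>x. norm (?p x - ?p' x) \<partial>M) + 2 * (\<integral>x. norm (?p' x) * norm (?p x - ?p' x) \<partial>M)
        + (\<integral>x. norm (?p x - ?p' x) * norm (?p x - ?p' x) \<partial>M))"
      using i by simp
    also have "\<dots> \<le> K * (?o * d + 2 * (L2_norm \<Omega> ?p' * d) + d * d)"
      using K(1) L2_imp_integrable_norm(2)[OF lmeasurable_domain dL] L2_Cauchy_Schwarz[OF pL(2) dL] L2_Cauchy_Schwarz[OF dL dL]
      unfolding dn by (intro mult_left_mono add_mono) auto
    also have "\<dots> = K * ((B + d) * d)" by (simp add: B_def algebra_simps)
    also have "\<dots> \<le> K * ((B + 1) * (1 + d) * d)"
      using K(1) d0 B by (intro mult_left_mono mult_right_mono) (auto simp: algebra_simps)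
    finally have 1: "\<bar>(\<integral>x. dens \<rho> (zp x) (?p x) \<partial>M) - (\<integral>x. dens \<rho> (zp x) (?p' x) \<partial>M)\<bar> \<le> K * ((B + 1) * (1 + d) * d)" .
    have "\<bar>l (fst w) - l (fst y)\<bar> \<le> Kl * H1_norm \<Omega> (\<lambda>x. fst w x - fst y x)"
      unfolding load_diff[OF l Yspace_H1(1)[OF w] Yspace_H1(1)[OF y]]
      by (intro Kl(2) H1_diff Yspace_H1 w y)
    also have "\<dots> \<le> Kl * d" unfolding d_def using Kl(1) by (intro mult_left_mono H1_norm_le_Y_dist) auto
    also have "\<dots> \<le> Kl * ((1 + d) * d)" using Kl(1) d0 by (intro mult_left_mono) (auto simp: algebra_simps)
    finally have 2: "\<bar>l (fst w) - l (fst y)\<bar> \<le> Kl * ((1 + d) * d)" .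
    have "\<bar>energy \<rho> zp l w - energy \<rho> zp l y\<bar> \<le> K * ((B + 1) * (1 + d) * d) + Kl * ((1 + d) * d)"
      using 1 2 unfolding energy_def by linarith
    also have "\<dots> = (K * (B + 1) + Kl) * (1 + d) * d" by (simp add: algebra_simps)
    finally show ?thesis by (simp add: d_def)
  qed
  moreover have "K * (B + 1) + Kl > 0" using K(1) Kl(1) B by (simp add: add_pos_pos)
  ultimately show ?thesis using that by blast
qed

lemma energy_tendsto:
  assumes \<rho>: "0 \<le> \<rho>" and zp: "zp \<in> L2 \<Omega>" and l: "l \<in> H1_dual \<Omega>" and y: "y \<in> Yspace \<Omega>"
    and W: "\<And>n. W n \<in> Yspace \<Omega>" and lim: "(\<lambda>n. Y_dist \<Omega> (W n) y) \<longlonglongrightarrow> 0"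
  shows "(\<lambda>n. energy \<rho> zp l (W n)) \<longlonglongrightarrow> energy \<rho> zp l y"
proof -
  obtain K where K: "K > 0"
    "\<And>w. w \<in> Yspace \<Omega> \<Longrightarrow> \<bar>energy \<rho> zp l w - energy \<rho> zp l y\<bar> \<le> K * (1 + Y_dist \<Omega> w y) * Y_dist \<Omega> w y"
    by (rule energy_continuous[OF \<rho> zp l y]) (rule that)
  show ?thesis
  proof (rule LIM_zero_cancel, rule Lim_null_comparison)
  show "\<forall>\<^sub>F n in sequentially. norm (energy \<rho> zp l (W n) - energy \<rho> zp l y) \<le> K * (1 + Y_dist \<Omega> (W n) y) * Y_dist \<Omega> (W n) y"
    using K(2)[OF W] by simp
  have "(\<lambda>n. K * (1 + Y_dist \<Omega> (W n) y) * Y_dist \<Omega> (W n) y) \<longlonglongrightarrow> K * (1 + 0) * 0"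
    by (intro tendsto_intros lim)
  then show "(\<lambda>n. K * (1 + Y_dist \<Omega> (W n) y) * Y_dist \<Omega> (W n) y) \<longlonglongrightarrow> 0" by simp
  qed
qed

text \<open>Coercivity in the distance to the reference state \<open>y\<close> is quadratic, the
  load grows only linearly in it. Since \<open>dens\<close> dominates \<open>quad\<close> for every
  \<rho>, the bound is uniform in \<rho> and \<open>zp\<close>.\<close>

lemma energy_bounded_below:
  assumes l: "l \<in> H1_dual \<Omega>" and y: "y \<in> Yspace \<Omega>"
  obtains B where "\<And>\<rho> zp w. 0 \<le> \<rho> \<Longrightarrow> zp \<in> L2 \<Omega> \<Longrightarrow> w \<in> Yspace \<Omega> \<Longrightarrow>
      has_trace \<Omega> \<Gamma> (\<lambda>x. fst w x - fst y x) (\<lambda>x. 0) \<Longrightarrow> B \<le> energy \<rho> zp l w"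
proof -
  obtain \<kappa> where \<kappa>: "\<kappa> > 0"
    "\<And>w y. w \<in> Yspace \<Omega> \<Longrightarrow> y \<in> Yspace \<Omega> \<Longrightarrow> has_trace \<Omega> \<Gamma> (\<lambda>x. fst w x - fst y x) (\<lambda>x. 0) \<Longrightarrow>
      \<kappa> * (Y_dist \<Omega> w y)\<^sup>2 \<le> (\<integral>x. quad (jet \<Omega> w x - jet \<Omega> y x) \<partial>M)"
    by (rule quad_diff_coercive) (rule that)
  obtain K where K: "K > 0" "\<And>u. u \<in> H1 \<Omega> \<Longrightarrow> \<bar>l u\<bar> \<le> K * H1_norm \<Omega> u"
    using loadD(2)[OF l] by blast
  define Q where "Q = (\<integral>x. quad (jet \<Omega> y x) \<partial>M)"
  have "- K\<^sup>2 / (2 * \<kappa>) - Q - l (fst y) \<le> energy \<rho> zp l w"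
    if \<rho>: "0 \<le> \<rho>" and zp: "zp \<in> L2 \<Omega>" and w: "w \<in> Yspace \<Omega>"
      and tr: "has_trace \<Omega> \<Gamma> (\<lambda>x. fst w x - fst y x) (\<lambda>x. 0)" for \<rho> zp w
  proof -
    define d where "d = Y_dist \<Omega> w y"
    have iq: "integrable M (\<lambda>x. quad (jet \<Omega> w x - jet \<Omega> y x))" "integrable M (\<lambda>x. quad (jet \<Omega> y x))"
      by (intro quad_integrable L2_diff jet_Yspace_L2 w y)+
    have "1/2 * (\<kappa> * d\<^sup>2) - Q \<le> 1/2 * (\<integral>x. quad (jet \<Omega> w x - jet \<Omega> y x) \<partial>M) - Q"
      using \<kappa>(2)[OF w y tr] by (simp add: d_def)
    also have "\<dots> = (\<integral>x. 1/2 * quad (jet \<Omega> w x - jet \<Omega> y x) - quad (jet \<Omega> y x) \<partial>M)"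
      using iq by (simp add: Q_def)
    also have "\<dots> \<le> (\<integral>x. dens \<rho> (zp x) (jet \<Omega> w x) \<partial>M)"
      using iq dens_integrable[OF \<rho> zp w] order_trans[OF quad_diff_ge dens_lower[OF \<rho>]]
      by (intro integral_mono) auto
    finally have 1: "1/2 * (\<kappa> * d\<^sup>2) - Q \<le> (\<integral>x. dens \<rho> (zp x) (jet \<Omega> w x) \<partial>M)" .
    have "l (fst w) - l (fst y) \<le> K * H1_norm \<Omega> (\<lambda>x. fst w x - fst y x)"
      unfolding load_diff[OF l Yspace_H1(1)[OF w] Yspace_H1(1)[OF y]]
      using K(2)[OF H1_diff[OF Yspace_H1(1)[OF w] Yspace_H1(1)[OF y]]] by simp
    also have "\<dots> \<le> K * d" unfolding d_def using K(1) by (intro mult_left_mono H1_norm_le_Y_dist) auto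
    finally have 2: "l (fst w) - l (fst y) \<le> K * d" .
    \<comment> \<open>Completing the square absorbs the load term \<open>K * d\<close>.\<close>
    have "0 \<le> (\<kappa> * d - K)\<^sup>2 / (2 * \<kappa>)" using \<kappa>(1) by simp
    also have "\<dots> = 1/2 * (\<kappa> * d\<^sup>2) - K * d + K\<^sup>2 / (2 * \<kappa>)"
      using \<kappa>(1) by (simp add: power2_eq_square field_simps)
    finally show ?thesis using 1 2 unfolding energy_def by simp
  qed
  then show ?thesis by (rule that)
qed

end

section \<open>Minimizers and their stability\<close>

context energy
begin

text \<open>Completeness of Lebesgue measure. The elastic integrand of \<open>stored_energy\<close>
  needs this: \<C> is unspecified off \<open>sym3\<close>, so the integrand is known to equal a
  measurable function only almost everywhere.\<close>

lemma borel_measurable_AE_cong: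
  fixes f g :: "vec3 \<Rightarrow> real"
  assumes f: "f \<in> borel_measurable M" and eq: "AE x in M. f x = g x"
  shows "g \<in> borel_measurable M"
proof -
  have "\<Omega> \<in> sets borel" using open_domain by simp
  then have \<Omega>: "\<Omega> \<in> sets lebesgue" "\<Omega> \<inter> space lebesgue \<in> sets lebesgue" by simp_all
  have "AE x in lebesgue. x \<in> \<Omega> \<longrightarrow> f x = g x"
    using eq by (simp add: AE_restrict_space_iff[OF \<Omega>(2)])
  then have "AE x in lebesgue. (if x \<in> \<Omega> then f x else 0) = (if x \<in> \<Omega> then g x else 0)"
    by eventually_elim simp
  moreover have "(\<lambda>x. if x \<in> \<Omega> then f x else 0) \<in> borel_measurable lebesgue"
    using f by (simp only: borel_measurable_if[OF \<Omega>(1)])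
  ultimately have "(\<lambda>x. if x \<in> \<Omega> then g x else 0) \<in> borel_measurable lebesgue"
    by (rule borel_measurable_AE[rotated])
  then show ?thesis by (simp only: borel_measurable_if[OF \<Omega>(1)])
qed

lemma hardening_eq_hard:
  assumes "\<rho> \<noteq> 0 \<or> norm a \<le> c\<^sub>3"
  shows "hardening c\<^sub>1 c\<^sub>2 c\<^sub>3 \<phi> \<rho> a = ereal (hard \<rho> (norm a) + c\<^sub>2 * (norm a)\<^sup>2)"
  using assms by (auto simp: hardening_def hard_def hard_0)

text \<open>The constraint is violated on a measurable set of positive measure, on which the
  integrand is infinite whatever \<open>G\<close> is.\<close>

lemma nn_integral_infinite_if_infeasible:
  assumes w: "w \<in> Yspace \<Omega>" and inf: "\<not> feasible 0 w"
  shows "(\<integral>\<^sup>+x. e2ennreal (hardening c\<^sub>1 c\<^sub>2 c\<^sub>3 \<phi> 0 (snd w x) + ereal (G x)) \<partial>M) = \<infinity>"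
proof -
  let ?A = "{x \<in> space M. \<not> norm (snd w x) \<le> c\<^sub>3}"
  have [measurable]: "snd w \<in> borel_measurable M" by (rule L2_measurable[OF snd_Yspace_L2[OF w]])
  have A: "?A \<in> sets M" by measurable
  have "emeasure M ?A \<noteq> 0"
  proof
    assume "emeasure M ?A = 0"
    then have "AE x in M. norm (snd w x) \<le> c\<^sub>3"
      by (intro AE_I[OF _ _ A]) auto
    with inf show False by (simp add: feasible_def)
  qed
  then have "(\<integral>\<^sup>+x. \<infinity> * indicator ?A x \<partial>M) = \<infinity>"
    using A by (subst nn_integral_cmult_indicator) (auto simp: ennreal_top_mult)
  moreover have "(\<integral>\<^sup>+x. \<infinity> * indicator ?A x \<partial>M) \<le> (\<integral>\<^sup>+x. e2ennreal (hardening c\<^sub>1 c\<^sub>2 c\<^sub>3 \<phi> 0 (snd w x) + ereal (G x)) \<partial>M)"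
    by (rule nn_integral_mono) (auto simp: indicator_def hardening_def)
  ultimately show ?thesis by (simp add: top_unique)
qed

text \<open>From here on the minimization is that of a real-valued functional over feasible states.
  The strain used in \<open>quad\<close> agrees with that of \<open>stored_energy\<close> because
  \<open>z\<close> is symmetric almost everywhere.\<close>

lemma objective_eq:
  assumes \<rho>: "0 \<le> \<rho>" and w: "w \<in> Yspace \<Omega>" and zp: "zp \<in> Zspace \<Omega>"
  shows "stored_energy \<Omega> \<C> (hardening c\<^sub>1 c\<^sub>2 c\<^sub>3 \<phi> \<rho>) \<nu> w - ereal (l (fst w)) + dissipation \<Omega> D (\<lambda>x. snd w x - zp x)
    = (if feasible \<rho> w then ereal (energy \<rho> zp l w) else \<infinity>)"
proof -
  obtain u z where wuz: "w = (u, z)" by (cases w)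
  let ?p = "jet \<Omega> w"
  note zpL = Zspace_L2[OF zp]
  have zL: "z \<in> L2 \<Omega>" using snd_Yspace_L2[OF w] wuz by simp
  have gL: "wgrad \<Omega> z \<in> L2 \<Omega>" using wgrad_L2[OF Yspace_H1(2)[OF w]] wuz by simp
  have zdev: "AE x in M. z x \<in> dev3" "AE x in M. zp x \<in> dev3"
    using w zp by (auto simp: wuz Yspace_def Zspace_def)
  have iDD: "integrable M (\<lambda>x. D_dev (z x - zp x))" by (rule D_dev_integrable[OF L2_diff[OF zL zpL]])
  have diss_eq: "dissipation \<Omega> D (\<lambda>x. z x - zp x) = ereal (\<integral>x. D_dev (z x - zp x) \<partial>M)"
  proof -
    have "(\<integral>\<^sup>+x. ennreal (D (z x - zp x)) \<partial>M) = (\<integral>\<^sup>+x. ennreal (D_dev (z x - zp x)) \<partial>M)"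
    proof (rule nn_integral_cong_AE)
      show "AE x in M. ennreal (D (z x - zp x)) = ennreal (D_dev (z x - zp x))"
        using zdev by eventually_elim (simp add: D_dev_def dev_part_id subspace_diff[OF subspace_dev3])
    qed
    also have "\<dots> = ennreal (\<integral>x. D_dev (z x - zp x) \<partial>M)"
      by (rule nn_integral_eq_integral[OF iDD]) (simp add: D_dev_nonneg)
    finally show ?thesis
      by (simp add: dissipation_def enn2ereal_ennreal integral_nonneg_AE D_dev_nonneg)
  qed
  define I where "I = 1/2 * (\<integral>x. \<C> (strain \<Omega> u x - z x) \<bullet> (strain \<Omega> u x - z x) \<partial>M)"
  show ?thesis
  proof (cases "feasible \<rho> w")
    case False
    then have "\<rho> = 0" "\<not> feasible 0 w" by (auto simp: feasible_def)
    then show ?thesis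
      using nn_integral_infinite_if_infeasible[OF w, of "\<lambda>x. \<nu>/2 * (norm (wgrad \<Omega> z x))\<^sup>2"] False
      by (simp add: stored_energy_def wuz diss_eq)
  next
    case True
    \<comment> \<open>The part that \<open>stored_energy\<close> integrates in
      \<open>ennreal\<close>. Its last two terms belong to \<open>quad\<close> in the density
      \<open>dens\<close>, so they are subtracted in \<open>I_eq\<close> and return through
      \<open>R_eq\<close>.\<close>
    define R where "R x = hard \<rho> (norm (z x)) + (c\<^sub>2 * (norm (z x))\<^sup>2 + \<nu>/2 * (norm (wgrad \<Omega> z x))\<^sup>2)" for x
    have R0: "0 \<le> R x" for x
      using hard_nonneg[OF \<rho>] constants by (simp add: R_def)
    have isq: "integrable M (\<lambda>x. (norm (z x))\<^sup>2)" "integrable M (\<lambda>x. (norm (wgrad \<Omega> z x))\<^sup>2)"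
      using zL gL by (simp_all add: L2_def)
    have ih: "integrable M (\<lambda>x. hard \<rho> (norm (z x)))" by (rule hard_integrable[OF \<rho> zL])
    have iR: "integrable M R" unfolding R_def[abs_def] using isq ih by simp
    have feas: "AE x in M. \<rho> \<noteq> 0 \<or> norm (z x) \<le> c\<^sub>3"
      using True by (cases "\<rho> = 0") (auto simp: feasible_def wuz)
    have "(\<integral>\<^sup>+x. e2ennreal (hardening c\<^sub>1 c\<^sub>2 c\<^sub>3 \<phi> \<rho> (z x) + ereal (\<nu>/2 * (norm (wgrad \<Omega> z x))\<^sup>2)) \<partial>M) = (\<integral>\<^sup>+x. ennreal (R x) \<partial>M)"
    proof (rule nn_integral_cong_AE)
      show "AE x in M. e2ennreal (hardening c\<^sub>1 c\<^sub>2 c\<^sub>3 \<phi> \<rho> (z x) + ereal (\<nu>/2 * (norm (wgrad \<Omega> z x))\<^sup>2)) = ennreal (R x)"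
        using feas by eventually_elim (simp add: hardening_eq_hard R_def e2ennreal_ereal add.assoc)
    qed
    also have "\<dots> = ennreal (\<integral>x. R x \<partial>M)"
      by (rule nn_integral_eq_integral[OF iR]) (simp add: R0)
    finally have nn: "enn2ereal (\<integral>\<^sup>+x. e2ennreal (hardening c\<^sub>1 c\<^sub>2 c\<^sub>3 \<phi> \<rho> (z x) + ereal (\<nu>/2 * (norm (wgrad \<Omega> z x))\<^sup>2)) \<partial>M)
        = ereal (\<integral>x. R x \<partial>M)"
      by (simp add: enn2ereal_ennreal integral_nonneg_AE R0)
    have iq: "integrable M (\<lambda>x. quad (?p x))" by (rule quad_integrable[OF jet_Yspace_L2[OF w]])
    have "AE x in M. \<C> (strain \<Omega> u x - z x) \<bullet> (strain \<Omega> u x - z x)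
        = 2 * (quad (?p x) - (c\<^sub>2 * (norm (z x))\<^sup>2 + \<nu>/2 * (norm (wgrad \<Omega> z x))\<^sup>2))"
      using zdev(1)
    proof eventually_elim
      case (elim x)
      have "sym_part (z x) = z x" using elim dev3_subset_sym3 by (intro sym_part_id) auto
      moreover have "strain \<Omega> u x = sym_part (jet_grad (?p x))"
        by (simp add: strain_def sym_part_def jet_grad_def jet_def jet1_def wuz)
      ultimately have "strain \<Omega> u x - z x = elastic_strain (?p x)"
        by (simp add: elastic_strain_def linear_diff[OF linear_sym_part] sym_part_id[OF sym_part_in_sym3] wuz)
      moreover have "jet_dz (?p x) = wgrad \<Omega> z x" by (simp add: jet_dz_def jet_def jet1_def wuz)
      ultimately show ?case by (simp add: quad_def wuz)
    qed
    note ae = this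
    have iqr: "integrable M (\<lambda>x. 2 * (quad (?p x) - (c\<^sub>2 * (norm (z x))\<^sup>2 + \<nu>/2 * (norm (wgrad \<Omega> z x))\<^sup>2)))"
      using iq isq by simp
    have "(\<integral>x. \<C> (strain \<Omega> u x - z x) \<bullet> (strain \<Omega> u x - z x) \<partial>M)
        = (\<integral>x. 2 * (quad (?p x) - (c\<^sub>2 * (norm (z x))\<^sup>2 + \<nu>/2 * (norm (wgrad \<Omega> z x))\<^sup>2)) \<partial>M)"
    proof (rule integral_cong_AE[OF _ borel_measurable_integrable[OF iqr] ae])
      show "(\<lambda>x. \<C> (strain \<Omega> u x - z x) \<bullet> (strain \<Omega> u x - z x)) \<in> borel_measurable M"
        by (rule borel_measurable_AE_cong[OF borel_measurable_integrable[OF iqr]])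
          (use ae in \<open>auto elim: eventually_mono\<close>)
    qed
    then have I_eq: "I = (\<integral>x. quad (?p x) \<partial>M) - (\<integral>x. c\<^sub>2 * (norm (z x))\<^sup>2 + \<nu>/2 * (norm (wgrad \<Omega> z x))\<^sup>2 \<partial>M)"
      using iq isq by (simp add: I_def)
    have R_eq: "(\<integral>x. R x \<partial>M) = (\<integral>x. hard \<rho> (norm (z x)) \<partial>M) + (\<integral>x. c\<^sub>2 * (norm (z x))\<^sup>2 + \<nu>/2 * (norm (wgrad \<Omega> z x))\<^sup>2 \<partial>M)"
      unfolding R_def using ih isq by (intro Bochner_Integration.integral_add) auto
    have E_eq: "energy \<rho> zp l w = (\<integral>x. quad (?p x) \<partial>M) + (\<integral>x. hard \<rho> (norm (z x)) \<partial>M) + (\<integral>x. D_dev (z x - zp x) \<partial>M) - l u"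
      using iq ih iDD by (simp add: energy_def dens_def wuz)
    have "stored_energy \<Omega> \<C> (hardening c\<^sub>1 c\<^sub>2 c\<^sub>3 \<phi> \<rho>) \<nu> w = ereal I + ereal (\<integral>x. R x \<partial>M)"
      unfolding stored_energy_def wuz I_def by (simp only: prod.case nn)
    then show ?thesis
      using True by (simp add: wuz diss_eq R_eq E_eq[unfolded wuz] I_eq[unfolded wuz])
  qed
qed

lemma arg_min_energy:
  assumes \<rho>: "0 \<le> \<rho>" and zp: "zp \<in> Zspace \<Omega>" and S: "admissible_variations \<Omega> \<Gamma> S" and v: "v \<in> H1 \<Omega>"
    and min: "is_arg_min (\<lambda>(u, z). stored_energy \<Omega> \<C> (hardening c\<^sub>1 c\<^sub>2 c\<^sub>3 \<phi> \<rho>) \<nu> (u, z) - ereal (l u)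
        + dissipation \<Omega> D (\<lambda>x. z x - zp x)) (\<lambda>w. w \<in> shifted v S) y"
  shows "y \<in> shifted v S" "feasible \<rho> y"
    "\<And>w. w \<in> shifted v S \<Longrightarrow> feasible \<rho> w \<Longrightarrow> energy \<rho> zp l y \<le> energy \<rho> zp l w"
proof -
  define J where "J w = (if feasible \<rho> w then ereal (energy \<rho> zp l w) else \<infinity>)" for w
  define F where "F = (\<lambda>(u, z). stored_energy \<Omega> \<C> (hardening c\<^sub>1 c\<^sub>2 c\<^sub>3 \<phi> \<rho>) \<nu> (u, z) - ereal (l u)
        + dissipation \<Omega> D (\<lambda>x. z x - zp x))"
  note min = min[folded F_def]
  have J: "F w = J w" if "w \<in> shifted v S" for w
    using objective_eq[OF \<rho> shifted_Yspace[OF S v that] zp, of l] by (cases w) (simp add: J_def F_def)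
  show y: "y \<in> shifted v S" using min by (simp add: is_arg_min_def)
  have le: "J y \<le> J w" if "w \<in> shifted v S" for w
  proof -
    have "\<not> F w < F y" using min that unfolding is_arg_min_def by blast
    then show ?thesis unfolding J[OF that] J[OF y] by simp
  qed
  \<comment> \<open>The competitor with \<open>z = 0\<close> is feasible since
    \<open>c\<^sub>3\<close> is positive; its finite value forces the minimizer to be feasible
    too.\<close>
  have s0: "(v, \<lambda>x. 0) \<in> shifted v S" using S by (simp add: shifted_def admissible_variations_def)
  have "feasible \<rho> (v, \<lambda>x. 0)" using constants by (simp add: feasible_def)
  then show fy: "feasible \<rho> y" using le[OF s0] by (auto simp: J_def split: if_splits)
  show "energy \<rho> zp l y \<le> energy \<rho> zp l w" if "w \<in> shifted v S" "feasible \<rho> w" for w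
    using le[OF that(1)] that(2) fy by (simp add: J_def)
qed

text \<open>The threshold \<delta> does not depend on \<open>w\<close>, so the bound can be used for
  minimizers over varying discrete subspaces.\<close>

lemma energy_lower_bound_vanishing_rho:
  assumes S: "admissible_variations \<Omega> \<Gamma> S" and v: "v \<in> H1 \<Omega>" and l: "l \<in> H1_dual \<Omega>" and zp: "zp \<in> L2 \<Omega>"
    and y: "y \<in> shifted v S" "feasible 0 y"
    and min: "\<And>w. w \<in> shifted v S \<Longrightarrow> feasible 0 w \<Longrightarrow> energy 0 zp l y \<le> energy 0 zp l w"
    and e: "e > 0"
  obtains \<delta> where "\<delta> > 0"
    "\<And>\<rho> w. 0 < \<rho> \<Longrightarrow> \<rho> \<le> \<delta> \<Longrightarrow> w \<in> shifted v S \<Longrightarrow> energy 0 zp l y - e \<le> energy \<rho> zp l w"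
proof -
  let ?A = "shifted v S"
  note AY = shifted_Yspace[OF S v]
  note Atr = shifted_diff_zero_trace[OF S]
  define r where "r n = inverse (real (Suc n))" for n
  have r: "0 < r n" for n by (simp add: r_def)
  have r_lim: "r \<longlonglongrightarrow> 0" unfolding r_def by (rule LIMSEQ_inverse_real_of_nat)
  have r_anti: "r k \<le> r n" if "n \<le> k" for n k unfolding r_def using that by (simp add: le_imp_inverse_le)
  obtain B where B: "\<And>\<rho> zp w. 0 \<le> \<rho> \<Longrightarrow> zp \<in> L2 \<Omega> \<Longrightarrow> w \<in> Yspace \<Omega> \<Longrightarrow>
      has_trace \<Omega> \<Gamma> (\<lambda>x. fst w x - fst y x) (\<lambda>x. 0) \<Longrightarrow> B \<le> energy \<rho> zp l w"
    by (rule energy_bounded_below[OF l AY[OF y(1)]]) (rule that)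
  obtain \<kappa> where \<kappa>: "\<kappa> > 0"
    "\<And>\<rho> zp l w y. 0 \<le> \<rho> \<Longrightarrow> zp \<in> L2 \<Omega> \<Longrightarrow> l \<in> H1_dual \<Omega> \<Longrightarrow> w \<in> Yspace \<Omega> \<Longrightarrow> y \<in> Yspace \<Omega> \<Longrightarrow>
      has_trace \<Omega> \<Gamma> (\<lambda>x. fst w x - fst y x) (\<lambda>x. 0) \<Longrightarrow>
      energy \<rho> zp l (state_comb (1/2) w (1/2) y) \<le> 1/2 * energy \<rho> zp l w + 1/2 * energy \<rho> zp l y - \<kappa> * (Y_dist \<Omega> w y)\<^sup>2"
    by (rule energy_strong_midpoint) (rule that)
  \<comment> \<open>The infima increase with \<open>n\<close> because the energies do, and they are
    bounded by the energy of the feasible state \<open>y\<close>; their limit \<open>L\<close> is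
    the quantity to compare with \<open>energy 0 zp l y\<close>.\<close>
  define m where "m n = Inf (energy (r n) zp l ` ?A)" for n
  have bdd: "bdd_below (energy (r n) zp l ` ?A)" for n
    using B[OF less_imp_le[OF r] zp AY Atr[OF _ y(1)]] by (intro bdd_belowI2) auto
  have m_le: "m n \<le> energy (r n) zp l w" if "w \<in> ?A" for n w
    unfolding m_def using that bdd by (intro cInf_lower) auto
  have r_mono: "energy (r n) zp l w \<le> energy (r k) zp l w" if "n \<le> k" "w \<in> ?A" for n k w
    using r r_anti[OF that(1)] zp AY[OF that(2)] by (rule energy_antimono)
  have "incseq m"
  proof (rule incseq_SucI)
    fix n
    show "m n \<le> m (Suc n)"
      unfolding m_def[of "Suc n"]
    proof (rule cInf_greatest)
      show "energy (r (Suc n)) zp l ` ?A \<noteq> {}" using y(1) by blast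
      fix a assume "a \<in> energy (r (Suc n)) zp l ` ?A"
      then obtain w where w: "w \<in> ?A" "a = energy (r (Suc n)) zp l w" by blast
      show "m n \<le> a" using order_trans[OF m_le[OF w(1)] r_mono[OF _ w(1), of n "Suc n"]] w(2) by simp
    qed
  qed
  moreover have "m n \<le> energy 0 zp l y" for n
    using m_le[OF y(1)] energy_le_energy_0[OF less_imp_le[OF r] zp AY[OF y(1)] y(2)] by (rule order_trans)
  ultimately obtain L where L: "m \<longlonglongrightarrow> L" "\<And>n. m n \<le> L"
    using incseq_convergent by blast
  have "\<exists>w\<in>?A. energy (r n) zp l w < m n + r n" for n
  proof -
    have "Inf (energy (r n) zp l ` ?A) < m n + r n" using r by (simp add: m_def)
    from cInf_lessD[OF _ this] show ?thesis using y(1) by blast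
  qed
  then have "\<exists>W. \<forall>n. W n \<in> ?A \<and> energy (r n) zp l (W n) < m n + r n"
    by (intro choice) blast
  then obtain W where W: "\<And>n. W n \<in> ?A" "\<And>n. energy (r n) zp l (W n) < m n + r n" by blast
  have W_le: "energy (r n) zp l (W k) \<le> L + r k" if "n \<le> k" for n k
    using r_mono[OF that W(1)] W(2)[of k] L(2)[of k] by (meson add_right_mono less_imp_le order_trans)
  \<comment> \<open>Both states are compared at the level \<open>r n\<close>, the larger of the two
    parameters, where each has energy at most \<open>L + r n\<close> while the midpoint has at least
    \<open>m n\<close>.\<close>
  have dist: "\<kappa> * (Y_dist \<Omega> (W n) (W k))\<^sup>2 \<le> (L - m n) + r n" if "n \<le> k" for n k
  proof -
    have "m n \<le> energy (r n) zp l (state_comb (1/2) (W n) (1/2) (W k))"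
      by (rule m_le[OF shifted_midpoint[OF S W(1) W(1)]])
    then have "\<kappa> * (Y_dist \<Omega> (W n) (W k))\<^sup>2 \<le> 1/2 * energy (r n) zp l (W n) + 1/2 * energy (r n) zp l (W k) - m n"
      using \<kappa>(2)[OF less_imp_le[OF r[of n]] zp l AY[OF W(1)[of n]] AY[OF W(1)[of k]] Atr[OF W(1)[of n] W(1)[of k]]] by linarith
    then show ?thesis using W(2)[of n] W_le[OF that] r_anti[OF that] L(2)[of n] by linarith
  qed
  have b_lim: "(\<lambda>n. (L - m n) + r n) \<longlonglongrightarrow> 0"
    using tendsto_add[OF tendsto_diff[OF tendsto_const L(1)] r_lim, of L] by simp
  have cauchy: "\<exists>N. \<forall>n\<ge>N. \<forall>k\<ge>N. Y_dist \<Omega> (W n) (W k) < \<epsilon>" if \<epsilon>: "\<epsilon> > 0" for \<epsilon>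
  proof -
    have "0 < \<kappa> * \<epsilon>\<^sup>2" using \<kappa>(1) \<epsilon> by simp
    from order_tendstoD(2)[OF b_lim this] obtain N where N: "\<And>n. n \<ge> N \<Longrightarrow> (L - m n) + r n < \<kappa> * \<epsilon>\<^sup>2"
      by (auto simp: eventually_sequentially)
    have *: "Y_dist \<Omega> (W n) (W k) < \<epsilon>" if "n \<ge> N" "n \<le> k" for n k
    proof -
      have "\<kappa> * (Y_dist \<Omega> (W n) (W k))\<^sup>2 < \<kappa> * \<epsilon>\<^sup>2" using dist[OF that(2)] N[OF that(1)] by linarith
      then have "(Y_dist \<Omega> (W n) (W k))\<^sup>2 < \<epsilon>\<^sup>2" using \<kappa>(1) by simp
      then show ?thesis using \<epsilon> by (intro power2_less_imp_less[of _ \<epsilon>]) auto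
    qed
    have "Y_dist \<Omega> (W n) (W k) < \<epsilon>" if "n \<ge> N" "k \<ge> N" for n k
    proof (cases "n \<le> k")
      case True
      then show ?thesis using * that by blast
    next
      case False
      then show ?thesis using *[of k n] that Y_dist_commute[OF AY[OF W(1)[of n]] AY[OF W(1)[of k]]] by simp
    qed
    then show ?thesis by blast
  qed
  obtain w where w: "w \<in> ?A" "(\<lambda>n. Y_dist \<Omega> (W n) w) \<longlonglongrightarrow> 0"
    by (rule shifted_complete[OF S v W(1) cauchy])
  note wY = AY[OF w(1)]
  \<comment> \<open>The level \<open>n\<close> stays fixed while the states \<open>W k\<close>
    converge, so that continuity at a fixed positive parameter is enough.\<close>
  have wL: "energy (r n) zp l w \<le> L" for n
  proof (rule LIMSEQ_le[OF energy_tendsto[OF less_imp_le[OF r[of n]] zp l wY AY[OF W(1)] w(2)]])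
    show "(\<lambda>k. L + r k) \<longlonglongrightarrow> L" using tendsto_add[OF tendsto_const r_lim, of L] by simp
    show "\<exists>N. \<forall>k\<ge>N. energy (r n) zp l (W k) \<le> L + r k" using W_le by blast
  qed
  define I where "I = (\<integral>x. \<phi> (norm (snd w x)) \<partial>M)"
  have I0: "0 \<le> I" unfolding I_def by (intro integral_nonneg_AE AE_I2 \<phi>_nonneg)
  have key: "energy 0 zp l w + I / r n \<le> L + c\<^sub>1 * r n * measure M (space M)" for n
    using order_trans[OF energy_0_le[OF less_imp_le[OF r] zp wY] add_right_mono[OF wL]] unfolding I_def .
  have lim0: "(\<lambda>n. L + c\<^sub>1 * r n * measure M (space M)) \<longlonglongrightarrow> L + c\<^sub>1 * 0 * measure M (space M)"
    by (intro tendsto_intros r_lim)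
  have E0L: "energy 0 zp l w \<le> L"
  proof (rule LIMSEQ_le_const)
    show "(\<lambda>n. L + c\<^sub>1 * r n * measure M (space M)) \<longlonglongrightarrow> L" using lim0 by simp
    have "energy 0 zp l w \<le> L + c\<^sub>1 * r n * measure M (space M)" for n
      using key[of n] I0 r[of n] divide_nonneg_pos[OF I0 r[of n]] by linarith
    then show "\<exists>N. \<forall>n\<ge>N. energy 0 zp l w \<le> L + c\<^sub>1 * r n * measure M (space M)" by blast
  qed
  \<comment> \<open>Multiplying \<open>key\<close> by \<open>r n\<close> leaves a bound on the
    penalty integral that tends to 0.\<close>
  have "I \<le> 0"
  proof (rule LIMSEQ_le_const)
    show "(\<lambda>n. r n * (L + c\<^sub>1 * r n * measure M (space M) - energy 0 zp l w)) \<longlonglongrightarrow> 0"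
      using tendsto_mult[OF r_lim tendsto_diff[OF lim0 tendsto_const[of "energy 0 zp l w"]]] by simp
    have "I \<le> r n * (L + c\<^sub>1 * r n * measure M (space M) - energy 0 zp l w)" for n
    proof -
      have "I / r n \<le> L + c\<^sub>1 * r n * measure M (space M) - energy 0 zp l w" using key[of n] by linarith
      then show ?thesis using r[of n] by (simp add: pos_divide_le_eq mult.commute)
    qed
    then show "\<exists>N. \<forall>n\<ge>N. I \<le> r n * (L + c\<^sub>1 * r n * measure M (space M) - energy 0 zp l w)" by blast
  qed
  then have "(\<integral>x. \<phi> (norm (snd w x)) \<partial>M) = 0" using I0 I_def by simp
  then have "AE x in M. \<phi> (norm (snd w x)) = 0"
    using integral_nonneg_eq_0_iff_AE[OF \<phi>_integrable[OF snd_Yspace_L2[OF wY]]] \<phi>_nonneg by simp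
  then have "feasible 0 w" unfolding feasible_def by (auto simp: \<phi>_eq_0_iff)
  \<comment> \<open>Minimality of \<open>y\<close> gives \<open>energy 0 zp l y \<le> L\<close>, so
    some \<open>m n\<close> exceeds it up to \<open>e\<close>. Monotonicity carries this bound from
    \<open>r n\<close> to all smaller positive parameters.\<close>
  from order_trans[OF min[OF w(1) this] E0L] have "energy 0 zp l y - e < L" using e by simp
  from order_tendstoD(1)[OF L(1) this] obtain n where n: "energy 0 zp l y - e < m n"
    by (auto simp: eventually_sequentially)
  show ?thesis
  proof (rule that[OF r[of n]])
    fix \<rho> w assume a: "0 < \<rho>" "\<rho> \<le> r n" "w \<in> ?A"
    show "energy 0 zp l y - e \<le> energy \<rho> zp l w"
      using n m_le[OF a(3), of n] energy_antimono[OF a(1,2) zp AY[OF a(3)], of l] by linarith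
  qed
qed

lemma feasible_vanishing: "feasible 0 w \<Longrightarrow> feasible \<rho> w"
  by (simp add: feasible_def)

text \<open>The minimizer is compared with a recovery state in its own space: by the midpoint
  inequality, \<kappa> times the squared distance is at most half the difference of their energies
  at \<open>\<rho>k k\<close> with the previous state \<open>zpk k\<close>.\<close>

lemma time_step_convergence:
  assumes S: "admissible_variations \<Omega> \<Gamma> S" and Sk: "\<And>k. admissible_variations \<Omega> \<Gamma> (Sk k)" "\<And>k. Sk k \<subseteq> S"
    and v: "v \<in> H1 \<Omega>" and l: "l \<in> H1_dual \<Omega>" and zp: "zp \<in> L2 \<Omega>" and zpk: "\<And>k. zpk k \<in> L2 \<Omega>"
    and zlim: "(\<lambda>k. L2_norm \<Omega> (\<lambda>x. zpk k x - zp x)) \<longlonglongrightarrow> 0"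
    and \<rho>k: "\<And>k. 0 \<le> \<rho>k k" and \<rho>: "(\<forall>k. \<rho>k k = \<rho>) \<or> \<rho> = 0 \<and> \<rho>k \<longlonglongrightarrow> 0"
    and y: "y \<in> shifted v S" "feasible \<rho> y"
      "\<And>w. w \<in> shifted v S \<Longrightarrow> feasible \<rho> w \<Longrightarrow> energy \<rho> zp l y \<le> energy \<rho> zp l w"
    and yk: "\<And>k. yk k \<in> shifted v (Sk k)" "\<And>k. feasible (\<rho>k k) (yk k)"
      "\<And>k w. w \<in> shifted v (Sk k) \<Longrightarrow> feasible (\<rho>k k) w \<Longrightarrow> energy (\<rho>k k) (zpk k) l (yk k) \<le> energy (\<rho>k k) (zpk k) l w"
    and recovery: "\<And>e. e > 0 \<Longrightarrow> \<forall>\<^sub>F k in sequentially. \<exists>w\<in>shifted v (Sk k). feasible \<rho> w \<and> Y_dist \<Omega> w y < e"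
  shows "(\<lambda>k. Y_dist \<Omega> (yk k) y) \<longlonglongrightarrow> 0"
proof (rule order_tendstoI)
  fix e :: real assume "e < 0"
  then show "\<forall>\<^sub>F k in sequentially. e < Y_dist \<Omega> (yk k) y"
    using Y_dist_nonneg by (intro always_eventually allI) (rule order.strict_trans2)
next
  fix e :: real assume e: "0 < e"
  have sub: "shifted v (Sk k) \<subseteq> shifted v S" for k using Sk(2)[of k] by (auto simp: shifted_def)
  have \<rho>0: "0 \<le> \<rho>" using \<rho> \<rho>k by (metis order_refl)
  note yY = shifted_Yspace[OF S v y(1)]
  obtain \<kappa> where \<kappa>: "\<kappa> > 0"
    "\<And>\<rho> zp l w y. 0 \<le> \<rho> \<Longrightarrow> zp \<in> L2 \<Omega> \<Longrightarrow> l \<in> H1_dual \<Omega> \<Longrightarrow> w \<in> Yspace \<Omega> \<Longrightarrow> y \<in> Yspace \<Omega> \<Longrightarrow>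
      has_trace \<Omega> \<Gamma> (\<lambda>x. fst w x - fst y x) (\<lambda>x. 0) \<Longrightarrow>
      energy \<rho> zp l (state_comb (1/2) w (1/2) y) \<le> 1/2 * energy \<rho> zp l w + 1/2 * energy \<rho> zp l y - \<kappa> * (Y_dist \<Omega> w y)\<^sup>2"
    by (rule energy_strong_midpoint) (rule that)
  obtain K where K: "K > 0"
    "\<And>\<rho> zp zp' l w. 0 \<le> \<rho> \<Longrightarrow> zp \<in> L2 \<Omega> \<Longrightarrow> zp' \<in> L2 \<Omega> \<Longrightarrow> w \<in> Yspace \<Omega> \<Longrightarrow>
      \<bar>energy \<rho> zp l w - energy \<rho> zp' l w\<bar> \<le> K * L2_norm \<Omega> (\<lambda>x. zp x - zp' x)"
    by (rule energy_lipschitz_previous) (rule that)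
  obtain Kc where Kc: "Kc > 0"
    "\<And>w. w \<in> Yspace \<Omega> \<Longrightarrow> \<bar>energy \<rho> zp l w - energy \<rho> zp l y\<bar> \<le> Kc * (1 + Y_dist \<Omega> w y) * Y_dist \<Omega> w y"
    by (rule energy_continuous[OF \<rho>0 zp l yY]) (rule that)
  \<comment> \<open>The energy gap collects four errors of size \<eta>: the change of the previous
    state for \<open>w\<close> and for \<open>yk k\<close>, the lower bound, and the continuity at
    \<open>y\<close>. Half of this gap is \<open>2 * \<eta>\<close>, which stays below
    \<open>\<kappa> * (e/2)\<^sup>2\<close>.\<close>
  define \<eta> where "\<eta> = \<kappa> * (e/2)\<^sup>2 / 4"
  have \<eta>: "\<eta> > 0" using \<kappa>(1) e by (simp add: \<eta>_def)
  \<comment> \<open>The first bound serves the final triangle inequality; the other two reduce the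
    continuity estimate at \<open>y\<close> to
    \<open>2 * Kc * \<delta> \<le> \<eta>\<close>.\<close>
  define \<delta> where "\<delta> = min (e/2) (min 1 (\<eta> / (2 * Kc)))"
  have \<delta>: "\<delta> > 0" "\<delta> \<le> e/2" "\<delta> \<le> 1" "\<delta> \<le> \<eta> / (2 * Kc)" using e \<eta> Kc(1) by (auto simp: \<delta>_def)
  have ev1: "\<forall>\<^sub>F k in sequentially. K * L2_norm \<Omega> (\<lambda>x. zpk k x - zp x) < \<eta>"
    using order_tendstoD(2)[OF tendsto_mult_right_zero[OF zlim, of K] \<eta>] .
  have ev2: "\<forall>\<^sub>F k in sequentially. energy \<rho> zp l y - \<eta> \<le> energy (\<rho>k k) zp l (yk k)"
  proof (cases "\<forall>k. \<rho>k k = \<rho>")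
    case True
    have "energy \<rho> zp l y - \<eta> \<le> energy (\<rho>k k) zp l (yk k)" for k
      using y(3)[of "yk k"] yk(1,2)[of k] sub[of k] True \<eta> by fastforce
    then show ?thesis by simp
  next
    case False
    then have z: "\<rho> = 0" "\<rho>k \<longlonglongrightarrow> 0" using \<rho> by auto
    obtain d where d: "d > 0" "\<And>\<rho>' w. 0 < \<rho>' \<Longrightarrow> \<rho>' \<le> d \<Longrightarrow> w \<in> shifted v S \<Longrightarrow> energy 0 zp l y - \<eta> \<le> energy \<rho>' zp l w"
      by (rule energy_lower_bound_vanishing_rho[OF S v l zp y[unfolded z(1)] \<eta>]) (assumption | rule that)+
    from order_tendstoD(2)[OF z(2) d(1)] show ?thesis
    proof eventually_elim
      case (elim k)
      show ?case
      \<comment> \<open>A vanishing sequence may contain zeros, where the lower bound for positive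
        parameters does not apply; the minimality of \<open>y\<close> takes its place.\<close>
      proof (cases "\<rho>k k = 0")
        case True
        then show ?thesis using y(3)[of "yk k"] yk(1,2)[of k] sub[of k] z(1) \<eta> by fastforce
      next
        case False
        then show ?thesis using d(2)[of "\<rho>k k" "yk k"] elim \<rho>k[of k] yk(1)[of k] sub[of k] z(1) by auto
      qed
    qed
  qed
  show "\<forall>\<^sub>F k in sequentially. Y_dist \<Omega> (yk k) y < e"
    using ev1 ev2 recovery[OF \<delta>(1)]
  proof eventually_elim
    case (elim k)
    then obtain w where w: "w \<in> shifted v (Sk k)" "feasible \<rho> w" "Y_dist \<Omega> w y < \<delta>" by blast
    note ykY = shifted_Yspace[OF Sk(1) v yk(1)[of k]] and wY = shifted_Yspace[OF Sk(1) v w(1)]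
    have fw: "feasible (\<rho>k k) w" using w(2) \<rho> feasible_vanishing by metis
    have "energy (\<rho>k k) (zpk k) l (yk k) \<le> energy (\<rho>k k) (zpk k) l (state_comb (1/2) (yk k) (1/2) w)"
    proof (rule yk(3)[OF shifted_midpoint[OF Sk(1) yk(1) w(1)]])
      \<comment> \<open>Feasibility says something only at \<open>\<rho>k k = 0\<close>, where it
        follows from convexity of the ball of radius \<open>c\<^sub>3\<close>.\<close>
      show "feasible (\<rho>k k) (state_comb (1/2) (yk k) (1/2) w)"
        unfolding feasible_def
      proof
        assume z: "\<rho>k k = 0"
        have "AE x in M. norm (snd (yk k) x) \<le> c\<^sub>3" "AE x in M. norm (snd w x) \<le> c\<^sub>3"
          using yk(2)[of k] fw z by (auto simp: feasible_def)
        then show "AE x in M. norm (snd (state_comb (1/2) (yk k) (1/2) w) x) \<le> c\<^sub>3"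
        proof eventually_elim
          case (elim x)
          have "norm (snd (state_comb (1/2) (yk k) (1/2) w) x) \<le> 1/2 * norm (snd (yk k) x) + 1/2 * norm (snd w x)"
            unfolding state_comb_def by (simp, rule order_trans[OF norm_triangle_ineq]) simp
          with elim show ?case by simp
        qed
      qed
    qed
    also have "\<dots> \<le> 1/2 * energy (\<rho>k k) (zpk k) l (yk k) + 1/2 * energy (\<rho>k k) (zpk k) l w - \<kappa> * (Y_dist \<Omega> (yk k) w)\<^sup>2"
      by (rule \<kappa>(2)[OF \<rho>k zpk l ykY wY shifted_diff_zero_trace[OF Sk(1) yk(1) w(1)]])
    finally have 1: "\<kappa> * (Y_dist \<Omega> (yk k) w)\<^sup>2 \<le> 1/2 * (energy (\<rho>k k) (zpk k) l w - energy (\<rho>k k) (zpk k) l (yk k))"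
      by simp
    have 2: "energy (\<rho>k k) (zpk k) l w \<le> energy (\<rho>k k) zp l w + \<eta>" "energy (\<rho>k k) zp l (yk k) \<le> energy (\<rho>k k) (zpk k) l (yk k) + \<eta>"
      using K(2)[OF \<rho>k[of k] zpk[of k] zp wY, of l] K(2)[OF \<rho>k[of k] zpk[of k] zp ykY, of l] elim(1) by linarith+
    \<comment> \<open>No error term is needed in this direction: \<open>w\<close> obeys the
      constraint whenever the limit is 0, and then its energy at any \<rho> is at most the one at
      0.\<close>
    have 3: "energy (\<rho>k k) zp l w \<le> energy \<rho> zp l w"
    proof (cases "\<rho>k k = \<rho>")
      case False
      then have "\<rho> = 0" using \<rho> by auto
      then show ?thesis using energy_le_energy_0[OF \<rho>k zp wY] w(2) by simp
    qed simp
    have "Kc * (1 + Y_dist \<Omega> w y) * Y_dist \<Omega> w y \<le> Kc * 2 * \<delta>"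
      using Kc(1) w(3) \<delta>(3) Y_dist_nonneg[of w y] by (intro mult_mono) auto
    also have "\<dots> \<le> \<eta>" using \<delta>(4) Kc(1) by (simp add: field_simps)
    finally have 4: "energy \<rho> zp l w \<le> energy \<rho> zp l y + \<eta>" using Kc(2)[OF wY] by linarith
    have "\<kappa> * (Y_dist \<Omega> (yk k) w)\<^sup>2 \<le> 2 * \<eta>"
    proof -
      have "energy (\<rho>k k) (zpk k) l w - energy (\<rho>k k) (zpk k) l (yk k) \<le> 4 * \<eta>"
        using 2 3 4 elim(2) by linarith
      with 1 show ?thesis by simp
    qed
    also have "\<dots> < \<kappa> * (e/2)\<^sup>2" using \<kappa>(1) e by (simp add: \<eta>_def)
    finally have "(Y_dist \<Omega> (yk k) w)\<^sup>2 < (e/2)\<^sup>2" using \<kappa>(1) by simp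
    then have "Y_dist \<Omega> (yk k) w < e/2" using e by (intro power2_less_imp_less[of _ "e/2"]) auto
    then show "Y_dist \<Omega> (yk k) y < e" using Y_dist_triangle[OF ykY wY yY] w(3) \<delta>(2) by linarith
  qed
qed

end

section \<open>Recovery sequences in the discrete spaces\<close>

context energy
begin

lemma Y_h0_subset:
  "Y_h0 \<Omega> \<Gamma> U Z h \<subseteq> Y_h0 \<Omega> \<Gamma> U Z 0"
  by (auto simp: Y_h0_def)

text \<open>The two components are approximated by different means. Density of the homogeneous
  spaces provides the displacement with the right boundary values, and the \<open>z\<close>
  component of that approximation is discarded because it may violate the constraint;
  \<open>r\<close> provides one that respects it.\<close>

lemma ex_recovery:
  assumes approx: "space_approximation \<Omega> \<Gamma> c\<^sub>3 U Z q r" and v: "v \<in> H1 \<Omega>"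
    and hs: "\<And>k. 0 \<le> hs k" "hs \<longlonglongrightarrow> 0"
    and y: "y \<in> shifted v (Y_h0 \<Omega> \<Gamma> U Z 0)" "feasible \<rho> y" and e: "e > 0"
  shows "\<forall>\<^sub>F k in sequentially. \<exists>w\<in>shifted v (Y_h0 \<Omega> \<Gamma> U Z (hs k)). feasible \<rho> w \<and> Y_dist \<Omega> w y < e"
proof -
  have S0: "admissible_variations \<Omega> \<Gamma> (Y_h0 \<Omega> \<Gamma> U Z 0)" by (rule admissible_variations_Y_h0[OF approx]) simp
  note yY = shifted_Yspace[OF S0 v y(1)]
  have zy: "snd y \<in> Zspace \<Omega>" using yY by (auto simp: Yspace_def)
  have e2: "e/2 > 0" using e by simp
  have "(\<lambda>x. fst y x - v x, snd y) \<in> Y_bc \<Omega> \<Gamma> (\<lambda>x. 0)"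
    using y(1) by (auto simp: shifted_def Y_h0_def)
  moreover have "dense_in_Y \<Omega> (\<Union>h\<in>{0<..}. Y_h0 \<Omega> \<Gamma> U Z h) (Y_bc \<Omega> \<Gamma> (\<lambda>x. 0))"
    using approx unfolding space_approximation_def by (elim conjE)
  ultimately obtain a where a: "a \<in> (\<Union>h\<in>{0<..}. Y_h0 \<Omega> \<Gamma> U Z h)" "Y_dist \<Omega> a (\<lambda>x. fst y x - v x, snd y) < e/2"
    using e2 unfolding dense_in_Y_def by blast
  then obtain h where h: "h > 0" "a \<in> Y_h0 \<Omega> \<Gamma> U Z h" by auto
  have ah: "fst a \<in> U h" "snd a \<in> Z h" "has_trace \<Omega> \<Gamma> (fst a) (\<lambda>x. 0)" "fst a \<in> H1 \<Omega>"
    using h by (auto simp: Y_h0_def Y_bc_def Yspace_def equal_on_boundary_def)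
  have mono: "\<forall>h h'. 0 < h' \<and> h' \<le> h \<longrightarrow> U h \<times> Z h \<subseteq> U h' \<times> Z h'"
    and rZ: "\<forall>h>0. \<forall>z\<in>Zspace \<Omega>. r h z \<in> Z h"
    and ZZ: "\<forall>h>0. closed_subspace_of_H1 \<Omega> (U h) \<and> closed_subspace_of_H1 \<Omega> (Z h) \<and> Z h \<subseteq> Zspace \<Omega>"
    and rlim: "\<forall>z\<in>Zspace \<Omega>. ((\<lambda>h. H1_norm \<Omega> (\<lambda>x. r h z x - z x)) \<longlongrightarrow> 0) (at_right 0)"
    and rbd: "\<forall>h>0. \<forall>z\<in>Zspace \<Omega>. (AE x in M. norm (z x) \<le> c\<^sub>3) \<longrightarrow> (AE x in M. norm (r h z x) \<le> c\<^sub>3)"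
    using approx unfolding space_approximation_def by - (elim conjE, assumption)+
  from order_tendstoD(2)[OF rlim[rule_format, OF zy] e2]
  obtain d where d: "d > 0" "\<And>h. 0 < h \<Longrightarrow> h < d \<Longrightarrow> H1_norm \<Omega> (\<lambda>x. r h (snd y) x - snd y x) < e/2"
    unfolding eventually_at_right_field by blast
  \<comment> \<open>Below \<open>h\<close> the nested spaces contain the displacement already
    chosen, and below \<open>d\<close> the operator \<open>r\<close> is accurate enough at
    \<open>snd y\<close>.\<close>
  have "0 < min h d" using h(1) d(1) by simp
  from order_tendstoD(2)[OF hs(2) this] show ?thesis
  proof eventually_elim
    case (elim k)
    show ?case
    \<comment> \<open>The sequence may contain zeros; there the space is the full one and
      \<open>y\<close> recovers itself.\<close>
    proof (cases "hs k = 0")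
      case True
      then show ?thesis using y e Y_dist_self[OF yY] by (intro bexI[of _ y]) auto
    next
      case False
      then have hk: "0 < hs k" "hs k \<le> h" "hs k < d" using hs(1)[of k] elim by auto
      define z where "z = r (hs k) (snd y)"
      define w where "w = (\<lambda>x. fst a x + v x, z)"
      have "fst a \<in> U (hs k)" using mono[rule_format, of "hs k" h] hk ah(1,2) by blast
      moreover have zZ: "z \<in> Z (hs k)" "z \<in> Zspace \<Omega>" unfolding z_def using rZ ZZ hk(1) zy by blast+
      ultimately have "w \<in> shifted v (Y_h0 \<Omega> \<Gamma> U Z (hs k))"
        using False ah(3,4) by (auto simp: w_def shifted_def Y_h0_def Y_bc_def Yspace_def equal_on_boundary_def)
      moreover have "feasible \<rho> w"
        using y(2) rbd[rule_format, OF hk(1) zy] by (simp add: feasible_def w_def z_def)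
      moreover have "Y_dist \<Omega> w y < e"
      proof -
        have "(\<lambda>x. fst w x - fst y x) = (\<lambda>x. fst a x - (fst y x - v x))"
          by (simp add: w_def algebra_simps fun_eq_iff)
        then have "H1_norm \<Omega> (\<lambda>x. fst w x - fst y x) < e/2"
          using H1_norm_le_Y_dist(1)[of a "(\<lambda>x. fst y x - v x, snd y)"] a(2) by simp
        moreover have "H1_norm \<Omega> (\<lambda>x. snd w x - snd y x) < e/2"
          using d(2)[OF hk(1,3)] by (simp add: w_def z_def)
        ultimately show ?thesis using Y_dist_le_add[of w y] by linarith
      qed
      ultimately show ?thesis by blast
    qed
  qed
qed

end

text \<open>The index depends on the time and the partition but not on \<open>y\<close>, so one
  index serves all parameters and convergence of the interpolants is convergence at one
  node.\<close>

lemma interpolant_eq: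
  assumes "\<And>i. i < N \<Longrightarrow> t i < t (Suc i)" "t 0 = 0" "0 \<le> \<tau>" "\<tau> \<le> t N"
  obtains i where "i \<le> N" "\<And>y. interpolant t N y \<tau> = y i"
proof (cases "\<tau> = t N")
  case True
  then show ?thesis by (intro that[of N]) (simp_all add: interpolant_def)
next
  case False
  have mono: "t i \<le> t j" if "i \<le> j" "j \<le> N" for i j
    using that by (induction j rule: dec_induct) (use assms(1) in \<open>auto intro: order_trans[OF _ less_imp_le]\<close>)
  let ?P = "\<lambda>i. i < N \<and> t i \<le> \<tau> \<and> \<tau> < t (Suc i)"
  have "\<exists>i. ?P i"
  proof (rule ccontr)
    assume no: "\<nexists>i. ?P i"
    have "t i \<le> \<tau>" if "i \<le> N" for i
      using that
    proof (induction i)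
      case 0
      then show ?case using assms by simp
    next
      case (Suc i)
      then show ?case using no by (meson Suc_le_lessD less_imp_le not_le)
    qed
    then show False using False assms(4) by (meson antisym order_refl)
  qed
  then obtain i where i: "?P i" by blast
  have "(THE i. ?P i) = i"
  proof (rule the_equality)
    show "?P i" by (rule i)
    fix j assume j: "?P j"
    show "j = i"
    proof (rule linorder_cases[of i j])
      assume "i < j"
      then show ?thesis using mono[of "Suc i" j] i j by simp
    next
      assume "j < i"
      then show ?thesis using mono[of "Suc j" i] i j by simp
    qed simp
  qed
  then show ?thesis using False i by (intro that[of i]) (simp_all add: interpolant_def)
qed

theorem theorem7p7:
  fixes \<Omega> \<Gamma>\<^sub>D \<Gamma>\<^sub>t :: "(real^3) set"
    and \<C> :: "real^3^3 \<Rightarrow> real^3^3"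
    and c\<^sub>1 c\<^sub>2 c\<^sub>3 \<nu> :: real
    and \<phi> :: "real \<Rightarrow> real"
    and D :: "real^3^3 \<Rightarrow> real"
    and U :: "real \<Rightarrow> (real^3 \<Rightarrow> real^3) set"
    and Z :: "real \<Rightarrow> (real^3 \<Rightarrow> real^3^3) set"
    and q :: "real \<Rightarrow> (real^3 \<Rightarrow> real^3) \<Rightarrow> (real^3 \<Rightarrow> real^3)"
    and r :: "real \<Rightarrow> (real^3 \<Rightarrow> real^3^3) \<Rightarrow> (real^3 \<Rightarrow> real^3^3)"
    and N :: nat and t :: "nat \<Rightarrow> real" and T :: real
    and uDir :: "nat \<Rightarrow> real^3 \<Rightarrow> real^3"
    and l :: "nat \<Rightarrow> (real^3 \<Rightarrow> real^3) \<Rightarrow> real"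
    and u\<^sub>0 :: "real^3 \<Rightarrow> real^3" and z\<^sub>0 :: "real^3 \<Rightarrow> real^3^3"
    and \<rho>s hs :: "nat \<Rightarrow> real" and \<rho> h :: real
    and y :: "real \<Rightarrow> real \<Rightarrow> nat \<Rightarrow> (real^3 \<Rightarrow> real^3) \<times> (real^3 \<Rightarrow> real^3^3)"
  assumes domain: "admissible_domain \<Omega> \<Gamma>\<^sub>D \<Gamma>\<^sub>t"
    and elasticity: "elasticity_tensor \<C>"
    and constants: "c\<^sub>1 > 0" "c\<^sub>2 > 0" "c\<^sub>3 > 0" "\<nu> > 0"
    and pen: "penalty c\<^sub>3 \<phi>"
    and diss: "dissipation_potential D"
    and approx: "space_approximation \<Omega> \<Gamma>\<^sub>D c\<^sub>3 U Z q r"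
    and partition: "0 < N" "t 0 = 0" "t N = T" "\<And>i. i < N \<Longrightarrow> t i < t (Suc i)"
    and rho_nonneg: "\<And>k. 0 \<le> \<rho>s k" and rho_lim: "\<rho>s \<longlonglongrightarrow> \<rho>"
    and rho_cases: "(\<exists>c. \<forall>k. \<rho>s k = c) \<or> \<rho>s \<longlonglongrightarrow> 0"
    and h_nonneg: "\<And>k. 0 \<le> hs k" and h_lim: "hs \<longlonglongrightarrow> h"
    and h_cases: "(\<exists>c. \<forall>k. hs k = c) \<or> hs \<longlonglongrightarrow> 0"
    and dirichlet: "\<And>i. i \<le> N \<Longrightarrow> uDir i \<in> H1 \<Omega>"
      "\<And>i h'. i \<le> N \<Longrightarrow> h' \<in> insert h (range hs) \<Longrightarrow> h' > 0 \<Longrightarrow> uDir i \<in> U h'"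
    and loads: "\<And>i. i \<le> N \<Longrightarrow> l i \<in> H1_dual \<Omega>"
    and initial: "\<And>h'. h' \<in> insert h (range hs) \<Longrightarrow>
      (u\<^sub>0, z\<^sub>0) \<in> shifted (uDir 0) (Y_h0 \<Omega> \<Gamma>\<^sub>D U Z h')"
    and solutions: "\<And>\<rho>' h'. (\<rho>', h') \<in> insert (\<rho>, h) (range (\<lambda>k. (\<rho>s k, hs k))) \<Longrightarrow>
      incremental_solution \<Omega> (stored_energy \<Omega> \<C> (hardening c\<^sub>1 c\<^sub>2 c\<^sub>3 \<phi> \<rho>') \<nu>) D
        (Y_h0 \<Omega> \<Gamma>\<^sub>D U Z h') N uDir l (u\<^sub>0, z\<^sub>0) (y \<rho>' h')"
  shows "\<forall>\<tau>\<in>{0..T}. tendsto_Y \<Omega>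
    (\<lambda>k. interpolant t N (y (\<rho>s k) (hs k)) \<tau>) (interpolant t N (y \<rho> h) \<tau>)"
proof -
  interpret energy \<Omega> \<C> c\<^sub>1 c\<^sub>2 c\<^sub>3 \<nu> \<phi> D \<Gamma>\<^sub>D
    by unfold_locales (use domain elasticity constants pen diss in \<open>simp_all add: admissible_domain_def\<close>)
  let ?S = "\<lambda>h. Y_h0 \<Omega> \<Gamma>\<^sub>D U Z h"
  have rho0: "0 \<le> \<rho>" using LIMSEQ_le_const[OF rho_lim] rho_nonneg by blast
  have h0: "0 \<le> h" using LIMSEQ_le_const[OF h_lim] h_nonneg by blast
  \<comment> \<open>A constant sequence has its constant as limit, a vanishing one has limit 0;
    \<open>time_step_convergence\<close> is stated for exactly these alternatives.\<close>
  have rho: "(\<forall>k. \<rho>s k = \<rho>) \<or> \<rho> = 0 \<and> \<rho>s \<longlonglongrightarrow> 0"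
    using rho_cases
  proof
    assume "\<exists>c. \<forall>k. \<rho>s k = c"
    then obtain c where c: "\<And>k. \<rho>s k = c" by blast
    then have "\<rho>s = (\<lambda>_. c)" by (rule ext)
    then have "\<rho>s \<longlonglongrightarrow> c" by simp
    with rho_lim have "\<rho> = c" by (rule LIMSEQ_unique)
    then show ?thesis using c by simp
  next
    assume "\<rho>s \<longlonglongrightarrow> 0"
    then show ?thesis using LIMSEQ_unique[OF rho_lim] by simp
  qed
  have h: "(\<forall>k. hs k = h) \<or> h = 0 \<and> hs \<longlonglongrightarrow> 0"
    using h_cases
  proof
    assume "\<exists>c. \<forall>k. hs k = c"
    then obtain c where c: "\<And>k. hs k = c" by blast
    then have "hs = (\<lambda>_. c)" by (rule ext)
    then have "hs \<longlonglongrightarrow> c" by simp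
    with h_lim have "h = c" by (rule LIMSEQ_unique)
    then show ?thesis using c by simp
  next
    assume "hs \<longlonglongrightarrow> 0"
    then show ?thesis using LIMSEQ_unique[OF h_lim] by simp
  qed
  have S: "admissible_variations \<Omega> \<Gamma>\<^sub>D (?S h)" by (rule admissible_variations_Y_h0[OF approx h0])
  have Sk: "admissible_variations \<Omega> \<Gamma>\<^sub>D (?S (hs k))" for k by (rule admissible_variations_Y_h0[OF approx h_nonneg])
  \<comment> \<open>Either all spaces coincide, or the limit space is the full space with zero
    trace, which contains every discrete one.\<close>
  have Sk_sub: "?S (hs k) \<subseteq> ?S h" for k
    using h Y_h0_subset[of U Z "hs k"] by auto
  have sol: "incremental_solution \<Omega> (stored_energy \<Omega> \<C> (hardening c\<^sub>1 c\<^sub>2 c\<^sub>3 \<phi> \<rho>) \<nu>) D (?S h) N uDir l (u\<^sub>0, z\<^sub>0) (y \<rho> h)"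
    by (rule solutions) simp
  have solk: "incremental_solution \<Omega> (stored_energy \<Omega> \<C> (hardening c\<^sub>1 c\<^sub>2 c\<^sub>3 \<phi> (\<rho>s k)) \<nu>) D (?S (hs k)) N uDir l (u\<^sub>0, z\<^sub>0) (y (\<rho>s k) (hs k))" for k
    by (rule solutions) simp
  \<comment> \<open>Induction over the time steps. At step 0 all solutions share the same initial
    datum; afterwards the convergence of the previous internal variable is the datum that changes
    with \<open>k\<close> in the functional besides \<rho>.\<close>
  have main: "tendsto_Y \<Omega> (\<lambda>k. y (\<rho>s k) (hs k) i) (y \<rho> h i)" if "i \<le> N" for i
    using that
  proof (induction i)
    case 0
    have eq: "y \<rho> h 0 = (u\<^sub>0, z\<^sub>0)" "\<And>k. y (\<rho>s k) (hs k) 0 = (u\<^sub>0, z\<^sub>0)"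
      using sol solk by (simp_all add: incremental_solution_def)
    have "(u\<^sub>0, z\<^sub>0) \<in> Yspace \<Omega>"
      by (rule shifted_Yspace[OF S dirichlet(1)[OF le0] initial]) simp
    then show ?case by (simp add: tendsto_Y_def eq Y_dist_self)
  next
    case (Suc i)
    then have IH: "tendsto_Y \<Omega> (\<lambda>k. y (\<rho>s k) (hs k) i) (y \<rho> h i)" by simp
    have i: "Suc i \<in> {1..N}" using Suc.prems by simp
    have v: "uDir (Suc i) \<in> H1 \<Omega>" and l: "l (Suc i) \<in> H1_dual \<Omega>" using Suc.prems dirichlet(1) loads by auto
    have prevY: "y \<rho> h i \<in> Yspace \<Omega>" "\<And>k. y (\<rho>s k) (hs k) i \<in> Yspace \<Omega>"
      and dist: "(\<lambda>k. Y_dist \<Omega> (y (\<rho>s k) (hs k) i) (y \<rho> h i)) \<longlonglongrightarrow> 0"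
      using IH by (simp_all add: tendsto_Y_def)
    have zp: "snd (y \<rho> h i) \<in> Zspace \<Omega>" "\<And>k. snd (y (\<rho>s k) (hs k) i) \<in> Zspace \<Omega>"
      using prevY by (auto simp: Yspace_def mem_Times_iff)
    have am: "is_arg_min (\<lambda>(u, z). stored_energy \<Omega> \<C> (hardening c\<^sub>1 c\<^sub>2 c\<^sub>3 \<phi> \<rho>) \<nu> (u, z) - ereal (l (Suc i) u)
        + dissipation \<Omega> D (\<lambda>x. z x - snd (y \<rho> h i) x)) (\<lambda>w. w \<in> shifted (uDir (Suc i)) (?S h)) (y \<rho> h (Suc i))"
      using sol i unfolding incremental_solution_def by fastforce
    have amk: "is_arg_min (\<lambda>(u, z). stored_energy \<Omega> \<C> (hardening c\<^sub>1 c\<^sub>2 c\<^sub>3 \<phi> (\<rho>s k)) \<nu> (u, z) - ereal (l (Suc i) u)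
        + dissipation \<Omega> D (\<lambda>x. z x - snd (y (\<rho>s k) (hs k) i) x)) (\<lambda>w. w \<in> shifted (uDir (Suc i)) (?S (hs k))) (y (\<rho>s k) (hs k) (Suc i))" for k
      using solk[of k] i unfolding incremental_solution_def by fastforce
    note m = arg_min_energy[OF rho0 zp(1) S v am]
    note mk = arg_min_energy[OF rho_nonneg zp(2) Sk v amk]
    have zlim: "(\<lambda>k. L2_norm \<Omega> (\<lambda>x. snd (y (\<rho>s k) (hs k) i) x - snd (y \<rho> h i) x)) \<longlonglongrightarrow> 0"
    proof (rule tendsto_sandwich[OF _ _ tendsto_const dist])
      show "\<forall>\<^sub>F k in sequentially. L2_norm \<Omega> (\<lambda>x. snd (y (\<rho>s k) (hs k) i) x - snd (y \<rho> h i) x) \<le> Y_dist \<Omega> (y (\<rho>s k) (hs k) i) (y \<rho> h i)"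
        using order_trans[OF L2_norm_le_H1_norm_diff H1_norm_le_Y_dist(2)] Yspace_H1(2)[OF prevY(1)] Yspace_H1(2)[OF prevY(2)]
        by simp
    qed simp
    have recovery: "\<forall>\<^sub>F k in sequentially. \<exists>w\<in>shifted (uDir (Suc i)) (?S (hs k)). feasible \<rho> w \<and> Y_dist \<Omega> w (y \<rho> h (Suc i)) < e"
      if "e > 0" for e
      using h
    proof
      assume "\<forall>k. hs k = h"
      then show ?thesis
        using m(1,2) Y_dist_self[OF shifted_Yspace[OF S v m(1)]] that by (intro always_eventually allI bexI[of _ "y \<rho> h (Suc i)"]) auto
    next
      assume hz: "h = 0 \<and> hs \<longlonglongrightarrow> 0"
      then have "y \<rho> h (Suc i) \<in> shifted (uDir (Suc i)) (?S 0)" using m(1) by simp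
      then show ?thesis
        by (rule ex_recovery[OF approx v h_nonneg conjunct2[OF hz] _ m(2) that])
    qed
    have "(\<lambda>k. Y_dist \<Omega> (y (\<rho>s k) (hs k) (Suc i)) (y \<rho> h (Suc i))) \<longlonglongrightarrow> 0"
      by (rule time_step_convergence[OF S Sk Sk_sub v l Zspace_L2[OF zp(1)] Zspace_L2[OF zp(2)] zlim rho_nonneg rho m mk recovery])
    then show ?case
      using shifted_Yspace[OF S v m(1)] shifted_Yspace[OF Sk v mk(1)] by (simp add: tendsto_Y_def)
  qed
  show ?thesis
  proof
    fix \<tau> assume "\<tau> \<in> {0..T}"
    then have "0 \<le> \<tau>" "\<tau> \<le> t N" using partition(3) by simp_all
    then obtain i where i: "i \<le> N" "\<And>y :: nat \<Rightarrow> state. interpolant t N y \<tau> = y i"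
      using interpolant_eq[of N t \<tau>] partition(2,4) by metis
    show "tendsto_Y \<Omega> (\<lambda>k. interpolant t N (y (\<rho>s k) (hs k)) \<tau>) (interpolant t N (y \<rho> h) \<tau>)"
      unfolding i(2) by (rule main[OF i(1)])
  qed
qed

end
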